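(* For any cosimplicial 2-groupoid $\mathcal{G}^\bullet$, there is a (natural) isomorphism of sets $$\overline{Desc}(\mathcal{G}^\bullet)\cong \pi_0\,Tot_r(r\mathbb{N}\mathcal{G}^\bullet).$$
   Context: **2-groupoids.** A (strict) 2-groupoid is a small category enriched in groupoids in which all morphisms are invertible: it has objects, 1-morphisms $f:x\to y$, and 2-morphisms $a:f\Rightarrow g$ between parallel 1-morphisms, with a strictly associative and unital composition $\circ$ of 1-morphisms, a vertical composition $*$ of 2-morphisms ($b*a$ is $a$ followed by $b$) and a horizontal composition $\circ$ of 2-morphisms satisfying the usual associativity, unit and interchange laws, and all 1- and 2-morphisms are invertible. $2\mathcal{G}pd$ is the category of 2-groupoids and strict 2-functors. **2-nerve.** A simplicial set $X$ is 3-coskeletal if the canonical map $X\to Cosk_3X$ is an isomorphism (such an $X$ is determined by its 3-truncation). The 2-nerve $\mathbb{N}:2\mathcal{G}pd\to s\mathcal{S}et$ sends $\mathcal{G}$ to the 3-coskeletal simplicial set $\mathbb{N}\mathcal{G}$ whose 0-simplices are the objects of $\mathcal{G}$; whose 1-simplices are the 1-morphisms; whose 2-simplices are the data of objects $x_0,x_1,x_2$, 1-morphisms $g_{ij}:x_i\to x_j$ ($i<j$) and a 2-morphism $a_{012}:g_{02}\Rightarrow g_{12}\circ g_{01}$; and whose 3-simplices are the data of objects $x_0,\dots,x_3$, 1-morphisms $g_{ij}:x_i\to x_j$ ($i<j$) and 2-morphisms $a_{ijk}:g_{ik}\Rightarrow g_{jk}\circ g_{ij}$ ($i<j<k$) such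 that $(1_{g_{23}}\circ a_{012})*a_{023}=(a_{123}\circ 1_{g_{01}})*a_{013}$. Faces and degeneracies are the evident ones. **Cosimplicial objects.** $\mathbb{\Delta}$ is the category of finite non-empty ordinals $[n]=\{0,\dots,n\}$ and weakly order preserving maps; $\mathbb{\Delta}_r\subset\mathbb{\Delta}$ is the subcategory with the same objects and only the injective maps. A cosimplicial (resp. restricted cosimplicial) object of $\mathcal{C}$ is a functor $\mathbb{\Delta}\to\mathcal{C}$ (resp. $\mathbb{\Delta}_r\to\mathcal{C}$); $d^i$ denotes the coface maps (induced by the injection skipping $i$), and $r$ denotes restriction along $\mathbb{\Delta}_r\subset\mathbb{\Delta}$. For a cosimplicial 2-groupoid $\mathcal{G}^\bullet$, $\mathbb{N}\mathcal{G}^\bullet$ is obtained by applying $\mathbb{N}$ in each cosimplicial degree. $\Delta^\bullet$ is the cosimplicial simplicial set with $\Delta^n$ in cosimplicial degree $n$. **Restricted totalization.** For a restricted cosimplicial simplicial set $X^\bullet$, $Tot_r(X^\bullet)$ is the simplicial set whose $n$-simplices are the natural transformations $r\Delta^\bullet\times\Delta^n\to X^\bullet$ of functors $\mathbb{\Delta}_r\to s\mathcal{S}et$ (with $\Delta^n$ constant in the cosimplicial direction), with simplicial structure induced from $\Delta^n$. **Descent data.** A descent datum of a cosimplicial 2-groupoid $\mathcal{G}^\bullet$ is a triple $(x,g,a)$ where $x$ is an object of $\mathcal{G}^0$, $g:d^1x\to d^0x$ is a 1-morphism in $\mathcal{G}^1$, and $a:d^1g\Rightarrow d^0g\circ d^2g$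 is a 2-morphism in $\mathcal{G}^2$ such that in $\mathcal{G}^3$ $$(1_{d^1d^0g}\circ d^3a)*d^1a=(d^0a\circ 1_{d^2d^2g})*d^2a .$$ $Desc(\mathcal{G}^\bullet)$ is the set of descent data. **Gauge transformations.** Let $\mathbf{d}=(x,g,a)$ and $\mathbf{d}'=(x',g',a')$ be descent data. A gauge transformation $\mathbf{d}\leadsto\mathbf{d}'$ is a pair $(f,c)$ where $f:x\to x'$ is a 1-morphism in $\mathcal{G}^0$ and $c:d^0f\circ g\Rightarrow g'\circ d^1f$ is a 2-morphism in $\mathcal{G}^1$, such that the following prism in $\mathcal{G}^2$ commutes. Write in $\mathcal{G}^2$: $f_0=d^2d^1f$, $f_1=d^2d^0f$, $f_2=d^1d^0f$; $g_{01}=d^2g$, $g_{02}=d^1g$, $g_{12}=d^0g$ and similarly $g'_{ij}$; $c_{01}=d^2c$, $c_{02}=d^1c$, $c_{12}=d^0c$, so $c_{ij}:f_j\circ g_{ij}\Rightarrow g'_{ij}\circ f_i$. Commutativity of the prism means $$(1_{g'_{12}}\circ c_{01})*(c_{12}\circ 1_{g_{01}})*(1_{f_2}\circ a)=(a'\circ 1_{f_0})*c_{02}$$ as 2-morphisms $f_2\circ g_{02}\Rightarrow g'_{12}\circ g'_{01}\circ f_0$. The relation "there exists a gauge transformation $\mathbf{d}\leadsto\mathbf{d}'$" is an equivalence relation on $Desc(\mathcal{G}^\bullet)$, and $\overline{Desc}(\mathcal{G}^\bullet)$ denotes the quotient set. *)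

theory Defs
  imports Main "HOL-Library.FuncSet"
begin

section \<open>The category of finite ordinals\<close>

text \<open>The ordinal \<open>[n]\<close> is \<open>{..n}\<close>. Maps are extensional (see \<^theory>\<open>HOL-Library.FuncSet\<close>), so that
  equality of functions is equality of maps; composition is \<^const>\<open>compose\<close>.\<close>

definition Delta :: "nat \<Rightarrow> nat \<Rightarrow> (nat \<Rightarrow> nat) set" where
  "Delta m n = {\<alpha> \<in> {..m} \<rightarrow>\<^sub>E {..n}. mono_on {..m} \<alpha>}"

definition Delta_r :: "nat \<Rightarrow> nat \<Rightarrow> (nat \<Rightarrow> nat) set" where
  "Delta_r m n = {\<alpha> \<in> Delta m n. inj_on \<alpha> {..m}}"

definition ord_id :: "nat \<Rightarrow> nat \<Rightarrow> nat" where
  "ord_id n = (\<lambda>k\<in>{..n}. k)"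

text \<open>The injection \<open>[n] \<rightarrow> [n+1]\<close> skipping \<open>i\<close>.\<close>

definition skip :: "nat \<Rightarrow> nat \<Rightarrow> nat \<Rightarrow> nat" where
  "skip n i = (\<lambda>k\<in>{..n}. if k < i then k else Suc k)"


section \<open>Strict 2-groupoids and strict 2-functors\<close>

record ('o, 'm, 'c) two_groupoid =
  Obj :: "'o set"
  Mor :: "'m set"
  Cell :: "'c set"
  src :: "'m \<Rightarrow> 'o"
  tgt :: "'m \<Rightarrow> 'o"
  src2 :: "'c \<Rightarrow> 'm"
  tgt2 :: "'c \<Rightarrow> 'm"
  id1 :: "'o \<Rightarrow> 'm"
  id2 :: "'m \<Rightarrow> 'c"
  comp1 :: "'m \<Rightarrow> 'm \<Rightarrow> 'm" (infixr "\<odot>\<index>" 72)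
  vcomp :: "'c \<Rightarrow> 'c \<Rightarrow> 'c" (infixr "\<star>\<index>" 70)
  hcomp :: "'c \<Rightarrow> 'c \<Rightarrow> 'c" (infixr "\<diamondop>\<index>" 72)

definition Hom1 :: "('o, 'm, 'c) two_groupoid \<Rightarrow> 'o \<Rightarrow> 'o \<Rightarrow> 'm set" where
  "Hom1 G x y = {f \<in> Mor G. src G f = x \<and> tgt G f = y}"

definition Hom2 :: "('o, 'm, 'c) two_groupoid \<Rightarrow> 'm \<Rightarrow> 'm \<Rightarrow> 'c set" where
  "Hom2 G f g = {a \<in> Cell G. src2 G a = f \<and> tgt2 G a = g}"

text \<open>All compositions are written in functional order: \<open>g \<odot> f\<close>, \<open>b \<star> a\<close> (vertical) and
  \<open>b \<diamondop> a\<close> (horizontal) mean the second argument followed by the first.\<close>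

locale two_groupoid =
  fixes G :: "('o, 'm, 'c) two_groupoid" (structure)
  assumes src_closed: "f \<in> Mor G \<Longrightarrow> src G f \<in> Obj G"
    and tgt_closed: "f \<in> Mor G \<Longrightarrow> tgt G f \<in> Obj G"
    and id1_closed: "x \<in> Obj G \<Longrightarrow> id1 G x \<in> Hom1 G x x"
    and comp1_closed: "\<lbrakk>f \<in> Hom1 G x y; g \<in> Hom1 G y z\<rbrakk> \<Longrightarrow> g \<odot> f \<in> Hom1 G x z"
    and comp1_assoc: "\<lbrakk>f \<in> Hom1 G w x; g \<in> Hom1 G x y; h \<in> Hom1 G y z\<rbrakk>
      \<Longrightarrow> (h \<odot> g) \<odot> f = h \<odot> (g \<odot> f)"
    and comp1_id_left: "f \<in> Hom1 G x y \<Longrightarrow> id1 G y \<odot> f = f"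
    and comp1_id_right: "f \<in> Hom1 G x y \<Longrightarrow> f \<odot> id1 G x = f"
    and inverse1: "f \<in> Hom1 G x y \<Longrightarrow> \<exists>g\<in>Hom1 G y x. g \<odot> f = id1 G x \<and> f \<odot> g = id1 G y"
    and src2_closed: "a \<in> Cell G \<Longrightarrow> src2 G a \<in> Mor G"
    and tgt2_closed: "a \<in> Cell G \<Longrightarrow> tgt2 G a \<in> Mor G"
    and parallel: "a \<in> Cell G \<Longrightarrow>
      src G (src2 G a) = src G (tgt2 G a) \<and> tgt G (src2 G a) = tgt G (tgt2 G a)"
    and id2_closed: "f \<in> Mor G \<Longrightarrow> id2 G f \<in> Hom2 G f f"
    and vcomp_closed: "\<lbrakk>a \<in> Hom2 G f g; b \<in> Hom2 G g h\<rbrakk> \<Longrightarrow> b \<star> a \<in> Hom2 G f h"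
    and vcomp_assoc: "\<lbrakk>a \<in> Hom2 G f g; b \<in> Hom2 G g h; c \<in> Hom2 G h k\<rbrakk>
      \<Longrightarrow> (c \<star> b) \<star> a = c \<star> (b \<star> a)"
    and vcomp_id_left: "a \<in> Hom2 G f g \<Longrightarrow> id2 G g \<star> a = a"
    and vcomp_id_right: "a \<in> Hom2 G f g \<Longrightarrow> a \<star> id2 G f = a"
    and inverse2: "a \<in> Hom2 G f g \<Longrightarrow> \<exists>b\<in>Hom2 G g f. b \<star> a = id2 G f \<and> a \<star> b = id2 G g"
    and hcomp_closed: "\<lbrakk>f \<in> Hom1 G x y; g \<in> Hom1 G y z; a \<in> Hom2 G f f'; b \<in> Hom2 G g g'\<rbrakk>
      \<Longrightarrow> b \<diamondop> a \<in> Hom2 G (g \<odot> f) (g' \<odot> f')"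
    and hcomp_assoc: "\<lbrakk>f \<in> Hom1 G w x; g \<in> Hom1 G x y; h \<in> Hom1 G y z;
        a \<in> Hom2 G f f'; b \<in> Hom2 G g g'; c \<in> Hom2 G h h'\<rbrakk>
      \<Longrightarrow> (c \<diamondop> b) \<diamondop> a = c \<diamondop> (b \<diamondop> a)"
    and hcomp_id_left: "\<lbrakk>f \<in> Hom1 G x y; a \<in> Hom2 G f f'\<rbrakk> \<Longrightarrow> id2 G (id1 G y) \<diamondop> a = a"
    and hcomp_id_right: "\<lbrakk>f \<in> Hom1 G x y; a \<in> Hom2 G f f'\<rbrakk> \<Longrightarrow> a \<diamondop> id2 G (id1 G x) = a"
    and hcomp_id2: "\<lbrakk>f \<in> Hom1 G x y; g \<in> Hom1 G y z\<rbrakk> \<Longrightarrow> id2 G g \<diamondop> id2 G f = id2 G (g \<odot> f)"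
    and interchange: "\<lbrakk>f \<in> Hom1 G x y; g \<in> Hom1 G y z; a \<in> Hom2 G f f'; a' \<in> Hom2 G f' f'';
        b \<in> Hom2 G g g'; b' \<in> Hom2 G g' g''\<rbrakk>
      \<Longrightarrow> (b' \<star> b) \<diamondop> (a' \<star> a) = (b' \<diamondop> a') \<star> (b \<diamondop> a)"

record ('o, 'm, 'c, 'p, 'n, 'd) two_functor =
  on_obj :: "'o \<Rightarrow> 'p"
  on_mor :: "'m \<Rightarrow> 'n"
  on_cell :: "'c \<Rightarrow> 'd"

locale strict_two_functor = G: two_groupoid G + H: two_groupoid H
  for G :: "('o, 'm, 'c) two_groupoid" (structure)
    and H :: "('p, 'n, 'd) two_groupoid" (structure) +
  fixes F :: "('o, 'm, 'c, 'p, 'n, 'd) two_functor"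
  assumes on_obj_closed: "x \<in> Obj G \<Longrightarrow> on_obj F x \<in> Obj H"
    and on_mor_closed: "f \<in> Hom1 G x y \<Longrightarrow> on_mor F f \<in> Hom1 H (on_obj F x) (on_obj F y)"
    and on_cell_closed: "a \<in> Hom2 G f g \<Longrightarrow> on_cell F a \<in> Hom2 H (on_mor F f) (on_mor F g)"
    and on_id1: "x \<in> Obj G \<Longrightarrow> on_mor F (id1 G x) = id1 H (on_obj F x)"
    and on_id2: "f \<in> Mor G \<Longrightarrow> on_cell F (id2 G f) = id2 H (on_mor F f)"
    and on_comp1: "\<lbrakk>f \<in> Hom1 G x y; g \<in> Hom1 G y z\<rbrakk>
      \<Longrightarrow> on_mor F (g \<odot>\<^bsub>G\<^esub> f) = on_mor F g \<odot>\<^bsub>H\<^esub> on_mor F f"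
    and on_vcomp: "\<lbrakk>a \<in> Hom2 G f g; b \<in> Hom2 G g h\<rbrakk>
      \<Longrightarrow> on_cell F (b \<star>\<^bsub>G\<^esub> a) = on_cell F b \<star>\<^bsub>H\<^esub> on_cell F a"
    and on_hcomp: "\<lbrakk>f \<in> Hom1 G x y; g \<in> Hom1 G y z; a \<in> Hom2 G f f'; b \<in> Hom2 G g g'\<rbrakk>
      \<Longrightarrow> on_cell F (b \<diamondop>\<^bsub>G\<^esub> a) = on_cell F b \<diamondop>\<^bsub>H\<^esub> on_cell F a"

definition two_functor_id :: "('o, 'm, 'c, 'o, 'm, 'c) two_functor" where
  "two_functor_id = \<lparr>on_obj = id, on_mor = id, on_cell = id\<rparr>"

definition two_functor_comp ::
  "('p, 'n, 'd, 'q, 'l, 'e) two_functor \<Rightarrow> ('o, 'm, 'c, 'p, 'n, 'd) two_functor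
    \<Rightarrow> ('o, 'm, 'c, 'q, 'l, 'e) two_functor" where
  "two_functor_comp F' F = \<lparr>on_obj = on_obj F' \<circ> on_obj F, on_mor = on_mor F' \<circ> on_mor F,
     on_cell = on_cell F' \<circ> on_cell F\<rparr>"

text \<open>Equality of 2-functors with source \<open>G\<close>: their values off the carriers are irrelevant.\<close>

definition two_functor_eq ::
  "('o, 'm, 'c) two_groupoid \<Rightarrow> ('o, 'm, 'c, 'p, 'n, 'd) two_functor
    \<Rightarrow> ('o, 'm, 'c, 'p, 'n, 'd) two_functor \<Rightarrow> bool" where
  "two_functor_eq G F F' \<longleftrightarrow>
     (\<forall>x\<in>Obj G. on_obj F x = on_obj F' x) \<and>
     (\<forall>f\<in>Mor G. on_mor F f = on_mor F' f) \<and>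
     (\<forall>a\<in>Cell G. on_cell F a = on_cell F' a)"


section \<open>Cosimplicial 2-groupoids\<close>

text \<open>\<open>act G m n \<alpha>\<close> is the 2-functor in degrees \<open>m \<rightarrow> n\<close> induced by \<open>\<alpha> : [m] \<rightarrow> [n]\<close>.\<close>

record ('o, 'm, 'c) cosimp_two_groupoid =
  deg :: "nat \<Rightarrow> ('o, 'm, 'c) two_groupoid"
  act :: "nat \<Rightarrow> nat \<Rightarrow> (nat \<Rightarrow> nat) \<Rightarrow> ('o, 'm, 'c, 'o, 'm, 'c) two_functor"

locale cosimplicial_two_groupoid =
  fixes G :: "('o, 'm, 'c) cosimp_two_groupoid"
  assumes deg_two_groupoid: "two_groupoid (deg G n)"
    and act_two_functor: "\<alpha> \<in> Delta m n \<Longrightarrow> strict_two_functor (deg G m) (deg G n) (act G m n \<alpha>)"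
    and act_id: "two_functor_eq (deg G n) (act G n n (ord_id n)) two_functor_id"
    and act_comp: "\<lbrakk>\<alpha> \<in> Delta l m; \<beta> \<in> Delta m n\<rbrakk> \<Longrightarrow>
      two_functor_eq (deg G l) (act G l n (compose {..l} \<beta> \<alpha>))
        (two_functor_comp (act G m n \<beta>) (act G l m \<alpha>))"

locale cosimplicial_two_functor =
  G: cosimplicial_two_groupoid G + H: cosimplicial_two_groupoid H
  for G H :: "('o, 'm, 'c) cosimp_two_groupoid" +
  fixes F :: "nat \<Rightarrow> ('o, 'm, 'c, 'o, 'm, 'c) two_functor"
  assumes component: "strict_two_functor (deg G n) (deg H n) (F n)"
    and natural: "\<alpha> \<in> Delta m n \<Longrightarrow>
      two_functor_eq (deg G m) (two_functor_comp (F n) (act G m n \<alpha>))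
        (two_functor_comp (act H m n \<alpha>) (F m))"


section \<open>Descent data and gauge transformations\<close>

text \<open>The coface \<open>d\<^sup>i\<close> from degree \<open>n\<close> to degree \<open>n+1\<close> on objects, 1-morphisms and 2-morphisms.\<close>

definition dO :: "('o, 'm, 'c) cosimp_two_groupoid \<Rightarrow> nat \<Rightarrow> nat \<Rightarrow> 'o \<Rightarrow> 'o" where
  "dO G n i = on_obj (act G n (Suc n) (skip n i))"

definition dM :: "('o, 'm, 'c) cosimp_two_groupoid \<Rightarrow> nat \<Rightarrow> nat \<Rightarrow> 'm \<Rightarrow> 'm" where
  "dM G n i = on_mor (act G n (Suc n) (skip n i))"

definition dC :: "('o, 'm, 'c) cosimp_two_groupoid \<Rightarrow> nat \<Rightarrow> nat \<Rightarrow> 'c \<Rightarrow> 'c" where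
  "dC G n i = on_cell (act G n (Suc n) (skip n i))"

definition Desc :: "('o, 'm, 'c) cosimp_two_groupoid \<Rightarrow> ('o \<times> 'm \<times> 'c) set" where
  "Desc G = {(x, g, a).
     x \<in> Obj (deg G 0) \<and>
     g \<in> Hom1 (deg G 1) (dO G 0 1 x) (dO G 0 0 x) \<and>
     a \<in> Hom2 (deg G 2) (dM G 1 1 g) (dM G 1 0 g \<odot>\<^bsub>deg G 2\<^esub> dM G 1 2 g) \<and>
     (id2 (deg G 3) (dM G 2 1 (dM G 1 0 g)) \<diamondop>\<^bsub>deg G 3\<^esub> dC G 2 3 a) \<star>\<^bsub>deg G 3\<^esub> dC G 2 1 a =
     (dC G 2 0 a \<diamondop>\<^bsub>deg G 3\<^esub> id2 (deg G 3) (dM G 2 2 (dM G 1 2 g))) \<star>\<^bsub>deg G 3\<^esub> dC G 2 2 a}"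

definition gauge ::
  "('o, 'm, 'c) cosimp_two_groupoid \<Rightarrow> 'o \<times> 'm \<times> 'c \<Rightarrow> 'o \<times> 'm \<times> 'c \<Rightarrow> ('m \<times> 'c) set" where
  "gauge G = (\<lambda>(x, g, a) (x', g', a'). {(f, c).
     f \<in> Hom1 (deg G 0) x x' \<and>
     c \<in> Hom2 (deg G 1) (dM G 0 0 f \<odot>\<^bsub>deg G 1\<^esub> g) (g' \<odot>\<^bsub>deg G 1\<^esub> dM G 0 1 f) \<and>
     (let f0 = dM G 1 2 (dM G 0 1 f); f2 = dM G 1 1 (dM G 0 0 f);
          g01 = dM G 1 2 g; g'12 = dM G 1 0 g';
          c01 = dC G 1 2 c; c02 = dC G 1 1 c; c12 = dC G 1 0 c
      in (id2 (deg G 2) g'12 \<diamondop>\<^bsub>deg G 2\<^esub> c01) \<star>\<^bsub>deg G 2\<^esub>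
         (c12 \<diamondop>\<^bsub>deg G 2\<^esub> id2 (deg G 2) g01) \<star>\<^bsub>deg G 2\<^esub>
         (id2 (deg G 2) f2 \<diamondop>\<^bsub>deg G 2\<^esub> a) =
         (a' \<diamondop>\<^bsub>deg G 2\<^esub> id2 (deg G 2) f0) \<star>\<^bsub>deg G 2\<^esub> c02)})"

definition gauge_rel ::
  "('o, 'm, 'c) cosimp_two_groupoid \<Rightarrow> (('o \<times> 'm \<times> 'c) \<times> ('o \<times> 'm \<times> 'c)) set" where
  "gauge_rel G = {(d, d'). d \<in> Desc G \<and> d' \<in> Desc G \<and> gauge G d d' \<noteq> {}}"

definition Desc_bar :: "('o, 'm, 'c) cosimp_two_groupoid \<Rightarrow> ('o \<times> 'm \<times> 'c) set set" where
  "Desc_bar G = Desc G // gauge_rel G"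

text \<open>The map \<open>[(x, g, a)] \<mapsto> [(F x, F g, F a)]\<close> induced by a morphism \<open>F\<close> with target \<open>H\<close>.\<close>

definition Desc_bar_map ::
  "('o, 'm, 'c) cosimp_two_groupoid \<Rightarrow> (nat \<Rightarrow> ('o, 'm, 'c, 'o, 'm, 'c) two_functor)
    \<Rightarrow> ('o \<times> 'm \<times> 'c) set \<Rightarrow> ('o \<times> 'm \<times> 'c) set" where
  "Desc_bar_map H F D =
     gauge_rel H `` ((\<lambda>(x, g, a). (on_obj (F 0) x, on_mor (F 1) g, on_cell (F 2) a)) ` D)"


section \<open>Simplicial sets\<close>

text \<open>\<open>sact X m n \<alpha> : X\<^sub>n \<rightarrow> X\<^sub>m\<close> is the operation induced by \<open>\<alpha> : [m] \<rightarrow> [n]\<close>.\<close>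

record 'a sset =
  simp :: "nat \<Rightarrow> 'a set"
  sact :: "nat \<Rightarrow> nat \<Rightarrow> (nat \<Rightarrow> nat) \<Rightarrow> 'a \<Rightarrow> 'a"

definition sset_hom :: "'a sset \<Rightarrow> 'b sset \<Rightarrow> (nat \<Rightarrow> 'a \<Rightarrow> 'b) set" where
  "sset_hom X Y = {\<phi>.
     (\<forall>n. \<phi> n \<in> simp X n \<rightarrow>\<^sub>E simp Y n) \<and>
     (\<forall>m n. \<forall>\<alpha>\<in>Delta m n. \<forall>s\<in>simp X n. \<phi> m (sact X m n \<alpha> s) = sact Y m n \<alpha> (\<phi> n s))}"

definition std_simplex :: "nat \<Rightarrow> (nat \<Rightarrow> nat) sset" where
  "std_simplex n = \<lparr>simp = (\<lambda>m. Delta m n), sact = (\<lambda>l m \<alpha> \<sigma>. compose {..l} \<sigma> \<alpha>)\<rparr>"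

definition sset_prod :: "'a sset \<Rightarrow> 'b sset \<Rightarrow> ('a \<times> 'b) sset" where
  "sset_prod X Y = \<lparr>simp = (\<lambda>n. simp X n \<times> simp Y n),
     sact = (\<lambda>m n \<alpha>. map_prod (sact X m n \<alpha>) (sact Y m n \<alpha>))\<rparr>"

text \<open>\<open>\<pi>\<^sub>0 X\<close> is the quotient of \<open>X\<^sub>0\<close> by the equivalence relation generated by
  \<open>d\<^sub>1 e \<sim> d\<^sub>0 e\<close> for \<open>e \<in> X\<^sub>1\<close>.\<close>

definition pi0_rel :: "'a sset \<Rightarrow> ('a \<times> 'a) set" where
  "pi0_rel X = (let R = {(sact X 0 1 (skip 0 1) e, sact X 0 1 (skip 0 0) e) | e. e \<in> simp X 1}
     in (R \<union> R\<inverse>)\<^sup>*)"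

definition pi0 :: "'a sset \<Rightarrow> 'a set set" where
  "pi0 X = simp X 0 // pi0_rel X"

text \<open>The map \<open>[v] \<mapsto> [\<phi> v]\<close> induced by a simplicial map \<open>\<phi>\<close> with target \<open>Y\<close>.\<close>

definition pi0_map :: "'b sset \<Rightarrow> (nat \<Rightarrow> 'a \<Rightarrow> 'b) \<Rightarrow> 'a set \<Rightarrow> 'b set" where
  "pi0_map Y \<phi> C = pi0_rel Y `` (\<phi> 0 ` C)"


section \<open>Coskeleta\<close>

text \<open>Maps of \<open>N\<close>-truncated simplicial sets \<open>tr\<^sub>N X \<rightarrow> tr\<^sub>N Y\<close>; only dimensions up to \<open>N\<close>
  of \<open>X\<close> and \<open>Y\<close> are used.\<close>

definition trunc_hom :: "nat \<Rightarrow> 'a sset \<Rightarrow> 'b sset \<Rightarrow> (nat \<Rightarrow> 'a \<Rightarrow> 'b) set" where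
  "trunc_hom N X Y = {\<phi> \<in> extensional {..N}.
     (\<forall>n\<le>N. \<phi> n \<in> simp X n \<rightarrow>\<^sub>E simp Y n) \<and>
     (\<forall>m\<le>N. \<forall>n\<le>N. \<forall>\<alpha>\<in>Delta m n. \<forall>s\<in>simp X n. \<phi> m (sact X m n \<alpha> s) = sact Y m n \<alpha> (\<phi> n s))}"

text \<open>\<open>(Cosk\<^sub>N X)\<^sub>n = Hom (tr\<^sub>N \<Delta>\<^sup>n, tr\<^sub>N X)\<close>.\<close>

definition cosk :: "nat \<Rightarrow> 'a sset \<Rightarrow> (nat \<Rightarrow> (nat \<Rightarrow> nat) \<Rightarrow> 'a) sset" where
  "cosk N X = \<lparr>simp = (\<lambda>n. trunc_hom N (std_simplex n) X),
     sact = (\<lambda>m n \<alpha> \<sigma>. \<lambda>k\<in>{..N}. \<lambda>\<tau>\<in>Delta k m. \<sigma> k (compose {..k} \<alpha> \<tau>))\<rparr>"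

definition cosk_map ::
  "nat \<Rightarrow> (nat \<Rightarrow> 'a \<Rightarrow> 'b) \<Rightarrow> nat \<Rightarrow> (nat \<Rightarrow> (nat \<Rightarrow> nat) \<Rightarrow> 'a) \<Rightarrow> (nat \<Rightarrow> (nat \<Rightarrow> nat) \<Rightarrow> 'b)" where
  "cosk_map N \<phi> n \<sigma> = (\<lambda>k\<in>{..N}. \<lambda>\<tau>\<in>Delta k n. \<phi> k (\<sigma> k \<tau>))"


section \<open>The 2-nerve\<close>

text \<open>The data \<open>x\<^sub>i\<close>, \<open>g\<^sub>i\<^sub>j\<close> (\<open>i < j\<close>), \<open>a\<^sub>i\<^sub>j\<^sub>k\<close> (\<open>i < j < k\<close>) of a simplex of the nerve.\<close>

record ('o, 'm, 'c) nerve_simplex =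
  vert :: "nat \<Rightarrow> 'o"
  edge :: "nat \<times> nat \<Rightarrow> 'm"
  tri :: "nat \<times> nat \<times> nat \<Rightarrow> 'c"

definition pairs :: "nat \<Rightarrow> (nat \<times> nat) set" where
  "pairs n = {(i, j). i < j \<and> j \<le> n}"

definition triples :: "nat \<Rightarrow> (nat \<times> nat \<times> nat) set" where
  "triples n = {(i, j, k). i < j \<and> j < k \<and> k \<le> n}"

definition nerve_simplices ::
  "('o, 'm, 'c) two_groupoid \<Rightarrow> nat \<Rightarrow> ('o, 'm, 'c) nerve_simplex set" where
  "nerve_simplices G n = {s.
     vert s \<in> {..n} \<rightarrow>\<^sub>E Obj G \<and>
     edge s \<in> (\<Pi>\<^sub>E (i, j)\<in>pairs n. Hom1 G (vert s i) (vert s j)) \<and>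
     tri s \<in> (\<Pi>\<^sub>E (i, j, k)\<in>triples n.
       Hom2 G (edge s (i, k)) (edge s (j, k) \<odot>\<^bsub>G\<^esub> edge s (i, j))) \<and>
     (\<forall>i j k l. i < j \<and> j < k \<and> k < l \<and> l \<le> n \<longrightarrow>
       (id2 G (edge s (k, l)) \<diamondop>\<^bsub>G\<^esub> tri s (i, j, k)) \<star>\<^bsub>G\<^esub> tri s (i, k, l) =
       (tri s (j, k, l) \<diamondop>\<^bsub>G\<^esub> id2 G (edge s (i, j))) \<star>\<^bsub>G\<^esub> tri s (i, j, l))}"

text \<open>Pullback along \<open>\<alpha> : [m] \<rightarrow> [n]\<close>. An edge collapsed by \<open>\<alpha>\<close> becomes an identity 1-morphism
  and a triangle degenerated by \<open>\<alpha>\<close> becomes an identity 2-morphism.\<close>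

definition nerve_edge ::
  "('o, 'm, 'c) two_groupoid \<Rightarrow> ('o, 'm, 'c) nerve_simplex \<Rightarrow> nat \<Rightarrow> nat \<Rightarrow> 'm" where
  "nerve_edge G s i j = (if i < j then edge s (i, j) else id1 G (vert s i))"

definition nerve_tri ::
  "('o, 'm, 'c) two_groupoid \<Rightarrow> ('o, 'm, 'c) nerve_simplex \<Rightarrow> nat \<Rightarrow> nat \<Rightarrow> nat \<Rightarrow> 'c" where
  "nerve_tri G s i j k =
     (if i < j \<and> j < k then tri s (i, j, k) else id2 G (nerve_edge G s i k))"

definition nerve_act ::
  "('o, 'm, 'c) two_groupoid \<Rightarrow> nat \<Rightarrow> (nat \<Rightarrow> nat)
    \<Rightarrow> ('o, 'm, 'c) nerve_simplex \<Rightarrow> ('o, 'm, 'c) nerve_simplex" where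
  "nerve_act G m \<alpha> s =
     \<lparr>vert = (\<lambda>i\<in>{..m}. vert s (\<alpha> i)),
      edge = (\<lambda>(i, j)\<in>pairs m. nerve_edge G s (\<alpha> i) (\<alpha> j)),
      tri = (\<lambda>(i, j, k)\<in>triples m. nerve_tri G s (\<alpha> i) (\<alpha> j) (\<alpha> k))\<rparr>"

text \<open>The 3-truncated simplicial set of nerve data; dimensions above 3 are not used.\<close>

definition nerve_data :: "('o, 'm, 'c) two_groupoid \<Rightarrow> ('o, 'm, 'c) nerve_simplex sset" where
  "nerve_data G = \<lparr>simp = nerve_simplices G, sact = (\<lambda>m n. nerve_act G m)\<rparr>"

definition nerve_data_map ::
  "('o, 'm, 'c, 'p, 'n, 'd) two_functor \<Rightarrow> nat
    \<Rightarrow> ('o, 'm, 'c) nerve_simplex \<Rightarrow> ('p, 'n, 'd) nerve_simplex" where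
  "nerve_data_map F n s =
     \<lparr>vert = (\<lambda>i\<in>{..n}. on_obj F (vert s i)),
      edge = (\<lambda>p\<in>pairs n. on_mor F (edge s p)),
      tri = (\<lambda>t\<in>triples n. on_cell F (tri s t))\<rparr>"

type_synonym ('o, 'm, 'c) cosk_simplex = "nat \<Rightarrow> (nat \<Rightarrow> nat) \<Rightarrow> ('o, 'm, 'c) nerve_simplex"

definition nerve :: "('o, 'm, 'c) two_groupoid \<Rightarrow> ('o, 'm, 'c) cosk_simplex sset" where
  "nerve G = cosk 3 (nerve_data G)"

definition nerve_map ::
  "('o, 'm, 'c, 'p, 'n, 'd) two_functor \<Rightarrow> nat
    \<Rightarrow> ('o, 'm, 'c) cosk_simplex \<Rightarrow> ('p, 'n, 'd) cosk_simplex" where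
  "nerve_map F = cosk_map 3 (nerve_data_map F)"


section \<open>Cosimplicial simplicial sets and restricted totalization\<close>

text \<open>\<open>csact X p q \<theta> n : X\<^sup>p\<^sub>n \<rightarrow> X\<^sup>q\<^sub>n\<close> is induced by \<open>\<theta> : [p] \<rightarrow> [q]\<close>. The same record carries
  restricted cosimplicial simplicial sets, for which only injective \<open>\<theta>\<close> are relevant.\<close>

record 'a cosimp_sset =
  csdeg :: "nat \<Rightarrow> 'a sset"
  csact :: "nat \<Rightarrow> nat \<Rightarrow> (nat \<Rightarrow> nat) \<Rightarrow> nat \<Rightarrow> 'a \<Rightarrow> 'a"

definition restr :: "'a cosimp_sset \<Rightarrow> 'a cosimp_sset" where
  "restr X = X\<lparr>csact := (\<lambda>p q \<theta>. if \<theta> \<in> Delta_r p q then csact X p q \<theta> else undefined)\<rparr>"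

definition rcosimp_hom :: "'a cosimp_sset \<Rightarrow> 'b cosimp_sset \<Rightarrow> (nat \<Rightarrow> nat \<Rightarrow> 'a \<Rightarrow> 'b) set" where
  "rcosimp_hom X Y = {T.
     (\<forall>p. T p \<in> sset_hom (csdeg X p) (csdeg Y p)) \<and>
     (\<forall>p q. \<forall>\<theta>\<in>Delta_r p q. \<forall>n. \<forall>s\<in>simp (csdeg X p) n.
        T q n (csact X p q \<theta> n s) = csact Y p q \<theta> n (T p n s))}"

definition std_cosimp :: "(nat \<Rightarrow> nat) cosimp_sset" where
  "std_cosimp = \<lparr>csdeg = std_simplex, csact = (\<lambda>p q \<theta> n \<sigma>. compose {..n} \<theta> \<sigma>)\<rparr>"

definition const_cosimp :: "'a sset \<Rightarrow> 'a cosimp_sset" where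
  "const_cosimp X = \<lparr>csdeg = (\<lambda>p. X), csact = (\<lambda>p q \<theta> n s. s)\<rparr>"

definition cosimp_prod :: "'a cosimp_sset \<Rightarrow> 'b cosimp_sset \<Rightarrow> ('a \<times> 'b) cosimp_sset" where
  "cosimp_prod X Y = \<lparr>csdeg = (\<lambda>p. sset_prod (csdeg X p) (csdeg Y p)),
     csact = (\<lambda>p q \<theta> n. map_prod (csact X p q \<theta> n) (csact Y p q \<theta> n))\<rparr>"

definition Tot_dom :: "nat \<Rightarrow> ((nat \<Rightarrow> nat) \<times> (nat \<Rightarrow> nat)) cosimp_sset" where
  "Tot_dom n = cosimp_prod (restr std_cosimp) (const_cosimp (std_simplex n))"

type_synonym 'a tot_simplex = "nat \<Rightarrow> nat \<Rightarrow> (nat \<Rightarrow> nat) \<times> (nat \<Rightarrow> nat) \<Rightarrow> 'a"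

definition Tot_r :: "'a cosimp_sset \<Rightarrow> 'a tot_simplex sset" where
  "Tot_r X = \<lparr>simp = (\<lambda>n. rcosimp_hom (Tot_dom n) X),
     sact = (\<lambda>m n \<beta> T p k. \<lambda>(\<sigma>, \<tau>)\<in>simp (csdeg (Tot_dom m) p) k. T p k (\<sigma>, compose {..k} \<beta> \<tau>))\<rparr>"

definition Tot_r_map :: "(nat \<Rightarrow> nat \<Rightarrow> 'a \<Rightarrow> 'b) \<Rightarrow> nat \<Rightarrow> 'a tot_simplex \<Rightarrow> 'b tot_simplex" where
  "Tot_r_map \<phi> n T p k = (\<lambda>z\<in>simp (csdeg (Tot_dom n) p) k. \<phi> p k (T p k z))"

definition nerve_cosimp ::
  "('o, 'm, 'c) cosimp_two_groupoid \<Rightarrow> ('o, 'm, 'c) cosk_simplex cosimp_sset" where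
  "nerve_cosimp G = \<lparr>csdeg = (\<lambda>p. nerve (deg G p)), csact = (\<lambda>p q \<theta>. nerve_map (act G p q \<theta>))\<rparr>"

definition pi0_Tot_map ::
  "('o, 'm, 'c) cosimp_two_groupoid \<Rightarrow> (nat \<Rightarrow> ('o, 'm, 'c, 'o, 'm, 'c) two_functor)
    \<Rightarrow> ('o, 'm, 'c) cosk_simplex tot_simplex set \<Rightarrow> ('o, 'm, 'c) cosk_simplex tot_simplex set" where
  "pi0_Tot_map H F =
     pi0_map (Tot_r (restr (nerve_cosimp H))) (Tot_r_map (\<lambda>p. nerve_map (F p)))"

end

theory Submission
  imports Defs
begin

text \<open>\<^emph>\<open>Totalization simplices are families of pseudofunctors.\<close> The product \<open>\<Delta>\<^sup>p \<times> \<Delta>\<^sup>n\<close> is the nerve of the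
  poset \<open>[p] \<times> [n]\<close>, and the 2-nerve is 3-coskeletal with data in dimensions 0, 1, 2 and an equation in
  dimension 3. A simplicial map \<open>\<Delta>\<^sup>p \<times> \<Delta>\<^sup>n \<rightarrow> \<N>G\<close> is therefore the same as a normal pseudofunctor from
  \<open>[p] \<times> [n]\<close> to \<open>G\<close>: objects \<open>V u\<close>, 1-morphisms \<open>E u v\<close> for \<open>u \<le> v\<close> and 2-morphisms
  \<open>A u v w : E u w \<Rightarrow> E v w \<odot> E u v\<close> for \<open>u \<le> v \<le> w\<close>, which are identities on degenerate chains and satisfy
  the cocycle equation on chains of four points. An \<open>n\<close>-simplex of the restricted totalization is a family of
  such pseudofunctors, one for each cosimplicial degree \<open>p\<close>, natural in the injections \<open>[p] \<rightarrow> [q]\<close>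
  (\<open>tot_of_in_Tot\<close>, \<open>Tot_simplex_is_tot_of\<close>).

  \<^emph>\<open>Vertices are descent data.\<close> For \<open>n = 0\<close> every object, 1-morphism and 2-morphism on a nondegenerate chain
  of \<open>[p]\<close> is the image, under the injection of \<open>[0]\<close>, \<open>[1]\<close> or \<open>[2]\<close> onto that chain, of the top one in degree
  0, 1 or 2. These three form a descent datum, its cocycle equation being the one in degree 3, and all
  other cocycle equations are images of that one (\<open>bij_betw_desc_tot\<close>).

  \<^emph>\<open>Edges are gauge transformations.\<close> For \<open>n = 1\<close> the pseudofunctors on \<open>[p] \<times> [1]\<close> restrict to descent data
  on the two ends, and the vertical edges come from one 1-morphism \<open>f\<close> in degree 0. The square over \<open>[1]\<close> is
  cut by its diagonal into two triangles; one of them composed with the inverse of the other is the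
  2-morphism \<open>c\<close> of a gauge transformation, and the three tetrahedra that make up the prism \<open>[2] \<times> [1]\<close> combine
  to its prism equation (\<open>prism_of_cylinder\<close>). Conversely a gauge transformation gives such
  pseudofunctors: take \<open>f j \<odot> g i j\<close> as the diagonal of the square over \<open>i \<le> j\<close> (\<open>cylinder\<close>). So two vertices
  are joined by an edge exactly when the descent data are joined by a gauge transformation.

  \<^emph>\<open>The components.\<close> Gluing two prisms along a common face, the glued prism commutes iff the second one does,
  provided that the first one does; this holds because 2-morphisms and whiskering by invertible 1-morphisms can
  be cancelled (\<open>prism_paste\<close>). It yields transitivity of the gauge relation and, applied to a gauge
  transformation followed by its formal inverse, also symmetry (\<open>equiv_gauge_rel\<close>). The relation generated
  by the edges is thus the gauge relation itself, and taking direct images under the bijection between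
  descent data and vertices is the required bijection of quotients. It is natural since that bijection
  commutes with cosimplicial 2-functors (\<open>Tot_map_desc_tot\<close>).\<close>

section \<open>Calculus in a strict 2-groupoid\<close>

context two_groupoid
begin

text \<open>The axioms speak of elements of hom-sets, whose endpoints the simplifier would have to guess. The rewrite rules
  of this section restate them with explicit sources and targets: every variable of a premise occurs in
  the left-hand side, so that simplification decides whether a composite is well-typed and brings
  composites of whiskered 2-morphisms into a right-nested normal form. Equations between pasting diagrams
  then reduce to applications of the exchange law below, which is left to be used by hand.\<close>

lemma Obj_typing [simp]:
  "f \<in> Mor G \<Longrightarrow> src G f \<in> Obj G"
  "f \<in> Mor G \<Longrightarrow> tgt G f \<in> Obj G"
  by (auto intro: src_closed tgt_closed)

lemma id1_typing [simp]:
  assumes "x \<in> Obj G"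
  shows "id1 G x \<in> Mor G" "src G (id1 G x) = x" "tgt G (id1 G x) = x"
  using id1_closed[OF assms] by (auto simp: Hom1_def)

lemma comp1_typing [simp]:
  assumes "f \<in> Mor G" "g \<in> Mor G" "src G g = tgt G f"
  shows "g \<odot> f \<in> Mor G" "src G (g \<odot> f) = src G f" "tgt G (g \<odot> f) = tgt G g"
  using comp1_closed[of f "src G f" "tgt G f" g "tgt G g"] assms by (auto simp: Hom1_def)

lemma comp1_laws [simp]:
  "\<lbrakk>f \<in> Mor G; g \<in> Mor G; h \<in> Mor G; src G g = tgt G f; src G h = tgt G g\<rbrakk>
    \<Longrightarrow> (h \<odot> g) \<odot> f = h \<odot> (g \<odot> f)"
  "\<lbrakk>f \<in> Mor G; tgt G f = y\<rbrakk> \<Longrightarrow> id1 G y \<odot> f = f"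
  "\<lbrakk>f \<in> Mor G; src G f = x\<rbrakk> \<Longrightarrow> f \<odot> id1 G x = f"
  by (auto simp: Hom1_def intro: comp1_assoc comp1_id_left comp1_id_right)

lemma cell_typing [simp]:
  assumes "a \<in> Cell G"
  shows "src2 G a \<in> Mor G" "tgt2 G a \<in> Mor G"
    "src G (tgt2 G a) = src G (src2 G a)" "tgt G (tgt2 G a) = tgt G (src2 G a)"
  using src2_closed tgt2_closed parallel assms by auto

lemma id2_typing [simp]:
  assumes "f \<in> Mor G"
  shows "id2 G f \<in> Cell G" "src2 G (id2 G f) = f" "tgt2 G (id2 G f) = f"
  using id2_closed[OF assms] by (auto simp: Hom2_def)

lemma vcomp_typing [simp]:
  assumes "a \<in> Cell G" "b \<in> Cell G" "src2 G b = tgt2 G a"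
  shows "b \<star> a \<in> Cell G" "src2 G (b \<star> a) = src2 G a" "tgt2 G (b \<star> a) = tgt2 G b"
  using vcomp_closed[of a "src2 G a" "tgt2 G a" b "tgt2 G b"] assms by (auto simp: Hom2_def)

lemma vcomp_laws [simp]:
  "\<lbrakk>a \<in> Cell G; b \<in> Cell G; c \<in> Cell G; src2 G b = tgt2 G a; src2 G c = tgt2 G b\<rbrakk>
    \<Longrightarrow> (c \<star> b) \<star> a = c \<star> (b \<star> a)"
  "\<lbrakk>a \<in> Cell G; tgt2 G a = g\<rbrakk> \<Longrightarrow> id2 G g \<star> a = a"
  "\<lbrakk>a \<in> Cell G; src2 G a = f\<rbrakk> \<Longrightarrow> a \<star> id2 G f = a"
  by (auto simp: Hom2_def intro: vcomp_assoc vcomp_id_left vcomp_id_right)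

lemma hcomp_typing [simp]:
  assumes "a \<in> Cell G" "b \<in> Cell G" "src G (src2 G b) = tgt G (src2 G a)"
  shows "b \<diamondop> a \<in> Cell G" "src2 G (b \<diamondop> a) = src2 G b \<odot> src2 G a"
    "tgt2 G (b \<diamondop> a) = tgt2 G b \<odot> tgt2 G a"
  using hcomp_closed[of "src2 G a" "src G (src2 G a)" "tgt G (src2 G a)" "src2 G b"
      "tgt G (src2 G b)" a "tgt2 G a" b "tgt2 G b"] assms
  by (auto simp: Hom1_def Hom2_def)

lemma hcomp_identity [simp]:
  "\<lbrakk>a \<in> Cell G; tgt G (src2 G a) = y\<rbrakk> \<Longrightarrow> id2 G (id1 G y) \<diamondop> a = a"
  "\<lbrakk>a \<in> Cell G; src G (src2 G a) = x\<rbrakk> \<Longrightarrow> a \<diamondop> id2 G (id1 G x) = a"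
  "\<lbrakk>f \<in> Mor G; g \<in> Mor G; src G g = tgt G f\<rbrakk> \<Longrightarrow> id2 G g \<diamondop> id2 G f = id2 G (g \<odot> f)"
  using hcomp_id_left[of "src2 G a" "src G (src2 G a)" y a "tgt2 G a"]
    hcomp_id_right[of "src2 G a" x "tgt G (src2 G a)" a "tgt2 G a"]
    hcomp_id2[of f "src G f" "tgt G f" g "tgt G g"]
  by (auto simp: Hom1_def Hom2_def)

lemma hcomp_assoc':
  "\<lbrakk>a \<in> Cell G; b \<in> Cell G; c \<in> Cell G; src G (src2 G b) = tgt G (src2 G a);
    src G (src2 G c) = tgt G (src2 G b)\<rbrakk> \<Longrightarrow> (c \<diamondop> b) \<diamondop> a = c \<diamondop> (b \<diamondop> a)"
  by (rule hcomp_assoc[where f = "src2 G a" and g = "src2 G b" and h = "src2 G c"])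
    (auto simp: Hom1_def Hom2_def)

lemma interchange':
  "\<lbrakk>a \<in> Cell G; a' \<in> Cell G; b \<in> Cell G; b' \<in> Cell G; src2 G a' = tgt2 G a; src2 G b' = tgt2 G b;
    src G (src2 G b) = tgt G (src2 G a)\<rbrakk>
    \<Longrightarrow> (b' \<star> b) \<diamondop> (a' \<star> a) = (b' \<diamondop> a') \<star> (b \<diamondop> a)"
  by (rule interchange[where f = "src2 G a" and g = "src2 G b"]) (auto simp: Hom1_def Hom2_def)

lemma whisker [simp]:
  "\<lbrakk>a \<in> Cell G; b \<in> Cell G; h \<in> Mor G; src2 G b = tgt2 G a; src G h = tgt G (src2 G a)\<rbrakk>
    \<Longrightarrow> id2 G h \<diamondop> (b \<star> a) = (id2 G h \<diamondop> b) \<star> (id2 G h \<diamondop> a)"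
  "\<lbrakk>a \<in> Cell G; b \<in> Cell G; h \<in> Mor G; src2 G b = tgt2 G a; tgt G h = src G (src2 G a)\<rbrakk>
    \<Longrightarrow> (b \<star> a) \<diamondop> id2 G h = (b \<diamondop> id2 G h) \<star> (a \<diamondop> id2 G h)"
  "\<lbrakk>a \<in> Cell G; h \<in> Mor G; k \<in> Mor G; src G k = tgt G (src2 G a); src G h = tgt G k\<rbrakk>
    \<Longrightarrow> id2 G h \<diamondop> (id2 G k \<diamondop> a) = id2 G (h \<odot> k) \<diamondop> a"
  "\<lbrakk>a \<in> Cell G; h \<in> Mor G; k \<in> Mor G; src G h = tgt G (src2 G a); tgt G k = src G (src2 G a)\<rbrakk>
    \<Longrightarrow> (id2 G h \<diamondop> a) \<diamondop> id2 G k = id2 G h \<diamondop> (a \<diamondop> id2 G k)"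
  "\<lbrakk>a \<in> Cell G; h \<in> Mor G; k \<in> Mor G; tgt G h = src G (src2 G a); tgt G k = src G h\<rbrakk>
    \<Longrightarrow> (a \<diamondop> id2 G h) \<diamondop> id2 G k = a \<diamondop> id2 G (h \<odot> k)"
  using interchange'[of a b "id2 G h" "id2 G h"] interchange'[of "id2 G h" "id2 G h" a b]
    hcomp_assoc'[of a "id2 G k" "id2 G h"] hcomp_assoc'[of "id2 G k" a "id2 G h"]
    hcomp_assoc'[of "id2 G k" "id2 G h" a]
  by simp_all

text \<open>Both sides are the horizontal composite \<open>b \<diamondop> a\<close>; this is the interchange law with two identities inserted.\<close>

lemma exchange:
  assumes "a \<in> Cell G" "b \<in> Cell G" "src G (src2 G b) = tgt G (src2 G a)"
    "src2 G a = f" "tgt2 G a = f'" "src2 G b = g" "tgt2 G b = g'"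
  shows "(b \<diamondop> id2 G f') \<star> (id2 G g \<diamondop> a) = (id2 G g' \<diamondop> a) \<star> (b \<diamondop> id2 G f)"
  using interchange'[of a "id2 G f'" "id2 G g" b] interchange'[of "id2 G f" a b "id2 G g'"] assms
  by auto

text \<open>In the right-nested normal form the two factors to be exchanged usually have a further one below them.\<close>

lemma exchange_under:
  assumes "a \<in> Cell G" "b \<in> Cell G" "src G (src2 G b) = tgt G (src2 G a)"
    "src2 G a = f" "tgt2 G a = f'" "src2 G b = g" "tgt2 G b = g'"
    "e \<in> Cell G" "tgt2 G e = g \<odot> f"
  shows "(b \<diamondop> id2 G f') \<star> ((id2 G g \<diamondop> a) \<star> e) = (id2 G g' \<diamondop> a) \<star> ((b \<diamondop> id2 G f) \<star> e)"
proof -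
  have "((b \<diamondop> id2 G f') \<star> (id2 G g \<diamondop> a)) \<star> e = ((id2 G g' \<diamondop> a) \<star> (b \<diamondop> id2 G f)) \<star> e"
    using exchange[OF assms(1-7)] by simp
  then show ?thesis using assms by auto
qed

lemma vcomp_cancel_right:
  assumes "a \<in> Cell G" "b \<in> Cell G" "b' \<in> Cell G" "src2 G b = tgt2 G a" "src2 G b' = tgt2 G a"
    and "b \<star> a = b' \<star> a"
  shows "b = b'"
proof -
  obtain i where i: "i \<in> Hom2 G (tgt2 G a) (src2 G a)" "a \<star> i = id2 G (tgt2 G a)"
    using inverse2[of a "src2 G a" "tgt2 G a"] assms by (auto simp: Hom2_def)
  have "(b \<star> a) \<star> i = (b' \<star> a) \<star> i" using assms(6) by simp
  then show ?thesis using i assms(1-5) by (auto simp: Hom2_def)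
qed

lemma whisker_cancel_right:
  assumes "f \<in> Mor G" "b \<in> Cell G" "b' \<in> Cell G" "src G (src2 G b) = tgt G f"
    "src G (src2 G b') = tgt G f"
    and "b \<diamondop> id2 G f = b' \<diamondop> id2 G f"
  shows "b = b'"
proof -
  obtain h where h: "h \<in> Hom1 G (tgt G f) (src G f)" "f \<odot> h = id1 G (tgt G f)"
    using inverse1[of f "src G f" "tgt G f"] assms by (auto simp: Hom1_def)
  have "(b \<diamondop> id2 G f) \<diamondop> id2 G h = (b' \<diamondop> id2 G f) \<diamondop> id2 G h" using assms(6) by simp
  then show ?thesis using h assms(1-5) by (auto simp: Hom1_def)
qed

end

section \<open>Prisms\<close>

text \<open>The equation of a gauge transformation with its entries as parameters, so that it can be stated in every
  cosimplicial degree.\<close>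

definition prism ::
  "('o, 'm, 'c) two_groupoid \<Rightarrow> 'm \<Rightarrow> 'm \<Rightarrow> 'm \<Rightarrow> 'm \<Rightarrow> 'c \<Rightarrow> 'c \<Rightarrow> 'c \<Rightarrow> 'c \<Rightarrow> 'c \<Rightarrow> bool" where
  "prism G f0 f2 g01 g'12 a a' c01 c02 c12 \<longleftrightarrow>
     (id2 G g'12 \<diamondop>\<^bsub>G\<^esub> c01) \<star>\<^bsub>G\<^esub> (c12 \<diamondop>\<^bsub>G\<^esub> id2 G g01) \<star>\<^bsub>G\<^esub> (id2 G f2 \<diamondop>\<^bsub>G\<^esub> a) =
     (a' \<diamondop>\<^bsub>G\<^esub> id2 G f0) \<star>\<^bsub>G\<^esub> c02"

context two_groupoid
begin

text \<open>In the glued prism the 2-morphisms \<open>c01\<close> and \<open>c12'\<close> act on disjoint parts and can be exchanged. After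
  that the first prism appears inside it, whiskered by \<open>f2'\<close>; replacing it by its other side leaves the
  second prism, whiskered by \<open>f0\<close> and composed with \<open>c02\<close>, and both of these operations are injective.
  The equivalence, rather than one implication, is what gives the inverse of a gauge transformation.\<close>

lemma prism_paste:
  assumes f: "f0 \<in> Hom1 G x0 x0'" "f1 \<in> Hom1 G x1 x1'" "f2 \<in> Hom1 G x2 x2'"
    and f': "f0' \<in> Hom1 G x0' x0''" "f1' \<in> Hom1 G x1' x1''" "f2' \<in> Hom1 G x2' x2''"
    and g: "g01 \<in> Hom1 G x0 x1" "g12 \<in> Hom1 G x1 x2" "g02 \<in> Hom1 G x0 x2"
    and g': "g01' \<in> Hom1 G x0' x1'" "g12' \<in> Hom1 G x1' x2'" "g02' \<in> Hom1 G x0' x2'"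
    and g'': "g01'' \<in> Hom1 G x0'' x1''" "g12'' \<in> Hom1 G x1'' x2''" "g02'' \<in> Hom1 G x0'' x2''"
    and a: "a \<in> Hom2 G g02 (g12 \<odot> g01)" "a' \<in> Hom2 G g02' (g12' \<odot> g01')"
      "a'' \<in> Hom2 G g02'' (g12'' \<odot> g01'')"
    and c: "c01 \<in> Hom2 G (f1 \<odot> g01) (g01' \<odot> f0)" "c12 \<in> Hom2 G (f2 \<odot> g12) (g12' \<odot> f1)"
      "c02 \<in> Hom2 G (f2 \<odot> g02) (g02' \<odot> f0)"
    and c': "c01' \<in> Hom2 G (f1' \<odot> g01') (g01'' \<odot> f0')" "c12' \<in> Hom2 G (f2' \<odot> g12') (g12'' \<odot> f1')"
      "c02' \<in> Hom2 G (f2' \<odot> g02') (g02'' \<odot> f0')"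
    and P: "prism G f0 f2 g01 g12' a a' c01 c02 c12"
  shows "prism G (f0' \<odot> f0) (f2' \<odot> f2) g01 g12'' a a''
      ((c01' \<diamondop> id2 G f0) \<star> (id2 G f1' \<diamondop> c01)) ((c02' \<diamondop> id2 G f0) \<star> (id2 G f2' \<diamondop> c02))
      ((c12' \<diamondop> id2 G f1) \<star> (id2 G f2' \<diamondop> c12))
    \<longleftrightarrow> prism G f0' f2' g01' g12'' a' a'' c01' c02' c12'"
    (is "?comp \<longleftrightarrow> prism G f0' f2' g01' g12'' a' a'' c01' c02' c12'")
proof -
  note [simp] = assms(1-24)[unfolded Hom1_def Hom2_def mem_Collect_eq]
  let ?L = "(id2 G g12'' \<diamondop> c01') \<star> (c12' \<diamondop> id2 G g01') \<star> (id2 G f2' \<diamondop> a')"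
  let ?R = "(a'' \<diamondop> id2 G f0') \<star> c02'"
  have P': "id2 G f2' \<diamondop> ((id2 G g12' \<diamondop> c01) \<star> (c12 \<diamondop> id2 G g01) \<star> (id2 G f2 \<diamondop> a))
    = id2 G f2' \<diamondop> ((a' \<diamondop> id2 G f0) \<star> c02)"
    using P by (simp only: prism_def)
  have "(id2 G (g12'' \<odot> f1') \<diamondop> c01) \<star> (c12' \<diamondop> id2 G (f1 \<odot> g01)) \<star> e
      = (c12' \<diamondop> id2 G (g01' \<odot> f0)) \<star> (id2 G (f2' \<odot> g12') \<diamondop> c01) \<star> e"
      if "e \<in> Cell G" "tgt2 G e = f2' \<odot> g12' \<odot> f1 \<odot> g01" for e
    using that by (intro exchange_under[symmetric]) simp_all
  with P' have 1: "(id2 G g12'' \<diamondop> ((c01' \<diamondop> id2 G f0) \<star> (id2 G f1' \<diamondop> c01)))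
      \<star> (((c12' \<diamondop> id2 G f1) \<star> (id2 G f2' \<diamondop> c12)) \<diamondop> id2 G g01) \<star> (id2 G (f2' \<odot> f2) \<diamondop> a)
    = (?L \<diamondop> id2 G f0) \<star> (id2 G f2' \<diamondop> c02)"
    by simp
  have 2: "(a'' \<diamondop> id2 G (f0' \<odot> f0)) \<star> (c02' \<diamondop> id2 G f0) \<star> (id2 G f2' \<diamondop> c02)
    = (?R \<diamondop> id2 G f0) \<star> (id2 G f2' \<diamondop> c02)"
    by simp
  from 1 2 have "?comp \<longleftrightarrow> (?L \<diamondop> id2 G f0) \<star> (id2 G f2' \<diamondop> c02) = (?R \<diamondop> id2 G f0) \<star> (id2 G f2' \<diamondop> c02)"
    by (simp only: prism_def)
  also have "\<dots> \<longleftrightarrow> ?L \<diamondop> id2 G f0 = ?R \<diamondop> id2 G f0"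
    by (rule iffI, rule vcomp_cancel_right[of "id2 G f2' \<diamondop> c02"]) (simp_all del: vcomp_laws whisker)
  also have "\<dots> \<longleftrightarrow> ?L = ?R"
    by (rule iffI, rule whisker_cancel_right[of f0]) (simp_all del: vcomp_laws whisker)
  finally show ?thesis by (simp only: prism_def)
qed

end

section \<open>Normal pseudofunctors\<close>

text \<open>The relation also determines the index set, as the set of points related to themselves. The
  cocycle equation is stated for weak chains, since a chain of \<open>[p] \<times> [1]\<close> may project to a degenerate chain
  of \<open>[p]\<close> and the cylinder construction uses the equation for the projection.\<close>

locale normal_pseudofunctor = two_groupoid G
  for G :: "('o, 'm, 'c) two_groupoid" (structure) +
  fixes le :: "'i \<Rightarrow> 'i \<Rightarrow> bool" (infix "\<preceq>" 50)
    and V :: "'i \<Rightarrow> 'o" and E :: "'i \<Rightarrow> 'i \<Rightarrow> 'm" and A :: "'i \<Rightarrow> 'i \<Rightarrow> 'i \<Rightarrow> 'c"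
  assumes le_refl: "u \<preceq> v \<Longrightarrow> u \<preceq> u \<and> v \<preceq> v"
    and le_trans: "\<lbrakk>u \<preceq> v; v \<preceq> w\<rbrakk> \<Longrightarrow> u \<preceq> w"
    and V_in: "u \<preceq> u \<Longrightarrow> V u \<in> Obj G"
    and E_in: "u \<preceq> v \<Longrightarrow> E u v \<in> Hom1 G (V u) (V v)"
    and A_in: "\<lbrakk>u \<preceq> v; v \<preceq> w\<rbrakk> \<Longrightarrow> A u v w \<in> Hom2 G (E u w) (E v w \<odot> E u v)"
    and E_id: "u \<preceq> u \<Longrightarrow> E u u = id1 G (V u)"
    and A_id_left: "u \<preceq> v \<Longrightarrow> A u u v = id2 G (E u v)"
    and A_id_right: "u \<preceq> v \<Longrightarrow> A u v v = id2 G (E u v)"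
    and cocycle: "\<lbrakk>u \<preceq> v; v \<preceq> w; w \<preceq> z\<rbrakk> \<Longrightarrow>
      (id2 G (E w z) \<diamondop> A u v w) \<star> A u w z = (A v w z \<diamondop> id2 G (E u v)) \<star> A u v z"
begin

lemma E_typing [simp]:
  assumes "u \<preceq> v"
  shows "E u v \<in> Mor G" "src G (E u v) = V u" "tgt G (E u v) = V v"
  using E_in[OF assms] by (auto simp: Hom1_def)

lemma A_typing [simp]:
  assumes "u \<preceq> v" "v \<preceq> w"
  shows "A u v w \<in> Cell G" "src2 G (A u v w) = E u w" "tgt2 G (A u v w) = E v w \<odot> E u v"
  using A_in[OF assms] by (auto simp: Hom2_def)

lemma reindex:
  assumes "\<And>i j. le' i j \<Longrightarrow> r i \<preceq> r j" "\<And>i j. le' i j \<Longrightarrow> le' i i \<and> le' j j"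
    "\<And>i j k. \<lbrakk>le' i j; le' j k\<rbrakk> \<Longrightarrow> le' i k"
  shows "normal_pseudofunctor G le' (\<lambda>i. V (r i)) (\<lambda>i j. E (r i) (r j)) (\<lambda>i j k. A (r i) (r j) (r k))"
  by unfold_locales (use assms in \<open>auto intro: V_in E_in A_in E_id A_id_left A_id_right cocycle\<close>)

end

definition chain :: "nat \<Rightarrow> nat \<Rightarrow> nat \<Rightarrow> bool" where
  "chain p i j \<longleftrightarrow> i \<le> j \<and> j \<le> p"

definition grid :: "nat \<Rightarrow> nat \<Rightarrow> nat \<times> nat \<Rightarrow> nat \<times> nat \<Rightarrow> bool" where
  "grid p n u v \<longleftrightarrow> chain p (fst u) (fst v) \<and> chain n (snd u) (snd v)"

lemma chain_refl: "chain p i j \<Longrightarrow> chain p i i \<and> chain p j j"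
  and chain_trans: "\<lbrakk>chain p i j; chain p j k\<rbrakk> \<Longrightarrow> chain p i k"
  by (auto simp: chain_def)

lemma grid_refl: "grid p n u v \<Longrightarrow> grid p n u u \<and> grid p n v v"
  and grid_trans: "\<lbrakk>grid p n u v; grid p n v w\<rbrakk> \<Longrightarrow> grid p n u w"
  by (auto simp: grid_def chain_def)

lemma grid_0: "grid p 0 u v \<longleftrightarrow> snd u = 0 \<and> snd v = 0 \<and> fst u \<le> fst v \<and> fst v \<le> p"
  by (auto simp: grid_def chain_def)

text \<open>On a degenerate chain two of the four 2-morphisms of the cocycle equation are identities and the other two
  are equal, so that only strict chains carry a condition.\<close>

lemma (in two_groupoid) normal_pseudofunctor_of_strict_chains:
  assumes V_in: "\<And>i. i \<le> p \<Longrightarrow> V i \<in> Obj G"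
    and E_in: "\<And>i j. \<lbrakk>i < j; j \<le> p\<rbrakk> \<Longrightarrow> E i j \<in> Hom1 G (V i) (V j)"
    and A_in: "\<And>i j k. \<lbrakk>i < j; j < k; k \<le> p\<rbrakk> \<Longrightarrow> A i j k \<in> Hom2 G (E i k) (E j k \<odot> E i j)"
    and E_id: "\<And>i. i \<le> p \<Longrightarrow> E i i = id1 G (V i)"
    and A_id: "\<And>i j. \<lbrakk>i \<le> j; j \<le> p\<rbrakk> \<Longrightarrow> A i i j = id2 G (E i j)"
      "\<And>i j. \<lbrakk>i \<le> j; j \<le> p\<rbrakk> \<Longrightarrow> A i j j = id2 G (E i j)"
    and cocycle: "\<And>i j k l. \<lbrakk>i < j; j < k; k < l; l \<le> p\<rbrakk> \<Longrightarrow>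
      (id2 G (E k l) \<diamondop> A i j k) \<star> A i k l = (A j k l \<diamondop> id2 G (E i j)) \<star> A i j l"
  shows "normal_pseudofunctor G (chain p) V E A"
proof -
  have E_in': "E i j \<in> Hom1 G (V i) (V j)" if "chain p i j" for i j
    using that E_in V_in E_id id1_closed by (cases "i = j") (auto simp: chain_def)
  have A_in': "A i j k \<in> Hom2 G (E i k) (E j k \<odot> E i j)" if le: "chain p i j" "chain p j k" for i j k
  proof -
    consider "i = j" | "j = k" | "i < j" "j < k"
      using le unfolding chain_def by linarith
    then show ?thesis
    proof cases
      case 1
      with that A_id(1)[of j k] E_id[of j] E_in'[of j k] show ?thesis
        by (auto simp: chain_def Hom1_def Hom2_def)
    next
      case 2
      with that A_id(2)[of i j] E_id[of j] E_in'[of i j] show ?thesis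
        by (auto simp: chain_def Hom1_def Hom2_def)
    next
      case 3
      with that A_in show ?thesis by (auto simp: chain_def)
    qed
  qed
  have "(id2 G (E k l) \<diamondop> A i j k) \<star> A i k l = (A j k l \<diamondop> id2 G (E i j)) \<star> A i j l"
    if ch: "chain p i j" "chain p j k" "chain p k l" for i j k l
  proof -
    have le': "i \<le> p" "j \<le> p" "k \<le> p" "l \<le> p" "i \<le> j" "j \<le> k" "k \<le> l" "i \<le> k" "j \<le> l" "i \<le> l"
      using that by (auto simp: chain_def)
    consider "i = j" | "j = k" | "k = l" | "i < j" "j < k" "k < l"
      using ch unfolding chain_def by linarith
    then show ?thesis
    proof cases
      case 1
      have "E k l \<in> Hom1 G (V k) (V l)" "E j k \<in> Hom1 G (V j) (V k)" "E j l \<in> Hom1 G (V j) (V l)"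
        "A j k l \<in> Hom2 G (E j l) (E k l \<odot> E j k)"
        using le' by (auto intro!: E_in' A_in' simp: chain_def)
      then show ?thesis using A_id le' E_id 1 by (simp add: Hom1_def Hom2_def)
    next
      case 2
      then show ?thesis using A_id le' E_id by simp
    next
      case 3
      have "E j l \<in> Hom1 G (V j) (V l)" "E i j \<in> Hom1 G (V i) (V j)" "E i l \<in> Hom1 G (V i) (V l)"
        "A i j l \<in> Hom2 G (E i l) (E j l \<odot> E i j)"
        using le' by (auto intro!: E_in' A_in' simp: chain_def)
      then show ?thesis using A_id le' E_id 3 by (simp add: Hom1_def Hom2_def)
    next
      case 4
      then show ?thesis using cocycle le' by simp
    qed
  qed
  with E_in' A_in' show ?thesis
    by unfold_locales (auto simp: chain_def V_in E_id A_id)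
qed

section \<open>Cylinders\<close>

text \<open>The pseudofunctor on \<open>[p] \<times> [1]\<close> with ends \<open>(x, g, a)\<close> and \<open>(x', g', a')\<close>, vertical edges \<open>f i\<close> and squares
  filled by \<open>c i j\<close>. An edge from the bottom to the top is sent to the composite that first runs along the
  bottom and then goes up; a triangle is filled with \<open>a\<close> whiskered by the vertical edge, followed by \<open>c\<close> if
  its middle vertex lies on the top already.\<close>

definition cyl_vert :: "(nat \<Rightarrow> 'o) \<Rightarrow> (nat \<Rightarrow> 'o) \<Rightarrow> nat \<times> nat \<Rightarrow> 'o" where
  "cyl_vert x x' u = (if snd u = 0 then x (fst u) else x' (fst u))"

definition cyl_edge :: "('o, 'm, 'c) two_groupoid \<Rightarrow> (nat \<Rightarrow> nat \<Rightarrow> 'm) \<Rightarrow> (nat \<Rightarrow> nat \<Rightarrow> 'm)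
    \<Rightarrow> (nat \<Rightarrow> 'm) \<Rightarrow> nat \<times> nat \<Rightarrow> nat \<times> nat \<Rightarrow> 'm" where
  "cyl_edge G g g' f u v =
    (if snd v = 0 then g (fst u) (fst v)
     else if snd u = 0 then f (fst v) \<odot>\<^bsub>G\<^esub> g (fst u) (fst v)
     else g' (fst u) (fst v))"

definition cyl_tri :: "('o, 'm, 'c) two_groupoid \<Rightarrow> (nat \<Rightarrow> nat \<Rightarrow> 'm)
    \<Rightarrow> (nat \<Rightarrow> nat \<Rightarrow> nat \<Rightarrow> 'c) \<Rightarrow> (nat \<Rightarrow> nat \<Rightarrow> nat \<Rightarrow> 'c)
    \<Rightarrow> (nat \<Rightarrow> 'm) \<Rightarrow> (nat \<Rightarrow> nat \<Rightarrow> 'c) \<Rightarrow> nat \<times> nat \<Rightarrow> nat \<times> nat \<Rightarrow> nat \<times> nat \<Rightarrow> 'c" where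
  "cyl_tri G g a a' f c u v w =
    (if snd w = 0 then a (fst u) (fst v) (fst w)
     else if snd v = 0 then id2 G (f (fst w)) \<diamondop>\<^bsub>G\<^esub> a (fst u) (fst v) (fst w)
     else if snd u = 0 then
       (c (fst v) (fst w) \<diamondop>\<^bsub>G\<^esub> id2 G (g (fst u) (fst v))) \<star>\<^bsub>G\<^esub>
       (id2 G (f (fst w)) \<diamondop>\<^bsub>G\<^esub> a (fst u) (fst v) (fst w))
     else a' (fst u) (fst v) (fst w))"

text \<open>A tetrahedron of \<open>[p] \<times> [1]\<close> is classified by how many of its vertices lie on the bottom. With
  four or none the cocycle equation is that of an end; with three it is the bottom one whiskered by \<open>f\<close>; with two it is
  in addition an exchange of \<open>c\<close> with \<open>a\<close>; with one it needs the prism equation as well. The vertices may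
  project to a degenerate chain of \<open>[p]\<close>, so the prism equation is first extended to weak chains.\<close>

lemma cylinder:
  fixes G :: "('o, 'm, 'c) two_groupoid" (structure)
  assumes D: "normal_pseudofunctor G (chain p) x g a"
    and D': "normal_pseudofunctor G (chain p) x' g' a'"
    and f: "\<And>i. i \<le> p \<Longrightarrow> f i \<in> Hom1 G (x i) (x' i)"
    and c: "\<And>i j. \<lbrakk>i < j; j \<le> p\<rbrakk> \<Longrightarrow> c i j \<in> Hom2 G (f j \<odot> g i j) (g' i j \<odot> f i)"
    and c_id: "\<And>i. i \<le> p \<Longrightarrow> c i i = id2 G (f i)"
    and P: "\<And>i j k. \<lbrakk>i < j; j < k; k \<le> p\<rbrakk> \<Longrightarrow>
      prism G (f i) (f k) (g i j) (g' j k) (a i j k) (a' i j k) (c i j) (c i k) (c j k)"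
  shows "normal_pseudofunctor G (grid p 1)
    (cyl_vert x x') (cyl_edge G g g' f) (cyl_tri G g a a' f c)"
proof -
  interpret D: normal_pseudofunctor G "chain p" x g a by (rule D)
  interpret D': normal_pseudofunctor G "chain p" x' g' a' by (rule D')
  have f' [simp]: "f i \<in> Mor G" "src G (f i) = x i" "tgt G (f i) = x' i" if "chain p i i" for i
    using that f[of i] by (auto simp: Hom1_def chain_def)
  have c' [simp]: "c i j \<in> Cell G" "src2 G (c i j) = f j \<odot> g i j" "tgt2 G (c i j) = g' i j \<odot> f i"
    if ij: "chain p i j" for i j
  proof -
    have "c i j \<in> Hom2 G (f j \<odot> g i j) (g' i j \<odot> f i)"
    proof (cases "i = j")
      case True
      have "chain p j j" using ij by (simp add: chain_def)
      then show ?thesis using ij D.E_id[of j] D'.E_id[of j] True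
        by (simp add: c_id chain_def Hom2_def)
    next
      case False
      then show ?thesis using ij c by (simp add: chain_def)
    qed
    then show "c i j \<in> Cell G" "src2 G (c i j) = f j \<odot> g i j" "tgt2 G (c i j) = g' i j \<odot> f i"
      by (auto simp: Hom2_def)
  qed
  have P': "(id2 G (g' j k) \<diamondop> c i j) \<star> (c j k \<diamondop> id2 G (g i j)) \<star> (id2 G (f k) \<diamondop> a i j k)
      = (a' i j k \<diamondop> id2 G (f i)) \<star> c i k"
    if le: "chain p i j" "chain p j k" for i j k
  proof -
    note r [simp] = that chain_refl[OF that(1)] chain_refl[OF that(2)] chain_trans[OF that]
    have le': "i \<le> p" "j \<le> p" "k \<le> p" using that by (auto simp: chain_def)
    consider "i = j" | "j = k" | "i < j" "j < k"
      using le unfolding chain_def by linarith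
    then show ?thesis
    proof cases
      case 1
      then show ?thesis using r by (simp add: D.E_id D.A_id_left D'.A_id_left c_id le')
    next
      case 2
      then show ?thesis using r by (simp add: D'.E_id D.A_id_right D'.A_id_right c_id le')
    next
      case 3
      then show ?thesis using P le' by (simp add: prism_def)
    qed
  qed
  let ?E = "cyl_edge G g g' f" and ?A = "cyl_tri G g a a' f c"
  have coc: "(id2 G (?E w z) \<diamondop> ?A u v w) \<star> ?A u w z = (?A v w z \<diamondop> id2 G (?E u v)) \<star> ?A u v z"
    if g4: "grid p 1 u v" "grid p 1 v w" "grid p 1 w z" for u v w z
  proof -
    obtain i j k l where ijkl: "fst u = i" "fst v = j" "fst w = k" "fst z = l" by blast
    note h [simp] = ijkl cyl_edge_def cyl_tri_def
    have le [simp]: "chain p i j" "chain p j k" "chain p k l" "chain p i k" "chain p j l" "chain p i l"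
      "chain p i i" "chain p j j" "chain p k k" "chain p l l"
      using g4 by (auto simp: grid_def chain_def)
    have coca: "(id2 G (g k l) \<diamondop> a i j k) \<star> a i k l = (a j k l \<diamondop> id2 G (g i j)) \<star> a i j l"
      by (rule D.cocycle) simp_all
    have fcoca: "(id2 G (f l \<odot> g k l) \<diamondop> a i j k) \<star> (id2 G (f l) \<diamondop> a i k l) =
        (id2 G (f l) \<diamondop> (a j k l \<diamondop> id2 G (g i j))) \<star> (id2 G (f l) \<diamondop> a i j l)"
      using arg_cong[OF coca, of "\<lambda>e. id2 G (f l) \<diamondop> e"] by simp
    have ex: "(id2 G (g' k l \<odot> f k) \<diamondop> a i j k) \<star> (c k l \<diamondop> id2 G (g i k)) \<star> (id2 G (f l) \<diamondop> a i k l)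
      = (c k l \<diamondop> id2 G (g j k \<odot> g i j)) \<star> (id2 G (f l \<odot> g k l) \<diamondop> a i j k) \<star> (id2 G (f l) \<diamondop> a i k l)"
      by (rule D.exchange_under[symmetric]) simp_all
    consider "snd z = 0" | "snd z = 1" "snd w = 0" | "snd z = 1" "snd w = 1" "snd v = 0"
      | "snd z = 1" "snd w = 1" "snd v = 1" "snd u = 0" 
      | "snd z = 1" "snd w = 1" "snd v = 1" "snd u = 1"
      using g4 by (auto simp: grid_def chain_def) linarith
    then show ?thesis
    proof cases
      case 1
      then have "snd u = 0" "snd v = 0" "snd w = 0" using g4 by (auto simp: grid_def chain_def)
      with 1 coca show ?thesis by simp
    next
      case 2
      then have "snd u = 0" "snd v = 0" using g4 by (auto simp: grid_def chain_def)
      with 2 fcoca show ?thesis by simp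
    next
      case 3
      then have "snd u = 0" using g4 by (auto simp: grid_def chain_def)
      with 3 ex fcoca show ?thesis by simp
    next
      case 4
      have "((id2 G (g' k l) \<diamondop> c j k) \<star> (c k l \<diamondop> id2 G (g j k)) \<star> (id2 G (f l) \<diamondop> a j k l)) \<diamondop> id2 G (g i j)
        = ((a' j k l \<diamondop> id2 G (f j)) \<star> c j l) \<diamondop> id2 G (g i j)"
        using P'[of j k l] by simp
      then have "((id2 G (g' k l) \<diamondop> c j k) \<diamondop> id2 G (g i j)) \<star> (c k l \<diamondop> id2 G (g j k \<odot> g i j))
          \<star> ((id2 G (f l) \<diamondop> a j k l) \<diamondop> id2 G (g i j))
        = (a' j k l \<diamondop> id2 G (f j \<odot> g i j)) \<star> (c j l \<diamondop> id2 G (g i j))"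
        by simp
      from arg_cong[OF this, of "\<lambda>e. e \<star> (id2 G (f l) \<diamondop> a i j l)"]
      show ?thesis using 4 ex fcoca by simp
    next
      case 5
      with D'.cocycle[of i j k l] show ?thesis by simp
    qed
  qed
  show ?thesis
  proof unfold_locales
    fix u v w assume *: "grid p 1 u v"
    then have le [simp]: "chain p (fst u) (fst v)" "chain p (fst u) (fst u)" "chain p (fst v) (fst v)"
      by (auto simp: grid_def chain_def)
    show "?E u v \<in> Hom1 G (cyl_vert x x' u) (cyl_vert x x' v)"
      using * by (auto simp: Hom1_def cyl_edge_def cyl_vert_def grid_def chain_def)
    show "?A u u v = id2 G (?E u v)"
      by (simp add: cyl_tri_def cyl_edge_def D.A_id_left D'.A_id_left)
    show "?A u v v = id2 G (?E u v)" using *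
      by (auto simp add: cyl_tri_def cyl_edge_def D.A_id_right D'.A_id_right grid_def chain_def c_id)
    assume **: "grid p 1 v w"
    then have le2 [simp]: "chain p (fst v) (fst w)" "chain p (fst u) (fst w)" "chain p (fst w) (fst w)"
      using * by (auto simp: grid_def chain_def)
    show "?A u v w \<in> Hom2 G (?E u w) (?E v w \<odot> ?E u v)"
      using * ** by (auto simp: Hom2_def cyl_tri_def cyl_edge_def grid_def chain_def)
  next
    fix u assume "grid p 1 u u"
    then have [simp]: "chain p (fst u) (fst u)" by (simp add: grid_def)
    show "cyl_vert x x' u \<in> Obj G" by (simp add: cyl_vert_def D.V_in D'.V_in)
    show "?E u u = id1 G (cyl_vert x x' u)" by (simp add: cyl_vert_def cyl_edge_def D.E_id D'.E_id)
  qed (use grid_refl grid_trans coc in \<open>blast+\<close>)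
qed

text \<open>The converse of the above: the prism over \<open>i < j < k\<close> is the union of three tetrahedra, and \<open>c r s\<close> is
  characterized by carrying one triangle of the square over \<open>r < s\<close> to the other one. Composing the prism equation with the
  triangle \<open>A (i, 0) (k, 0) (k, 1)\<close> on the right, each tetrahedron moves the composite past one of them.\<close>

lemma prism_of_cylinder:
  fixes G :: "('o, 'm, 'c) two_groupoid" (structure)
  assumes "normal_pseudofunctor G (grid p 1) V E A"
    and "i < j" "j < k" "k \<le> p"
    and c: "\<And>r s. \<lbrakk>r < s; s \<le> p\<rbrakk> \<Longrightarrow>
        c r s \<in> Hom2 G (E (s, 0) (s, 1) \<odot> E (r, 0) (s, 0)) (E (r, 1) (s, 1) \<odot> E (r, 0) (r, 1))"
    and ct: "\<And>r s. \<lbrakk>r < s; s \<le> p\<rbrakk> \<Longrightarrow> c r s \<star> A (r, 0) (s, 0) (s, 1) = A (r, 0) (r, 1) (s, 1)"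
  shows "prism G (E (i, 0) (i, 1)) (E (k, 0) (k, 1)) (E (i, 0) (j, 0)) (E (j, 1) (k, 1))
    (A (i, 0) (j, 0) (k, 0)) (A (i, 1) (j, 1) (k, 1)) (c i j) (c i k) (c j k)"
proof -
  interpret normal_pseudofunctor G "grid p 1" V E A by fact
  note One_nat_def [simp del]
  have gr [simp]: "grid p 1 (r, m) (s, n) \<longleftrightarrow> r \<le> s \<and> s \<le> p \<and> m \<le> n \<and> n \<le> 1" for r s m n
    by (auto simp: grid_def chain_def)
  have [simp]: "i < j" "j < k" "i < k" "i \<le> j" "j \<le> k" "i \<le> k" "i \<le> p" "j \<le> p" "k \<le> p"
    using assms(2-4) by auto
  have c' [simp]: "c r s \<in> Cell G" "src2 G (c r s) = E (s, 0) (s, 1) \<odot> E (r, 0) (s, 0)"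
    "tgt2 G (c r s) = E (r, 1) (s, 1) \<odot> E (r, 0) (r, 1)" if "r < s" "s \<le> p" for r s
    using c[OF that] by (auto simp: Hom2_def)
  note ct1 = ct[of j k, THEN arg_cong, of "\<lambda>e. e \<diamondop> id2 G (E (i, 0) (j, 0))", simplified]
   and ct2 = ct[of i j, THEN arg_cong, of "\<lambda>e. id2 G (E (j, 1) (k, 1)) \<diamondop> e", simplified]
  have t1: "(id2 G (E (k, 0) (k, 1)) \<diamondop> A (i, 0) (j, 0) (k, 0)) \<star> A (i, 0) (k, 0) (k, 1)
    = (A (j, 0) (k, 0) (k, 1) \<diamondop> id2 G (E (i, 0) (j, 0))) \<star> A (i, 0) (j, 0) (k, 1)"
    by (rule cocycle) simp_all
  have t2: "(id2 G (E (j, 1) (k, 1)) \<diamondop> A (i, 0) (j, 0) (j, 1)) \<star> A (i, 0) (j, 1) (k, 1)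
    = (A (j, 0) (j, 1) (k, 1) \<diamondop> id2 G (E (i, 0) (j, 0))) \<star> A (i, 0) (j, 0) (k, 1)"
    by (rule cocycle) simp_all
  have t3: "(id2 G (E (j, 1) (k, 1)) \<diamondop> A (i, 0) (i, 1) (j, 1)) \<star> A (i, 0) (j, 1) (k, 1)
    = (A (i, 1) (j, 1) (k, 1) \<diamondop> id2 G (E (i, 0) (i, 1))) \<star> A (i, 0) (i, 1) (k, 1)"
    by (rule cocycle) simp_all
  let ?L = "(id2 G (E (j, 1) (k, 1)) \<diamondop> c i j) \<star> (c j k \<diamondop> id2 G (E (i, 0) (j, 0)))
    \<star> (id2 G (E (k, 0) (k, 1)) \<diamondop> A (i, 0) (j, 0) (k, 0))"
  let ?R = "(A (i, 1) (j, 1) (k, 1) \<diamondop> id2 G (E (i, 0) (i, 1))) \<star> c i k"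
  have "?L \<star> A (i, 0) (k, 0) (k, 1)
    = (id2 G (E (j, 1) (k, 1)) \<diamondop> c i j) \<star> ((c j k \<diamondop> id2 G (E (i, 0) (j, 0)))
      \<star> (A (j, 0) (k, 0) (k, 1) \<diamondop> id2 G (E (i, 0) (j, 0)))) \<star> A (i, 0) (j, 0) (k, 1)"
    using t1 by simp
  also have "\<dots> = (id2 G (E (j, 1) (k, 1)) \<diamondop> c i j)
     \<star> (id2 G (E (j, 1) (k, 1)) \<diamondop> A (i, 0) (j, 0) (j, 1)) \<star> A (i, 0) (j, 1) (k, 1)"
    unfolding ct1 t2 ..
  also have "\<dots> = ((id2 G (E (j, 1) (k, 1)) \<diamondop> c i j)
     \<star> (id2 G (E (j, 1) (k, 1)) \<diamondop> A (i, 0) (j, 0) (j, 1))) \<star> A (i, 0) (j, 1) (k, 1)"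
    by simp
  also have "\<dots> = (A (i, 1) (j, 1) (k, 1) \<diamondop> id2 G (E (i, 0) (i, 1))) \<star> (c i k \<star> A (i, 0) (k, 0) (k, 1))"
    unfolding ct2 t3 using ct[of i k] by simp
  also have "\<dots> = ?R \<star> A (i, 0) (k, 0) (k, 1)"
    by simp
  finally show ?thesis unfolding prism_def
    by (rule vcomp_cancel_right[rotated 5]) simp_all
qed

section \<open>Simplices of the nerve as pseudofunctors\<close>

lemma compose_Delta: "\<lbrakk>\<alpha> \<in> Delta l m; \<beta> \<in> Delta m n\<rbrakk> \<Longrightarrow> compose {..l} \<beta> \<alpha> \<in> Delta l n"
  by (auto simp: Delta_def compose_def mono_on_def PiE_def Pi_def extensional_def)

lemma Delta_r_Delta: "\<theta> \<in> Delta_r m n \<Longrightarrow> \<theta> \<in> Delta m n"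
  by (simp add: Delta_r_def)

lemma ord_id_Delta: "ord_id n \<in> Delta n n"
  by (auto simp: Delta_def ord_id_def mono_on_def)

lemma Delta_le: "\<lbrakk>\<alpha> \<in> Delta m n; i \<le> m\<rbrakk> \<Longrightarrow> \<alpha> i \<le> n"
  by (auto simp: Delta_def)

lemma Delta_mono: "\<lbrakk>\<alpha> \<in> Delta m n; i \<le> j; j \<le> m\<rbrakk> \<Longrightarrow> \<alpha> i \<le> \<alpha> j"
  by (auto simp: Delta_def mono_on_def)

lemma Delta_r_strict: "\<lbrakk>\<theta> \<in> Delta_r m n; i < j; j \<le> m\<rbrakk> \<Longrightarrow> \<theta> i < \<theta> j"
  using Delta_mono[of \<theta> m n i j] inj_onD[of \<theta> "{..m}" i j] by (fastforce simp: Delta_r_def)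

lemma compose_ord_id: "\<alpha> \<in> Delta m n \<Longrightarrow> compose {..m} (ord_id n) \<alpha> = \<alpha>"
  "\<alpha> \<in> Delta m n \<Longrightarrow> compose {..m} \<alpha> (ord_id m) = \<alpha>"
  by (auto simp: Delta_def ord_id_def compose_def PiE_def extensional_def fun_eq_iff Pi_def)

text \<open>The simplex of the nerve which a pseudofunctor assigns to a chain \<open>u 0 \<le> \<dots> \<le> u l\<close> of its index poset.\<close>

definition nsimplex :: "nat \<Rightarrow> ('i \<Rightarrow> 'o) \<Rightarrow> ('i \<Rightarrow> 'i \<Rightarrow> 'm) \<Rightarrow> ('i \<Rightarrow> 'i \<Rightarrow> 'i \<Rightarrow> 'c) \<Rightarrow> (nat \<Rightarrow> 'i)
    \<Rightarrow> ('o, 'm, 'c) nerve_simplex" where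
  "nsimplex l V E A u =
     \<lparr>vert = (\<lambda>i\<in>{..l}. V (u i)),
      edge = (\<lambda>(i, j)\<in>pairs l. E (u i) (u j)),
      tri = (\<lambda>(i, j, k)\<in>triples l. A (u i) (u j) (u k))\<rparr>"

lemma nsimplex_cong:
  assumes "\<And>i. i \<le> l \<Longrightarrow> V (u i) = V' (u' i)"
    "\<And>i j. \<lbrakk>i < j; j \<le> l\<rbrakk> \<Longrightarrow> E (u i) (u j) = E' (u' i) (u' j)"
    "\<And>i j k. \<lbrakk>i < j; j < k; k \<le> l\<rbrakk> \<Longrightarrow> A (u i) (u j) (u k) = A' (u' i) (u' j) (u' k)"
  shows "nsimplex l V E A u = nsimplex l V' E' A' u'"
  using assms by (auto simp: nsimplex_def pairs_def triples_def intro!: restrict_ext)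

lemma nerve_data_map_nsimplex:
  "nerve_data_map F l (nsimplex l V E A u) =
     nsimplex l (\<lambda>a. on_obj F (V a)) (\<lambda>a b. on_mor F (E a b)) (\<lambda>a b c. on_cell F (A a b c)) u"
  by (auto simp: nsimplex_def nerve_data_map_def intro!: restrict_ext)

context normal_pseudofunctor
begin

lemma nsimplex_in_nerve:
  assumes "\<And>i j. \<lbrakk>i \<le> j; j \<le> l\<rbrakk> \<Longrightarrow> u i \<preceq> u j"
  shows "nsimplex l V E A u \<in> nerve_simplices G l"
  unfolding nerve_simplices_def
  using assms by (auto simp: nsimplex_def pairs_def triples_def intro!: V_in E_in A_in cocycle)

text \<open>Degeneracies insert identities in the nerve, so this is where normality of the pseudofunctor enters.\<close>

lemma nerve_act_nsimplex:
  assumes u: "\<And>i j. \<lbrakk>i \<le> j; j \<le> l\<rbrakk> \<Longrightarrow> u i \<preceq> u j" and \<alpha>: "\<alpha> \<in> Delta m l"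
  shows "nerve_act G m \<alpha> (nsimplex l V E A u) = nsimplex m V E A (\<lambda>i. u (\<alpha> i))"
proof -
  have e: "nerve_edge G (nsimplex l V E A u) i j = E (u i) (u j)" if "i \<le> j" "j \<le> l" for i j
    using that u[of i i] by (cases "i = j") (auto simp: nerve_edge_def nsimplex_def pairs_def E_id)
  have t: "nerve_tri G (nsimplex l V E A u) i j k = A (u i) (u j) (u k)"
    if "i \<le> j" "j \<le> k" "k \<le> l" for i j k
  proof -
    have "i < j \<and> j < k \<or> i = j \<or> j = k" using that by linarith
    then show ?thesis using that u
      by (auto simp: nerve_tri_def e A_id_left A_id_right) (simp add: nsimplex_def triples_def)
  qed
  show ?thesis
    using Delta_le[OF \<alpha>] Delta_mono[OF \<alpha>]
    by (auto simp: nerve_act_def nsimplex_def[of m] e t pairs_def triples_def intro!: restrict_ext)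
      (simp add: nsimplex_def)
qed

end

section \<open>Simplices of the restricted totalization as families of pseudofunctors\<close>

text \<open>A \<open>k\<close>-simplex \<open>(\<sigma>, \<tau>)\<close> of \<open>\<Delta>\<^sup>p \<times> \<Delta>\<^sup>n\<close> is a chain of \<open>k + 1\<close> points of \<open>[p] \<times> [n]\<close>. Its image in the coskeleton is
  given by its faces and degeneracies \<open>\<rho>\<close> of dimension \<open>l \<le> 3\<close>.\<close>

definition tot_of :: "nat \<Rightarrow> (nat \<Rightarrow> nat \<times> nat \<Rightarrow> 'o) \<Rightarrow> (nat \<Rightarrow> nat \<times> nat \<Rightarrow> nat \<times> nat \<Rightarrow> 'm)
    \<Rightarrow> (nat \<Rightarrow> nat \<times> nat \<Rightarrow> nat \<times> nat \<Rightarrow> nat \<times> nat \<Rightarrow> 'c)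
    \<Rightarrow> ('o, 'm, 'c) cosk_simplex tot_simplex" where
  "tot_of n V E A p k = (\<lambda>(\<sigma>, \<tau>)\<in>Delta k p \<times> Delta k n. \<lambda>l\<in>{..3}. \<lambda>\<rho>\<in>Delta l k.
     nsimplex l (V p) (E p) (A p) (\<lambda>i. (\<sigma> (\<rho> i), \<tau> (\<rho> i))))"

text \<open>Injections of ordinals act on the cosimplicial coordinate of \<open>[p] \<times> [n]\<close> only.\<close>

definition push :: "(nat \<Rightarrow> nat) \<Rightarrow> nat \<times> nat \<Rightarrow> nat \<times> nat" where
  "push \<theta> u = (\<theta> (fst u), snd u)"

definition pseudofunctor_family :: "('o, 'm, 'c) cosimp_two_groupoid \<Rightarrow> nat
    \<Rightarrow> (nat \<Rightarrow> nat \<times> nat \<Rightarrow> 'o) \<Rightarrow> (nat \<Rightarrow> nat \<times> nat \<Rightarrow> nat \<times> nat \<Rightarrow> 'm)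
    \<Rightarrow> (nat \<Rightarrow> nat \<times> nat \<Rightarrow> nat \<times> nat \<Rightarrow> nat \<times> nat \<Rightarrow> 'c) \<Rightarrow> bool" where
  "pseudofunctor_family G n V E A \<longleftrightarrow>
     (\<forall>p. normal_pseudofunctor (deg G p) (grid p n) (V p) (E p) (A p)) \<and>
     (\<forall>p q. \<forall>\<theta>\<in>Delta_r p q.
       (\<forall>u. grid p n u u \<longrightarrow> V q (push \<theta> u) = on_obj (act G p q \<theta>) (V p u)) \<and>
       (\<forall>u v. grid p n u v \<longrightarrow> E q (push \<theta> u) (push \<theta> v) = on_mor (act G p q \<theta>) (E p u v)) \<and>
       (\<forall>u v w. grid p n u v \<longrightarrow> grid p n v w \<longrightarrow>
          A q (push \<theta> u) (push \<theta> v) (push \<theta> w) = on_cell (act G p q \<theta>) (A p u v w)))"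

lemma Tot_r_nerve_iff:
  "T \<in> simp (Tot_r (restr (nerve_cosimp G))) n \<longleftrightarrow>
    (\<forall>p k. T p k \<in> Delta k p \<times> Delta k n \<rightarrow>\<^sub>E trunc_hom 3 (std_simplex k) (nerve_data (deg G p))) \<and>
    (\<forall>p m k. \<forall>\<alpha>\<in>Delta m k. \<forall>\<sigma>\<in>Delta k p. \<forall>\<tau>\<in>Delta k n.
       T p m (compose {..m} \<sigma> \<alpha>, compose {..m} \<tau> \<alpha>) =
       (\<lambda>l\<in>{..3}. \<lambda>\<rho>\<in>Delta l m. T p k (\<sigma>, \<tau>) l (compose {..l} \<alpha> \<rho>))) \<and>
    (\<forall>p q. \<forall>\<theta>\<in>Delta_r p q. \<forall>k. \<forall>\<sigma>\<in>Delta k p. \<forall>\<tau>\<in>Delta k n.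
       T q k (compose {..k} \<theta> \<sigma>, \<tau>) =
       (\<lambda>l\<in>{..3}. \<lambda>\<rho>\<in>Delta l k. nerve_data_map (act G p q \<theta>) l (T p k (\<sigma>, \<tau>) l \<rho>)))"
  by (simp add: Tot_r_def rcosimp_hom_def Tot_dom_def cosimp_prod_def const_cosimp_def restr_def
      std_cosimp_def sset_hom_def sset_prod_def std_simplex_def nerve_cosimp_def nerve_def cosk_def
      nerve_map_def cosk_map_def) blast

lemma Tot_r_nerve_sact:
  "sact (Tot_r (restr (nerve_cosimp G))) m n \<beta> T p k =
    (\<lambda>(\<sigma>, \<tau>)\<in>Delta k p \<times> Delta k m. T p k (\<sigma>, compose {..k} \<beta> \<tau>))"
  by (simp add: Tot_r_def Tot_dom_def cosimp_prod_def const_cosimp_def restr_def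
      std_cosimp_def sset_prod_def std_simplex_def)

lemma tot_of_cong:
  assumes "\<And>p u. grid p n u u \<Longrightarrow> V p u = V' p u"
    "\<And>p u v. grid p n u v \<Longrightarrow> E p u v = E' p u v"
    "\<And>p u v w. \<lbrakk>grid p n u v; grid p n v w\<rbrakk> \<Longrightarrow> A p u v w = A' p u v w"
  shows "tot_of n V E A = tot_of n V' E' A'"
proof (rule ext, rule ext, rule ext)
  fix p k and st :: "(nat \<Rightarrow> nat) \<times> (nat \<Rightarrow> nat)"
  have "(case st of (\<sigma>, \<tau>) \<Rightarrow> \<lambda>l\<in>{..3}. \<lambda>\<rho>\<in>Delta l k. nsimplex l (V p) (E p) (A p) (\<lambda>i. (\<sigma> (\<rho> i), \<tau> (\<rho> i))))
    = (case st of (\<sigma>, \<tau>) \<Rightarrow> \<lambda>l\<in>{..3}. \<lambda>\<rho>\<in>Delta l k. nsimplex l (V' p) (E' p) (A' p) (\<lambda>i. (\<sigma> (\<rho> i), \<tau> (\<rho> i))))"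
    if "st \<in> Delta k p \<times> Delta k n" for st
    using that by (auto intro!: restrict_ext nsimplex_cong assms simp: grid_def chain_def Delta_le Delta_mono)
  then show "tot_of n V E A p k st = tot_of n V' E' A' p k st"
    by (simp add: tot_of_def restrict_def)
qed

lemma tot_of_sact:
  assumes "\<beta> \<in> Delta m n"
  shows "sact (Tot_r (restr (nerve_cosimp G))) m n \<beta> (tot_of n V E A) =
    tot_of m (\<lambda>p u. V p (fst u, \<beta> (snd u))) (\<lambda>p u v. E p (fst u, \<beta> (snd u)) (fst v, \<beta> (snd v)))
      (\<lambda>p u v w. A p (fst u, \<beta> (snd u)) (fst v, \<beta> (snd v)) (fst w, \<beta> (snd w)))"
    (is "_ = ?T")
proof (rule ext, rule ext, rule ext)
  fix p k and st :: "(nat \<Rightarrow> nat) \<times> (nat \<Rightarrow> nat)"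
  show "sact (Tot_r (restr (nerve_cosimp G))) m n \<beta> (tot_of n V E A) p k st = ?T p k st"
  proof (cases "st \<in> Delta k p \<times> Delta k m")
    case True
    then show ?thesis unfolding Tot_r_nerve_sact tot_of_def
      using assms
      by (auto intro!: restrict_ext nsimplex_cong simp: compose_Delta) (auto simp: compose_def Delta_le)
  next
    case False
    then show ?thesis by (simp add: Tot_r_nerve_sact tot_of_def restrict_def)
  qed
qed

lemma tot_of_in_Tot:
  assumes fam: "pseudofunctor_family G n V E A"
  shows "tot_of n V E A \<in> simp (Tot_r (restr (nerve_cosimp G))) n"
proof -
  let ?T = "tot_of n V E A"
  have psf: "normal_pseudofunctor (deg G p) (grid p n) (V p) (E p) (A p)" for p
    using fam by (simp add: pseudofunctor_family_def)
  have path: "grid p n (\<sigma> (\<rho> i), \<tau> (\<rho> i)) (\<sigma> (\<rho> j), \<tau> (\<rho> j))"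
    if "\<sigma> \<in> Delta k p" "\<tau> \<in> Delta k n" "\<rho> \<in> Delta l k" "i \<le> j" "j \<le> l" for p \<sigma> \<tau> \<rho> k l i j
    using that by (simp add: grid_def chain_def Delta_le Delta_mono)
  show ?thesis
    unfolding Tot_r_nerve_iff
  proof (intro conjI allI ballI)
    fix p k
    show "?T p k \<in> Delta k p \<times> Delta k n \<rightarrow>\<^sub>E trunc_hom 3 (std_simplex k) (nerve_data (deg G p))"
    proof (rule PiE_I)
      fix st assume "st \<in> Delta k p \<times> Delta k n"
      then obtain \<sigma> \<tau> where st: "st = (\<sigma>, \<tau>)" "\<sigma> \<in> Delta k p" "\<tau> \<in> Delta k n" by auto
      interpret normal_pseudofunctor "deg G p" "grid p n" "V p" "E p" "A p" by (rule psf)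
      note path' = path[OF st(2,3)]
      show "?T p k st \<in> trunc_hom 3 (std_simplex k) (nerve_data (deg G p))"
        unfolding trunc_hom_def mem_Collect_eq
      proof (intro conjI allI impI ballI)
        show "?T p k st \<in> extensional {..3}" using st by (simp add: tot_of_def)
        show "?T p k st l \<in> simp (std_simplex k) l \<rightarrow>\<^sub>E simp (nerve_data (deg G p)) l" if "l \<le> 3" for l
          using st that path' by (auto simp: tot_of_def std_simplex_def nerve_data_def intro!: nsimplex_in_nerve)
        fix l m \<alpha> s assume a: "l \<le> (3::nat)" "m \<le> (3::nat)" "\<alpha> \<in> Delta l m" "s \<in> simp (std_simplex k) m"
        then have s: "s \<in> Delta m k" by (simp add: std_simplex_def)
        have "nsimplex l (V p) (E p) (A p) (\<lambda>i. (\<sigma> (compose {..l} s \<alpha> i), \<tau> (compose {..l} s \<alpha> i)))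
          = nsimplex l (V p) (E p) (A p) (\<lambda>i. (\<sigma> (s (\<alpha> i)), \<tau> (s (\<alpha> i))))"
          by (rule nsimplex_cong) (auto simp: compose_def)
        also have "\<dots> = nerve_act (deg G p) l \<alpha> (nsimplex m (V p) (E p) (A p) (\<lambda>i. (\<sigma> (s i), \<tau> (s i))))"
          using nerve_act_nsimplex[of m "\<lambda>i. (\<sigma> (s i), \<tau> (s i))" \<alpha> l] path'[OF s] a(3) by simp
        finally show "?T p k st l (sact (std_simplex k) l m \<alpha> s) =
            sact (nerve_data (deg G p)) l m \<alpha> (?T p k st m s)"
          using st a s compose_Delta[OF a(3) s]
          by (simp add: tot_of_def std_simplex_def nerve_data_def)
      qed
    qed (auto simp: tot_of_def)
  next
    fix p m k \<alpha> \<sigma> \<tau> assume a: "\<alpha> \<in> Delta m k" "\<sigma> \<in> Delta k p" "\<tau> \<in> Delta k n"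
    show "?T p m (compose {..m} \<sigma> \<alpha>, compose {..m} \<tau> \<alpha>) =
       (\<lambda>l\<in>{..3}. \<lambda>\<rho>\<in>Delta l m. ?T p k (\<sigma>, \<tau>) l (compose {..l} \<alpha> \<rho>))"
      using a by (auto simp: tot_of_def compose_Delta intro!: restrict_ext nsimplex_cong)
        (auto simp: compose_def Delta_le)
  next
    fix p q \<theta> k \<sigma> \<tau> assume a: "\<theta> \<in> Delta_r p q" "\<sigma> \<in> Delta k p" "\<tau> \<in> Delta k n"
    have "nsimplex l (V q) (E q) (A q) (\<lambda>i. (compose {..k} \<theta> \<sigma> (\<rho> i), \<tau> (\<rho> i)))
      = nerve_data_map (act G p q \<theta>) l (nsimplex l (V p) (E p) (A p) (\<lambda>i. (\<sigma> (\<rho> i), \<tau> (\<rho> i))))"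
      if \<rho>: "\<rho> \<in> Delta l k" for l \<rho>
    proof -
      have *: "(compose {..k} \<theta> \<sigma> (\<rho> i), \<tau> (\<rho> i)) = push \<theta> (\<sigma> (\<rho> i), \<tau> (\<rho> i))" if "i \<le> l" for i
        using that \<rho> by (simp add: push_def compose_def Delta_le)
      show ?thesis
        unfolding nerve_data_map_nsimplex
        using fam[unfolded pseudofunctor_family_def, THEN conjunct2, rule_format, OF a(1)] path[OF a(2,3) \<rho>]
        by (intro nsimplex_cong) (auto simp: *)
    qed
    then show "?T q k (compose {..k} \<theta> \<sigma>, \<tau>) =
       (\<lambda>l\<in>{..3}. \<lambda>\<rho>\<in>Delta l k. nerve_data_map (act G p q \<theta>) l (?T p k (\<sigma>, \<tau>) l \<rho>))"
      using a by (auto simp: tot_of_def compose_Delta Delta_r_Delta intro!: restrict_ext)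
  qed
qed

text \<open>Chains of one to four points; shorter chains repeat their last point.\<close>

definition pick :: "'i \<Rightarrow> 'i \<Rightarrow> 'i \<Rightarrow> 'i \<Rightarrow> nat \<Rightarrow> 'i" where
  "pick u v w z i = (if i = 0 then u else if i = 1 then v else if i = 2 then w else z)"

lemma pick_simps [simp]:
  "pick u v w z 0 = u" "pick u v w z 1 = v" "pick u v w z (Suc 0) = v" "pick u v w z 2 = w"
  "pick u v w z 3 = z"
  by (simp_all add: pick_def)

text \<open>The chain \<open>u 0 \<le> \<dots> \<le> u l\<close> of points of \<open>[p] \<times> [n]\<close> as an \<open>l\<close>-simplex of \<open>\<Delta>\<^sup>p \<times> \<Delta>\<^sup>n\<close>.\<close>

definition path :: "nat \<Rightarrow> (nat \<Rightarrow> nat \<times> nat) \<Rightarrow> (nat \<Rightarrow> nat) \<times> (nat \<Rightarrow> nat)" where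
  "path l u = (\<lambda>i\<in>{..l}. fst (u i), \<lambda>i\<in>{..l}. snd (u i))"

lemma pick_map: "(\<lambda>i. \<theta> (pick a b c d i)) = pick (\<theta> a) (\<theta> b) (\<theta> c) (\<theta> d)"
  by (auto simp: pick_def)

lemma nerve_simplicesD:
  assumes "s \<in> nerve_simplices G n"
  shows "i \<le> n \<Longrightarrow> vert s i \<in> Obj G"
    "\<lbrakk>i < j; j \<le> n\<rbrakk> \<Longrightarrow> edge s (i, j) \<in> Hom1 G (vert s i) (vert s j)"
    "\<lbrakk>i < j; j < k; k \<le> n\<rbrakk> \<Longrightarrow>
       tri s (i, j, k) \<in> Hom2 G (edge s (i, k)) (edge s (j, k) \<odot>\<^bsub>G\<^esub> edge s (i, j))"
    "\<lbrakk>i < j; j < k; k < l; l \<le> n\<rbrakk> \<Longrightarrow>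
       (id2 G (edge s (k, l)) \<diamondop>\<^bsub>G\<^esub> tri s (i, j, k)) \<star>\<^bsub>G\<^esub> tri s (i, k, l) =
       (tri s (j, k, l) \<diamondop>\<^bsub>G\<^esub> id2 G (edge s (i, j))) \<star>\<^bsub>G\<^esub> tri s (i, j, l)"
proof -
  note s = assms[unfolded nerve_simplices_def mem_Collect_eq]
  show "i \<le> n \<Longrightarrow> vert s i \<in> Obj G" using s by blast
  show "\<lbrakk>i < j; j \<le> n\<rbrakk> \<Longrightarrow> edge s (i, j) \<in> Hom1 G (vert s i) (vert s j)"
    using PiE_mem[OF s[THEN conjunct2, THEN conjunct1], of "(i, j)"] by (simp add: pairs_def)
  show "\<lbrakk>i < j; j < k; k \<le> n\<rbrakk> \<Longrightarrow>
       tri s (i, j, k) \<in> Hom2 G (edge s (i, k)) (edge s (j, k) \<odot>\<^bsub>G\<^esub> edge s (i, j))"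
    using PiE_mem[OF s[THEN conjunct2, THEN conjunct2, THEN conjunct1], of "(i, j, k)"]
    by (simp add: triples_def)
  show "\<lbrakk>i < j; j < k; k < l; l \<le> n\<rbrakk> \<Longrightarrow>
       (id2 G (edge s (k, l)) \<diamondop>\<^bsub>G\<^esub> tri s (i, j, k)) \<star>\<^bsub>G\<^esub> tri s (i, k, l) =
       (tri s (j, k, l) \<diamondop>\<^bsub>G\<^esub> id2 G (edge s (i, j))) \<star>\<^bsub>G\<^esub> tri s (i, j, l)"
    using s[THEN conjunct2, THEN conjunct2, THEN conjunct2] by blast
qed

text \<open>By naturality in the simplicial direction \<open>T\<close> is determined by the nerve simplices \<open>W p l u\<close> that it assigns to
  chains \<open>u\<close> of length \<open>l \<le> 3\<close>, evaluated at the identity of \<open>[l]\<close>. Restricting \<open>W p l u\<close> to its vertices, edges and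
  triangles gives the values of \<open>W\<close> on shorter chains, so these alone define \<open>V\<close>, \<open>E\<close> and \<open>A\<close>. The laws of a
  pseudofunctor are read off from the simplices of dimension at most 3, the degenerate ones giving normality.\<close>

lemma Tot_simplex_is_tot_of:
  assumes G: "cosimplicial_two_groupoid G"
    and T: "T \<in> simp (Tot_r (restr (nerve_cosimp G))) n"
  shows "\<exists>V E A. pseudofunctor_family G n V E A \<and> T = tot_of n V E A"
proof -
  define W where "W p l u = T p l (path l u) l (ord_id l)" for p l u
  define V where "V p u = vert (W p 0 (\<lambda>_. u)) 0" for p u
  define E where "E p u v = edge (W p 1 (pick u v v v)) (0, 1)" for p u v
  define A where "A p u v w = tri (W p 2 (pick u v w w)) (0, 1, 2)" for p u v w
  define mon where "mon p l u \<longleftrightarrow> (\<forall>i j. i \<le> j \<longrightarrow> j \<le> l \<longrightarrow> grid p n (u i) (u j))" for p u and l :: nat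
  note T' = T[unfolded Tot_r_nerve_iff]
  note T_in = T'[THEN conjunct1, rule_format]
    and T_nat = T'[THEN conjunct2, THEN conjunct1, rule_format]
    and T_cos = T'[THEN conjunct2, THEN conjunct2, rule_format]
  have path_in: "path l u \<in> Delta l p \<times> Delta l n" if "mon p l u" for p l u
    using that by (auto simp: path_def Delta_def mon_def grid_def chain_def mono_on_def)
  have T_in': "T p k (\<sigma>, \<tau>) \<in> trunc_hom 3 (std_simplex k) (nerve_data (deg G p))"
    if "\<sigma> \<in> Delta k p" "\<tau> \<in> Delta k n" for p k \<sigma> \<tau>
    using T_in[of p k] that by auto
  \<comment> \<open>everything is seen on simplices evaluated at the identity\<close>
  have T_W: "T p k (\<sigma>, \<tau>) l \<rho> = W p l (\<lambda>i. (\<sigma> (\<rho> i), \<tau> (\<rho> i)))"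
    if "\<sigma> \<in> Delta k p" "\<tau> \<in> Delta k n" "\<rho> \<in> Delta l k" "l \<le> 3" for p k \<sigma> \<tau> l \<rho>
  proof -
    have "path l (\<lambda>i. (\<sigma> (\<rho> i), \<tau> (\<rho> i))) = (compose {..l} \<sigma> \<rho>, compose {..l} \<tau> \<rho>)"
      by (simp add: path_def compose_def)
    then show ?thesis
      using that T_nat[OF that(3,1,2)] by (simp add: W_def ord_id_Delta compose_ord_id)
  qed
  have W_in: "W p l u \<in> nerve_simplices (deg G p) l" if "mon p l u" "l \<le> 3" for p l u
  proof -
    have "T p l (path l u) \<in> trunc_hom 3 (std_simplex l) (nerve_data (deg G p))"
      using path_in[OF that(1)] T_in' by auto
    then have "T p l (path l u) l \<in> Delta l l \<rightarrow>\<^sub>E nerve_simplices (deg G p) l"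
      using that(2) by (auto simp: trunc_hom_def std_simplex_def nerve_data_def)
    then show ?thesis using ord_id_Delta by (auto simp: W_def)
  qed
  have W_cong: "W p l u = W p l u'" if "\<And>i. i \<le> l \<Longrightarrow> u i = u' i" for p l u u'
  proof -
    have "path l u = path l u'" using that by (auto simp: path_def intro!: restrict_ext)
    then show ?thesis by (simp add: W_def)
  qed
  have W_act: "nerve_act (deg G p) m \<alpha> (W p l u) = W p m (\<lambda>i. u (\<alpha> i))"
    if u: "mon p l u" and l: "l \<le> 3" "m \<le> 3" and \<alpha>: "\<alpha> \<in> Delta m l" for p l m \<alpha> u
  proof -
    obtain \<sigma> \<tau> where st: "path l u = (\<sigma>, \<tau>)" "\<sigma> \<in> Delta l p" "\<tau> \<in> Delta l n"
      using path_in[OF u] by (metis mem_Sigma_iff surj_pair)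
    have "T p l (\<sigma>, \<tau>) \<in> trunc_hom 3 (std_simplex l) (nerve_data (deg G p))"
      using st T_in' by auto
    then have "T p l (\<sigma>, \<tau>) m (compose {..m} (ord_id l) \<alpha>) =
        nerve_act (deg G p) m \<alpha> (T p l (\<sigma>, \<tau>) l (ord_id l))"
      using l \<alpha> ord_id_Delta[of l] by (auto simp: trunc_hom_def std_simplex_def nerve_data_def)
    then have "nerve_act (deg G p) m \<alpha> (W p l u) = W p m (\<lambda>i. (\<sigma> (\<alpha> i), \<tau> (\<alpha> i)))"
      using T_W[OF st(2,3) \<alpha> l(2)] \<alpha> by (simp add: W_def st(1) compose_ord_id)
    also have "\<dots> = W p m (\<lambda>i. u (\<alpha> i))"
      using st(1) Delta_le[OF \<alpha>] by (intro W_cong) (auto simp: path_def)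
    finally show ?thesis .
  qed
  have W_push: "W q l (\<lambda>i. push \<theta> (u i)) = nerve_data_map (act G p q \<theta>) l (W p l u)"
    if u: "mon p l u" and l: "l \<le> 3" and \<theta>: "\<theta> \<in> Delta_r p q" for p q l \<theta> u
  proof -
    obtain \<sigma> \<tau> where st: "path l u = (\<sigma>, \<tau>)" "\<sigma> \<in> Delta l p" "\<tau> \<in> Delta l n"
      using path_in[OF u] by (metis mem_Sigma_iff surj_pair)
    have "path l (\<lambda>i. push \<theta> (u i)) = (compose {..l} \<theta> \<sigma>, \<tau>)"
      using st(1) by (auto simp: path_def push_def compose_def intro!: restrict_ext)
    then show ?thesis
      using T_cos[OF \<theta> st(2,3)] l by (simp add: W_def st(1) ord_id_Delta)
  qed
  \<comment> \<open>faces of \<open>W p l u\<close> are values of \<open>W\<close> on subchains of \<open>u\<close>\<close>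
  have W_vert: "vert (W p l u) i = V p (u i)"
    if u: "mon p l u" and l: "l \<le> 3" and i: "i \<le> l" for p l u i
  proof -
    have "(\<lambda>_\<in>{..0}. i) \<in> Delta 0 l" using i by (auto simp: Delta_def mono_on_def)
    from arg_cong[OF W_act[OF u l _ this], of "\<lambda>s. vert s 0"]
    have "vert (W p l u) i = vert (W p 0 (\<lambda>k. u ((\<lambda>_\<in>{..0::nat}. i) k))) 0"
      by (simp add: nerve_act_def)
    also have "W p 0 (\<lambda>k. u ((\<lambda>_\<in>{..0::nat}. i) k)) = W p 0 (\<lambda>_. u i)"
      by (rule W_cong) simp
    finally show ?thesis by (simp add: V_def)
  qed
  have W_edge: "nerve_edge (deg G p) (W p l u) i j = E p (u i) (u j)"
    if u: "mon p l u" and l: "l \<le> 3" and ij: "i \<le> j" "j \<le> l" for p l u i j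
  proof -
    let ?\<alpha> = "restrict (pick i j j j) {..1}"
    have "?\<alpha> \<in> Delta 1 l" using ij by (auto simp: Delta_def mono_on_def pick_def)
    from arg_cong[OF W_act[OF u l _ this], of "\<lambda>s. edge s (0, 1)"]
    have "nerve_edge (deg G p) (W p l u) i j = edge (W p 1 (\<lambda>k. u (?\<alpha> k))) (0, 1)"
      by (simp add: nerve_act_def pairs_def)
    also have "W p 1 (\<lambda>k. u (?\<alpha> k)) = W p 1 (pick (u i) (u j) (u j) (u j))"
      by (rule W_cong) (auto simp: pick_def)
    finally show ?thesis by (simp add: E_def)
  qed
  have W_tri: "nerve_tri (deg G p) (W p l u) i j k = A p (u i) (u j) (u k)"
    if u: "mon p l u" and l: "l \<le> 3" and ij: "i \<le> j" "j \<le> k" "k \<le> l" for p l u i j k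
  proof -
    let ?\<alpha> = "restrict (pick i j k k) {..2}"
    have "?\<alpha> \<in> Delta 2 l" using ij by (auto simp: Delta_def mono_on_def pick_def)
    from arg_cong[OF W_act[OF u l _ this], of "\<lambda>s. tri s (0, 1, 2)"]
    have "nerve_tri (deg G p) (W p l u) i j k = tri (W p 2 (\<lambda>k. u (?\<alpha> k))) (0, 1, 2)"
      by (simp add: nerve_act_def triples_def)
    also have "W p 2 (\<lambda>k. u (?\<alpha> k)) = W p 2 (pick (u i) (u j) (u k) (u k))"
      by (rule W_cong) (auto simp: pick_def)
    finally show ?thesis by (simp add: A_def)
  qed
  have W_edge': "edge (W p l u) (i, j) = E p (u i) (u j)"
    if "mon p l u" "l \<le> 3" "i < j" "j \<le> l" for p l u i j
    using W_edge[OF that(1,2), of i j] that by (simp add: nerve_edge_def)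
  have W_tri': "tri (W p l u) (i, j, k) = A p (u i) (u j) (u k)"
    if "mon p l u" "l \<le> 3" "i < j" "j < k" "k \<le> l" for p l u i j k
    using W_tri[OF that(1,2), of i j k] that by (simp add: nerve_tri_def)
  have mon3: "mon p l (pick u v w z)" if "grid p n u v" "grid p n v w" "grid p n w z" "l \<le> 3" for p l u v w z
  proof -
    have "grid p n u u" "grid p n v v" "grid p n w w" "grid p n z z" "grid p n u w" "grid p n v z" "grid p n u z"
      using that grid_refl grid_trans by blast+
    with that(1-3) show ?thesis by (auto simp: mon_def pick_def)
  qed
  have psf: "normal_pseudofunctor (deg G p) (grid p n) (V p) (E p) (A p)" for p
  proof -
    have "two_groupoid (deg G p)" using G by (simp add: cosimplicial_two_groupoid_def)
    then show ?thesis
    proof (intro normal_pseudofunctor.intro normal_pseudofunctor_axioms.intro)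
      fix u v w z assume g: "grid p n u v" "grid p n v w" "grid p n w z"
      have m: "mon p 3 (pick u v w z)" using mon3[OF g] by simp
      have e: "edge (W p 3 (pick u v w z)) (0, 1) = E p u v" "edge (W p 3 (pick u v w z)) (2, 3) = E p w z"
        using W_edge'[OF m, of 0 1] W_edge'[OF m, of 2 3] by simp_all
      have t: "tri (W p 3 (pick u v w z)) (0, 1, 2) = A p u v w" "tri (W p 3 (pick u v w z)) (0, 2, 3) = A p u w z"
        "tri (W p 3 (pick u v w z)) (1, 2, 3) = A p v w z" "tri (W p 3 (pick u v w z)) (0, 1, 3) = A p u v z"
        using W_tri'[OF m, of 0 1 2] W_tri'[OF m, of 0 2 3] W_tri'[OF m, of 1 2 3] W_tri'[OF m, of 0 1 3] by simp_all
      have "0 < (1::nat)" "1 < (2::nat)" "2 < (3::nat)" by simp_all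
      from nerve_simplicesD(4)[OF W_in[OF m order_refl] this order_refl]
      show "(id2 (deg G p) (E p w z) \<diamondop>\<^bsub>deg G p\<^esub> A p u v w) \<star>\<^bsub>deg G p\<^esub> A p u w z =
          (A p v w z \<diamondop>\<^bsub>deg G p\<^esub> id2 (deg G p) (E p u v)) \<star>\<^bsub>deg G p\<^esub> A p u v z"
        unfolding e t .
    next
      fix u v w assume g: "grid p n u v" "grid p n v w"
      have m: "mon p 2 (pick u v w w)" using mon3[OF g grid_refl[OF g(2), THEN conjunct2]] by simp 
      from nerve_simplicesD(3)[OF W_in[OF m], of 0 1 2] have "tri (W p 2 (pick u v w w)) (0, 1, 2) \<in>
          Hom2 (deg G p) (edge (W p 2 (pick u v w w)) (0, 2))
            (edge (W p 2 (pick u v w w)) (1, 2) \<odot>\<^bsub>deg G p\<^esub> edge (W p 2 (pick u v w w)) (0, 1))"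
        by simp
      then show "A p u v w \<in> Hom2 (deg G p) (E p u w) (E p v w \<odot>\<^bsub>deg G p\<^esub> E p u v)"
        using m by (simp add: W_edge' W_tri')
    next
      fix u v assume g: "grid p n u v"
      have m: "mon p 1 (pick u v v v)" using mon3[OF g, of v v] grid_refl[OF g] by simp
      from nerve_simplicesD(2)[OF W_in[OF m], of 0 1] have "edge (W p 1 (pick u v v v)) (0, 1) \<in>
          Hom1 (deg G p) (vert (W p 1 (pick u v v v)) 0) (vert (W p 1 (pick u v v v)) 1)"
        by simp
      then show "E p u v \<in> Hom1 (deg G p) (V p u) (V p v)"
        using m by (simp add: W_edge' W_vert)
      show "A p u u v = id2 (deg G p) (E p u v)" "A p u v v = id2 (deg G p) (E p u v)"
        using W_tri[OF m, of 0 0 1] W_tri[OF m, of 0 1 1] W_edge[OF m, of 0 1]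
        by (simp_all add: nerve_tri_def)
    next
      fix u assume g: "grid p n u u"
      have m: "mon p 0 (\<lambda>_. u)" using g by (simp add: mon_def)
      show "V p u \<in> Obj (deg G p)"
        using nerve_simplicesD(1)[OF W_in[OF m], of 0] by (simp add: V_def)
      show "E p u u = id1 (deg G p) (V p u)"
        using W_edge[OF m, of 0 0] by (simp add: nerve_edge_def V_def)
    qed (assumption | erule grid_refl | erule (1) grid_trans)+
  qed
  have fam: "pseudofunctor_family G n V E A"
    unfolding pseudofunctor_family_def
  proof (intro conjI allI ballI impI psf)
    fix p q \<theta> assume \<theta>: "\<theta> \<in> Delta_r p q"
    { fix u assume "grid p n u u"
      then have m: "mon p 0 (\<lambda>_. u)" by (simp add: mon_def)
      show "V q (push \<theta> u) = on_obj (act G p q \<theta>) (V p u)"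
        using W_push[OF m _ \<theta>] by (simp add: V_def nerve_data_map_def) }
    { fix u v assume g: "grid p n u v"
      have m: "mon p 1 (pick u v v v)" using mon3[OF g, of v v] grid_refl[OF g] by simp
      show "E q (push \<theta> u) (push \<theta> v) = on_mor (act G p q \<theta>) (E p u v)"
        using W_push[OF m _ \<theta>] by (simp add: E_def nerve_data_map_def pick_map pairs_def) }
    { fix u v w assume g: "grid p n u v" "grid p n v w"
      have m: "mon p 2 (pick u v w w)" using mon3[OF g grid_refl[OF g(2), THEN conjunct2]] by simp
      show "A q (push \<theta> u) (push \<theta> v) (push \<theta> w) = on_cell (act G p q \<theta>) (A p u v w)"
        using W_push[OF m _ \<theta>] by (simp add: A_def nerve_data_map_def pick_map triples_def) }
  qed
  have W_nsimplex: "W p l u = nsimplex l (V p) (E p) (A p) u" if u: "mon p l u" and l: "l \<le> 3" for p l u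
  proof (rule nerve_simplex.equality)
    note in' = W_in[OF u l, unfolded nerve_simplices_def mem_Collect_eq]
    show "vert (W p l u) = vert (nsimplex l (V p) (E p) (A p) u)"
      using in' W_vert[OF u l] by (auto simp: nsimplex_def PiE_def extensional_def fun_eq_iff)
    show "edge (W p l u) = edge (nsimplex l (V p) (E p) (A p) u)"
    proof
      fix ij show "edge (W p l u) ij = edge (nsimplex l (V p) (E p) (A p) u) ij"
        using in' W_edge'[OF u l] PiE_arb[of "edge (W p l u)" "pairs l" _ ij]
        by (cases "ij \<in> pairs l") (auto simp: nsimplex_def pairs_def)
    qed
    show "tri (W p l u) = tri (nsimplex l (V p) (E p) (A p) u)"
    proof
      fix ijk show "tri (W p l u) ijk = tri (nsimplex l (V p) (E p) (A p) u) ijk"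
        using in' W_tri'[OF u l] PiE_arb[of "tri (W p l u)" "triples l" _ ijk]
        by (cases "ijk \<in> triples l") (auto simp: nsimplex_def triples_def)
    qed
  qed simp
  have "T p k = tot_of n V E A p k" for p k
  proof
    fix st show "T p k st = tot_of n V E A p k st"
    proof (cases "st \<in> Delta k p \<times> Delta k n")
      case False
      then show ?thesis using PiE_arb[OF T_in[of p k]] by (auto simp: tot_of_def restrict_def)
    next
      case True
      then obtain \<sigma> \<tau> where st: "st = (\<sigma>, \<tau>)" "\<sigma> \<in> Delta k p" "\<tau> \<in> Delta k n" by auto
      note in' = T_in'[OF st(2,3), unfolded trunc_hom_def mem_Collect_eq]
      have "T p k (\<sigma>, \<tau>) = (\<lambda>l\<in>{..3}. \<lambda>\<rho>\<in>Delta l k. nsimplex l (V p) (E p) (A p) (\<lambda>i. (\<sigma> (\<rho> i), \<tau> (\<rho> i))))"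
      proof (intro ext)
        fix l \<rho>
        show "T p k (\<sigma>, \<tau>) l \<rho> = (\<lambda>l\<in>{..3}. \<lambda>\<rho>\<in>Delta l k. nsimplex l (V p) (E p) (A p) (\<lambda>i. (\<sigma> (\<rho> i), \<tau> (\<rho> i)))) l \<rho>"
        proof (cases "l \<le> 3")
          case False
          then show ?thesis using in' by (simp add: extensional_def restrict_def)
        next
          case l: True
          then have ext: "T p k (\<sigma>, \<tau>) l \<in> extensional (Delta l k)"
            using in' by (auto simp: std_simplex_def PiE_def)
          show ?thesis
          proof (cases "\<rho> \<in> Delta l k")
            case False
            then show ?thesis using ext l by (simp add: extensional_def)
          next
            case True
            then have "mon p l (\<lambda>i. (\<sigma> (\<rho> i), \<tau> (\<rho> i)))"
              using st by (simp add: mon_def grid_def chain_def Delta_le Delta_mono)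
            then show ?thesis using True l st by (simp add: T_W W_nsimplex)
          qed
        qed
      qed
      then show ?thesis using st by (simp add: tot_of_def)
    qed
  qed
  then have "T = tot_of n V E A" by (intro ext) simp
  with fam show ?thesis by blast
qed

section \<open>Iterated cofaces\<close>

definition face :: "nat \<Rightarrow> (nat \<Rightarrow> nat) \<Rightarrow> nat \<Rightarrow> nat" where
  "face l u = restrict u {..l}"

lemma face_Delta_r:
  assumes "\<And>i j. \<lbrakk>i < j; j \<le> l\<rbrakk> \<Longrightarrow> u i < u j" "\<And>i. i \<le> l \<Longrightarrow> u i \<le> p"
  shows "face l u \<in> Delta_r l p"
proof -
  have "u i \<le> u j" if "i \<le> j" "j \<le> l" for i j
    using assms(1)[of i j] that by (cases "i = j") auto
  moreover have "u i = u j \<longrightarrow> i = j" if "i \<le> l" "j \<le> l" for i j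
    using assms(1)[of i j] assms(1)[of j i] that by (cases i j rule: linorder_cases) auto
  ultimately show ?thesis using assms(2)
    by (auto simp: Delta_r_def Delta_def face_def mono_on_def inj_on_def)
qed

lemma skip_face: "skip l i = face l (\<lambda>k. if k < i then k else Suc k)"
  by (simp add: skip_def face_def)

lemma skip_Delta_r: "skip l i \<in> Delta_r l (Suc l)"
  unfolding skip_face by (rule face_Delta_r) auto

lemma ord_id_face: "ord_id l = face l (\<lambda>k. k)"
  by (simp add: ord_id_def face_def)

lemma face_cong: "(\<And>i. i \<le> l \<Longrightarrow> u i = u' i) \<Longrightarrow> face l u = face l u'"
  by (auto simp: face_def)

lemma compose_face: "compose {..l} \<theta> (face l u) = face l (\<lambda>i. \<theta> (u i))"
  by (auto simp: face_def compose_def)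

text \<open>The images in degree \<open>p\<close> of an object, 1-morphism or 2-morphism in degree 0, 1 or 2 under the injection onto the
  vertex \<open>i\<close>, the edge \<open>i < j\<close> or the triangle \<open>i < j < k\<close>. The first letter of the name stands for vertex, edge or
  triangle, the second for object, 1-morphism or 2-cell. In this form composites of cofaces need no
  cosimplicial identities: an injection merely acts on the indices.\<close>

definition vO :: "('o, 'm, 'c) cosimp_two_groupoid \<Rightarrow> nat \<Rightarrow> nat \<Rightarrow> 'o \<Rightarrow> 'o" where
  "vO G p i = on_obj (act G 0 p (face 0 (\<lambda>_. i)))"

definition vM :: "('o, 'm, 'c) cosimp_two_groupoid \<Rightarrow> nat \<Rightarrow> nat \<Rightarrow> 'm \<Rightarrow> 'm" where
  "vM G p i = on_mor (act G 0 p (face 0 (\<lambda>_. i)))"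

definition eM :: "('o, 'm, 'c) cosimp_two_groupoid \<Rightarrow> nat \<Rightarrow> nat \<Rightarrow> nat \<Rightarrow> 'm \<Rightarrow> 'm" where
  "eM G p i j = on_mor (act G 1 p (face 1 (pick i j j j)))"

definition eC :: "('o, 'm, 'c) cosimp_two_groupoid \<Rightarrow> nat \<Rightarrow> nat \<Rightarrow> nat \<Rightarrow> 'c \<Rightarrow> 'c" where
  "eC G p i j = on_cell (act G 1 p (face 1 (pick i j j j)))"

definition tC :: "('o, 'm, 'c) cosimp_two_groupoid \<Rightarrow> nat \<Rightarrow> nat \<Rightarrow> nat \<Rightarrow> nat \<Rightarrow> 'c \<Rightarrow> 'c" where
  "tC G p i j k = on_cell (act G 2 p (face 2 (pick i j k k)))"

lemma coface_eqs:
  "dO G 0 1 = vO G 1 0" "dO G 0 0 = vO G 1 1"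
  "dM G 0 1 = vM G 1 0" "dM G 0 0 = vM G 1 1"
  "dM G 1 0 = eM G 2 1 2" "dM G 1 1 = eM G 2 0 2" "dM G 1 2 = eM G 2 0 1"
  "dC G 1 0 = eC G 2 1 2" "dC G 1 1 = eC G 2 0 2" "dC G 1 2 = eC G 2 0 1"
  "dC G 2 0 = tC G 3 1 2 3" "dC G 2 1 = tC G 3 0 2 3" "dC G 2 2 = tC G 3 0 1 3" "dC G 2 3 = tC G 3 0 1 2"
proof -
  have 0: "skip 0 1 = face 0 (\<lambda>_. 0)" "skip 0 0 = face 0 (\<lambda>_. 1)"
    by (auto simp: skip_face intro!: face_cong)
  have 1: "skip 1 0 = face 1 (pick 1 2 2 2)" "skip 1 1 = face 1 (pick 0 2 2 2)"
    "skip 1 2 = face 1 (pick 0 1 1 1)"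
    by (auto simp: skip_face pick_def intro!: face_cong)
  have 2: "skip 2 0 = face 2 (pick 1 2 3 3)" "skip 2 1 = face 2 (pick 0 2 3 3)"
    "skip 2 2 = face 2 (pick 0 1 3 3)" "skip 2 3 = face 2 (pick 0 1 2 2)"
    by (auto simp: skip_face pick_def intro!: face_cong)
  have s: "Suc 0 = 1" "Suc 1 = 2" "Suc 2 = 3" by simp_all
  show "dO G 0 1 = vO G 1 0" "dO G 0 0 = vO G 1 1"
    "dM G 0 1 = vM G 1 0" "dM G 0 0 = vM G 1 1"
    unfolding dO_def dM_def vO_def vM_def 0 s by (rule refl)+
  show "dM G 1 0 = eM G 2 1 2" "dM G 1 1 = eM G 2 0 2" "dM G 1 2 = eM G 2 0 1"
    "dC G 1 0 = eC G 2 1 2" "dC G 1 1 = eC G 2 0 2" "dC G 1 2 = eC G 2 0 1"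
    unfolding dM_def dC_def eM_def eC_def 1 s by (rule refl)+
  show "dC G 2 0 = tC G 3 1 2 3" "dC G 2 1 = tC G 3 0 2 3" "dC G 2 2 = tC G 3 0 1 3" "dC G 2 3 = tC G 3 0 1 2"
    unfolding dC_def tC_def 2 s by (rule refl)+
qed

lemma face_vertex: "i \<le> p \<Longrightarrow> face 0 (\<lambda>_. i) \<in> Delta_r 0 p"
  and face_edge: "\<lbrakk>i < j; j \<le> p\<rbrakk> \<Longrightarrow> face 1 (pick i j j j) \<in> Delta_r 1 p"
  and face_triangle: "\<lbrakk>i < j; j < k; k \<le> p\<rbrakk> \<Longrightarrow> face 2 (pick i j k k) \<in> Delta_r 2 p"
  and face_tetrahedron: "\<lbrakk>i < j; j < k; k < l; l \<le> p\<rbrakk> \<Longrightarrow> face 3 (pick i j k l) \<in> Delta_r 3 p"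
  by (rule face_Delta_r; auto simp: pick_def)+

lemma face_apply [simp]: "i \<le> l \<Longrightarrow> face l u i = u i"
  by (simp add: face_def)

context strict_two_functor
begin

lemma on_obj_Obj [simp]: "x \<in> Obj G \<Longrightarrow> on_obj F x \<in> Obj H"
  by (rule on_obj_closed)

lemma on_mor_typing [simp]:
  assumes "f \<in> Mor G"
  shows "on_mor F f \<in> Mor H" "src H (on_mor F f) = on_obj F (src G f)"
    "tgt H (on_mor F f) = on_obj F (tgt G f)"
  using on_mor_closed[of f "src G f" "tgt G f"] assms by (auto simp: Hom1_def)

lemma on_cell_typing [simp]:
  assumes "a \<in> Cell G"
  shows "on_cell F a \<in> Cell H" "src2 H (on_cell F a) = on_mor F (src2 G a)"
    "tgt2 H (on_cell F a) = on_mor F (tgt2 G a)"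
  using on_cell_closed[of a "src2 G a" "tgt2 G a"] assms by (auto simp: Hom2_def)

lemma on_comp [simp]:
  "\<lbrakk>f \<in> Mor G; g \<in> Mor G; src G g = tgt G f\<rbrakk> \<Longrightarrow> on_mor F (g \<odot>\<^bsub>G\<^esub> f) = on_mor F g \<odot>\<^bsub>H\<^esub> on_mor F f"
  "\<lbrakk>a \<in> Cell G; b \<in> Cell G; src2 G b = tgt2 G a\<rbrakk>
    \<Longrightarrow> on_cell F (b \<star>\<^bsub>G\<^esub> a) = on_cell F b \<star>\<^bsub>H\<^esub> on_cell F a"
  "\<lbrakk>a \<in> Cell G; b \<in> Cell G; src G (src2 G b) = tgt G (src2 G a)\<rbrakk>
    \<Longrightarrow> on_cell F (b \<diamondop>\<^bsub>G\<^esub> a) = on_cell F b \<diamondop>\<^bsub>H\<^esub> on_cell F a"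
  using on_comp1[of f "src G f" "tgt G f" g "tgt G g"] on_vcomp[of a "src2 G a" "tgt2 G a" b "tgt2 G b"]
    on_hcomp[of "src2 G a" "src G (src2 G a)" "tgt G (src2 G a)" "src2 G b" "tgt G (src2 G b)"
      a "tgt2 G a" b "tgt2 G b"]
  by (auto simp: Hom1_def Hom2_def)

declare on_id1 [simp] on_id2 [simp]

lemma on_cocycle:
  assumes "g01 \<in> Hom1 G x0 x1" "g12 \<in> Hom1 G x1 x2" "g23 \<in> Hom1 G x2 x3"
    "g02 \<in> Hom1 G x0 x2" "g13 \<in> Hom1 G x1 x3" "g03 \<in> Hom1 G x0 x3"
    "a012 \<in> Hom2 G g02 (g12 \<odot>\<^bsub>G\<^esub> g01)" "a023 \<in> Hom2 G g03 (g23 \<odot>\<^bsub>G\<^esub> g02)"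
    "a123 \<in> Hom2 G g13 (g23 \<odot>\<^bsub>G\<^esub> g12)" "a013 \<in> Hom2 G g03 (g13 \<odot>\<^bsub>G\<^esub> g01)"
    and "(id2 G g23 \<diamondop>\<^bsub>G\<^esub> a012) \<star>\<^bsub>G\<^esub> a023 = (a123 \<diamondop>\<^bsub>G\<^esub> id2 G g01) \<star>\<^bsub>G\<^esub> a013"
  shows "(id2 H (on_mor F g23) \<diamondop>\<^bsub>H\<^esub> on_cell F a012) \<star>\<^bsub>H\<^esub> on_cell F a023 =
    (on_cell F a123 \<diamondop>\<^bsub>H\<^esub> id2 H (on_mor F g01)) \<star>\<^bsub>H\<^esub> on_cell F a013"
proof -
  note [simp] = assms(1-10)[unfolded Hom1_def Hom2_def mem_Collect_eq]
  from arg_cong[OF assms(11), of "on_cell F"] show ?thesis by simp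
qed

lemma on_prism:
  assumes "f0 \<in> Hom1 G x0 x0'" "f1 \<in> Hom1 G x1 x1'" "f2 \<in> Hom1 G x2 x2'"
    "g01 \<in> Hom1 G x0 x1" "g12 \<in> Hom1 G x1 x2" "g02 \<in> Hom1 G x0 x2"
    "g01' \<in> Hom1 G x0' x1'" "g12' \<in> Hom1 G x1' x2'" "g02' \<in> Hom1 G x0' x2'"
    "a \<in> Hom2 G g02 (g12 \<odot>\<^bsub>G\<^esub> g01)" "a' \<in> Hom2 G g02' (g12' \<odot>\<^bsub>G\<^esub> g01')"
    "c01 \<in> Hom2 G (f1 \<odot>\<^bsub>G\<^esub> g01) (g01' \<odot>\<^bsub>G\<^esub> f0)" "c12 \<in> Hom2 G (f2 \<odot>\<^bsub>G\<^esub> g12) (g12' \<odot>\<^bsub>G\<^esub> f1)"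
    "c02 \<in> Hom2 G (f2 \<odot>\<^bsub>G\<^esub> g02) (g02' \<odot>\<^bsub>G\<^esub> f0)"
    and "prism G f0 f2 g01 g12' a a' c01 c02 c12"
  shows "prism H (on_mor F f0) (on_mor F f2) (on_mor F g01) (on_mor F g12')
    (on_cell F a) (on_cell F a') (on_cell F c01) (on_cell F c02) (on_cell F c12)"
proof -
  note [simp] = assms(1-14)[unfolded Hom1_def Hom2_def mem_Collect_eq]
  from arg_cong[OF assms(15)[unfolded prism_def], of "on_cell F"]
  show ?thesis unfolding prism_def by simp
qed

end

context cosimplicial_two_groupoid
begin

lemma act_functor: "\<theta> \<in> Delta_r p q \<Longrightarrow> strict_two_functor (deg G p) (deg G q) (act G p q \<theta>)"
  by (rule act_two_functor[OF Delta_r_Delta])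

lemma act_face:
  assumes \<theta>: "\<theta> \<in> Delta_r p q" and u: "face l u \<in> Delta_r l p"
  shows "x \<in> Obj (deg G l) \<Longrightarrow> on_obj (act G p q \<theta>) (on_obj (act G l p (face l u)) x) =
      on_obj (act G l q (face l (\<lambda>i. \<theta> (u i)))) x"
    "f \<in> Mor (deg G l) \<Longrightarrow> on_mor (act G p q \<theta>) (on_mor (act G l p (face l u)) f) =
      on_mor (act G l q (face l (\<lambda>i. \<theta> (u i)))) f"
    "a \<in> Cell (deg G l) \<Longrightarrow> on_cell (act G p q \<theta>) (on_cell (act G l p (face l u)) a) =
      on_cell (act G l q (face l (\<lambda>i. \<theta> (u i)))) a"
  using act_comp[OF Delta_r_Delta[OF u] Delta_r_Delta[OF \<theta>]]
  by (auto simp: two_functor_eq_def two_functor_comp_def compose_face)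

lemma act_vO: "\<lbrakk>\<theta> \<in> Delta_r p q; x \<in> Obj (deg G 0); i \<le> p\<rbrakk>
    \<Longrightarrow> on_obj (act G p q \<theta>) (vO G p i x) = vO G q (\<theta> i) x"
  and act_vM: "\<lbrakk>\<theta> \<in> Delta_r p q; f \<in> Mor (deg G 0); i \<le> p\<rbrakk>
    \<Longrightarrow> on_mor (act G p q \<theta>) (vM G p i f) = vM G q (\<theta> i) f"
  and act_eM: "\<lbrakk>\<theta> \<in> Delta_r p q; g \<in> Mor (deg G 1); i < j; j \<le> p\<rbrakk>
    \<Longrightarrow> on_mor (act G p q \<theta>) (eM G p i j g) = eM G q (\<theta> i) (\<theta> j) g"
  and act_eC: "\<lbrakk>\<theta> \<in> Delta_r p q; c \<in> Cell (deg G 1); i < j; j \<le> p\<rbrakk>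
    \<Longrightarrow> on_cell (act G p q \<theta>) (eC G p i j c) = eC G q (\<theta> i) (\<theta> j) c"
  and act_tC: "\<lbrakk>\<theta> \<in> Delta_r p q; a \<in> Cell (deg G 2); i < j; j < k; k \<le> p\<rbrakk>
    \<Longrightarrow> on_cell (act G p q \<theta>) (tC G p i j k a) = tC G q (\<theta> i) (\<theta> j) (\<theta> k) a"
  unfolding vO_def vM_def eM_def eC_def tC_def
  by (simp_all only: act_face face_vertex face_edge face_triangle pick_map)

lemma act_ord_id:
  "x \<in> Obj (deg G n) \<Longrightarrow> on_obj (act G n n (ord_id n)) x = x"
  "f \<in> Mor (deg G n) \<Longrightarrow> on_mor (act G n n (ord_id n)) f = f"
  "a \<in> Cell (deg G n) \<Longrightarrow> on_cell (act G n n (ord_id n)) a = a"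
  using act_id[of n] by (auto simp: two_functor_eq_def two_functor_id_def)

lemma top_cofaces:
  "x \<in> Obj (deg G 0) \<Longrightarrow> vO G 0 0 x = x" "f \<in> Mor (deg G 0) \<Longrightarrow> vM G 0 0 f = f"
  "g \<in> Mor (deg G 1) \<Longrightarrow> eM G 1 0 1 g = g" "c \<in> Cell (deg G 1) \<Longrightarrow> eC G 1 0 1 c = c"
  "a \<in> Cell (deg G 2) \<Longrightarrow> tC G 2 0 1 2 a = a"
proof -
  have f: "face 0 (\<lambda>_. 0) = ord_id 0" "face 1 (pick 0 1 1 1) = ord_id 1" "face 2 (pick 0 1 2 2) = ord_id 2"
    unfolding ord_id_face by (rule face_cong; auto simp: pick_def)+
  show "x \<in> Obj (deg G 0) \<Longrightarrow> vO G 0 0 x = x" "f \<in> Mor (deg G 0) \<Longrightarrow> vM G 0 0 f = f"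
    "g \<in> Mor (deg G 1) \<Longrightarrow> eM G 1 0 1 g = g" "c \<in> Cell (deg G 1) \<Longrightarrow> eC G 1 0 1 c = c"
    "a \<in> Cell (deg G 2) \<Longrightarrow> tC G 2 0 1 2 a = a"
    unfolding vO_def vM_def eM_def eC_def tC_def f by (auto simp: act_ord_id)
qed

end

section \<open>Descent data and gauge transformations in every degree\<close>

context cosimplicial_two_groupoid
begin

lemma skip_Delta_r':
  "skip 0 i \<in> Delta_r 0 1" "skip 1 i \<in> Delta_r 1 2" "skip 2 i \<in> Delta_r 2 3"
  using skip_Delta_r[of 0 i] skip_Delta_r[of 1 i] skip_Delta_r[of 2 i] by (simp_all add: eval_nat_numeral)

text \<open>The definition with all cofaces, including the iterated ones, written as vertices, edges and triangles.\<close>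

lemma Desc_iff:
  "(x, g, a) \<in> Desc G \<longleftrightarrow>
     x \<in> Obj (deg G 0) \<and> g \<in> Hom1 (deg G 1) (vO G 1 0 x) (vO G 1 1 x) \<and>
     a \<in> Hom2 (deg G 2) (eM G 2 0 2 g) (eM G 2 1 2 g \<odot>\<^bsub>deg G 2\<^esub> eM G 2 0 1 g) \<and>
     (id2 (deg G 3) (eM G 3 2 3 g) \<diamondop>\<^bsub>deg G 3\<^esub> tC G 3 0 1 2 a) \<star>\<^bsub>deg G 3\<^esub> tC G 3 0 2 3 a =
     (tC G 3 1 2 3 a \<diamondop>\<^bsub>deg G 3\<^esub> id2 (deg G 3) (eM G 3 0 1 g)) \<star>\<^bsub>deg G 3\<^esub> tC G 3 0 1 3 a"
proof -
  have "dM G 2 1 (eM G 2 1 2 g) = eM G 3 2 3 g" "dM G 2 2 (eM G 2 0 1 g) = eM G 3 0 1 g"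
    if "g \<in> Hom1 (deg G 1) (vO G 1 0 x) (vO G 1 1 x)"
  proof -
    have s: "Suc 2 = 3" "skip 2 1 1 = 2" "skip 2 1 2 = 3" "skip 2 2 0 = 0" "skip 2 2 1 = 1"
      by (simp_all add: skip_def)
    have "g \<in> Mor (deg G 1)" using that by (simp add: Hom1_def)
    then show "dM G 2 1 (eM G 2 1 2 g) = eM G 3 2 3 g" "dM G 2 2 (eM G 2 0 1 g) = eM G 3 0 1 g"
      using act_eM[OF skip_Delta_r'(3), of g 1 2 1] act_eM[OF skip_Delta_r'(3), of g 0 1 2]
      unfolding dM_def s by simp_all
  qed
  then show ?thesis unfolding Desc_def mem_Collect_eq case_prod_conv coface_eqs by (intro conj_cong refl) auto
qed

lemma vO_in: "\<lbrakk>x \<in> Obj (deg G 0); i \<le> p\<rbrakk> \<Longrightarrow> vO G p i x \<in> Obj (deg G p)"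
  unfolding vO_def by (rule strict_two_functor.on_obj_closed[OF act_functor[OF face_vertex]])

lemma vM_in:
  assumes "f \<in> Hom1 (deg G 0) x x'" "i \<le> p"
  shows "vM G p i f \<in> Hom1 (deg G p) (vO G p i x) (vO G p i x')"
  unfolding vM_def vO_def
  using strict_two_functor.on_mor_closed[OF act_functor[OF face_vertex[OF assms(2)]] assms(1)] .

lemma eM_in:
  assumes g: "g \<in> Hom1 (deg G 1) (vO G 1 0 x) (vO G 1 1 x')" and "x \<in> Obj (deg G 0)" "x' \<in> Obj (deg G 0)"
    and ij: "i < j" "j \<le> p"
  shows "eM G p i j g \<in> Hom1 (deg G p) (vO G p i x) (vO G p j x')"
  using strict_two_functor.on_mor_closed[OF act_functor[OF face_edge[OF ij]] g]
    act_vO[OF face_edge[OF ij] assms(2), of 0] act_vO[OF face_edge[OF ij] assms(3), of 1]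
  by (simp add: eM_def)

context
  fixes x g a
  assumes d: "(x, g, a) \<in> Desc G"
begin

lemma desc_x: "x \<in> Obj (deg G 0)"
  and desc_g: "g \<in> Hom1 (deg G 1) (vO G 1 0 x) (vO G 1 1 x)"
  and desc_a: "a \<in> Hom2 (deg G 2) (eM G 2 0 2 g) (eM G 2 1 2 g \<odot>\<^bsub>deg G 2\<^esub> eM G 2 0 1 g)"
  using d by (simp_all add: Desc_iff)

lemma desc_g_Mor: "g \<in> Mor (deg G 1)"
  using desc_g by (simp add: Hom1_def)

lemma desc_a_Cell: "a \<in> Cell (deg G 2)"
  using desc_a by (simp add: Hom2_def)

lemma desc_eM_in:
  "\<lbrakk>i < j; j \<le> p\<rbrakk> \<Longrightarrow> eM G p i j g \<in> Hom1 (deg G p) (vO G p i x) (vO G p j x)"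
  by (rule eM_in[OF desc_g desc_x desc_x])

lemma desc_tC_in:
  assumes ijk: "i < j" "j < k" "k \<le> p"
  shows "tC G p i j k a \<in> Hom2 (deg G p) (eM G p i k g) (eM G p j k g \<odot>\<^bsub>deg G p\<^esub> eM G p i j g)"
proof -
  note \<theta> = face_triangle[OF ijk]
  interpret strict_two_functor "deg G 2" "deg G p" "act G 2 p (face 2 (pick i j k k))"
    by (rule act_functor[OF \<theta>])
  show ?thesis
    using on_cell_closed[OF desc_a] on_comp1[OF desc_eM_in[of 0 1 2] desc_eM_in[of 1 2 2]]
      act_eM[OF \<theta> desc_g_Mor, of 0 1] act_eM[OF \<theta> desc_g_Mor, of 0 2] act_eM[OF \<theta> desc_g_Mor, of 1 2]
    by (simp add: tC_def)
qed

text \<open>The image of the defining equation, which lives in degree 3, under the injection onto \<open>i < j < k < l\<close>.\<close>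

lemma desc_cocycle:
  assumes ijkl: "i < j" "j < k" "k < l" "l \<le> p"
  shows "(id2 (deg G p) (eM G p k l g) \<diamondop>\<^bsub>deg G p\<^esub> tC G p i j k a) \<star>\<^bsub>deg G p\<^esub> tC G p i k l a =
     (tC G p j k l a \<diamondop>\<^bsub>deg G p\<^esub> id2 (deg G p) (eM G p i j g)) \<star>\<^bsub>deg G p\<^esub> tC G p i j l a"
proof -
  note \<theta> = face_tetrahedron[OF ijkl]
  interpret strict_two_functor "deg G 3" "deg G p" "act G 3 p (face 3 (pick i j k l))"
    by (rule act_functor[OF \<theta>])
  have "(id2 (deg G 3) (eM G 3 2 3 g) \<diamondop>\<^bsub>deg G 3\<^esub> tC G 3 0 1 2 a) \<star>\<^bsub>deg G 3\<^esub> tC G 3 0 2 3 a =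
     (tC G 3 1 2 3 a \<diamondop>\<^bsub>deg G 3\<^esub> id2 (deg G 3) (eM G 3 0 1 g)) \<star>\<^bsub>deg G 3\<^esub> tC G 3 0 1 3 a"
    using d by (simp add: Desc_iff)
  from on_cocycle[OF desc_eM_in desc_eM_in desc_eM_in desc_eM_in desc_eM_in desc_eM_in
      desc_tC_in desc_tC_in desc_tC_in desc_tC_in this]
  show ?thesis
    using act_eM[OF \<theta> desc_g_Mor, of 0 1] act_eM[OF \<theta> desc_g_Mor, of 2 3]
      act_tC[OF \<theta> desc_a_Cell, of 0 1 2] act_tC[OF \<theta> desc_a_Cell, of 0 2 3]
      act_tC[OF \<theta> desc_a_Cell, of 1 2 3] act_tC[OF \<theta> desc_a_Cell, of 0 1 3]
    by simp
qed

end

lemma gauge_iff: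
  "(f, c) \<in> gauge G (x, g, a) (x', g', a') \<longleftrightarrow>
     f \<in> Hom1 (deg G 0) x x' \<and>
     c \<in> Hom2 (deg G 1) (vM G 1 1 f \<odot>\<^bsub>deg G 1\<^esub> g) (g' \<odot>\<^bsub>deg G 1\<^esub> vM G 1 0 f) \<and>
     prism (deg G 2) (vM G 2 0 f) (vM G 2 2 f) (eM G 2 0 1 g) (eM G 2 1 2 g') a a'
       (eC G 2 0 1 c) (eC G 2 0 2 c) (eC G 2 1 2 c)"
proof -
  have "dM G 1 2 (vM G 1 0 f) = vM G 2 0 f" "dM G 1 1 (vM G 1 1 f) = vM G 2 2 f"
    if "f \<in> Hom1 (deg G 0) x x'"
  proof -
    have s: "Suc 1 = 2" "skip 1 2 0 = 0" "skip 1 1 1 = 2" by (simp_all add: skip_def)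
    have "f \<in> Mor (deg G 0)" using that by (simp add: Hom1_def)
    then show "dM G 1 2 (vM G 1 0 f) = vM G 2 0 f" "dM G 1 1 (vM G 1 1 f) = vM G 2 2 f"
      using act_vM[OF skip_Delta_r'(2), of f 0 2] act_vM[OF skip_Delta_r'(2), of f 1 1]
      unfolding dM_def s by simp_all
  qed
  then show ?thesis
    unfolding gauge_def mem_Collect_eq case_prod_conv coface_eqs prism_def Let_def
    by (intro conj_cong refl) auto
qed

context
  fixes x g a x' g' a' f c
  assumes d: "(x, g, a) \<in> Desc G" and d': "(x', g', a') \<in> Desc G"
    and f: "f \<in> Hom1 (deg G 0) x x'"
    and c: "c \<in> Hom2 (deg G 1) (vM G 1 1 f \<odot>\<^bsub>deg G 1\<^esub> g) (g' \<odot>\<^bsub>deg G 1\<^esub> vM G 1 0 f)"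
begin

lemma gauge_eC_in:
  assumes ij: "i < j" "j \<le> p"
  shows "eC G p i j c \<in> Hom2 (deg G p) (vM G p j f \<odot>\<^bsub>deg G p\<^esub> eM G p i j g)
    (eM G p i j g' \<odot>\<^bsub>deg G p\<^esub> vM G p i f)"
proof -
  note \<theta> = face_edge[OF ij]
  interpret strict_two_functor "deg G 1" "deg G p" "act G 1 p (face 1 (pick i j j j))"
    by (rule act_functor[OF \<theta>])
  have fM: "f \<in> Mor (deg G 0)" using f by (simp add: Hom1_def)
  show ?thesis
    using on_cell_closed[OF c] on_comp1[OF desc_g[OF d] vM_in[OF f, of 1 1]]
      on_comp1[OF vM_in[OF f, of 0 1] desc_g[OF d']]
      act_vM[OF \<theta> fM, of 0] act_vM[OF \<theta> fM, of 1]
    by (simp add: eC_def eM_def)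
qed

text \<open>The image of the defining equation, which lives in degree 2, under the injection onto \<open>i < j < k\<close>.\<close>

lemma gauge_prism:
  assumes "prism (deg G 2) (vM G 2 0 f) (vM G 2 2 f) (eM G 2 0 1 g) (eM G 2 1 2 g') a a'
       (eC G 2 0 1 c) (eC G 2 0 2 c) (eC G 2 1 2 c)"
    and ijk: "i < j" "j < k" "k \<le> p"
  shows "prism (deg G p) (vM G p i f) (vM G p k f) (eM G p i j g) (eM G p j k g')
       (tC G p i j k a) (tC G p i j k a') (eC G p i j c) (eC G p i k c) (eC G p j k c)"
proof -
  note \<theta> = face_triangle[OF ijk]
  interpret strict_two_functor "deg G 2" "deg G p" "act G 2 p (face 2 (pick i j k k))"
    by (rule act_functor[OF \<theta>])
  have fM: "f \<in> Mor (deg G 0)" using f by (simp add: Hom1_def)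
  have cC: "c \<in> Cell (deg G 1)" using c by (simp add: Hom2_def)
  \<comment> \<open>\<open>le(1,5)\<close>, \<open>le(2,6)\<close> and \<open>le(3,6)\<close> are the bounds for the edges 01, 12 and 02 of \<open>[2]\<close>\<close>
  have le: "(0::nat) < 1" "(1::nat) < 2" "(0::nat) < 2" "(0::nat) \<le> 2" "(1::nat) \<le> 2" "(2::nat) \<le> 2" by simp_all
  note V = vM_in[OF f] and E = desc_eM_in[OF d] and E' = desc_eM_in[OF d'] and C = gauge_eC_in
  from on_prism[OF V[OF le(4)] V[OF le(5)] V[OF le(6)] E[OF le(1,5)] E[OF le(2,6)] E[OF le(3,6)]
      E'[OF le(1,5)] E'[OF le(2,6)] E'[OF le(3,6)] desc_a[OF d] desc_a[OF d']
      C[OF le(1,5)] C[OF le(2,6)] C[OF le(3,6)] assms(1)]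
  show ?thesis
    using act_eM[OF \<theta> desc_g_Mor[OF d], of 0 1] act_eM[OF \<theta> desc_g_Mor[OF d'], of 1 2]
      act_vM[OF \<theta> fM, of 0] act_vM[OF \<theta> fM, of 2]
      act_eC[OF \<theta> cC, of 0 1] act_eC[OF \<theta> cC, of 0 2] act_eC[OF \<theta> cC, of 1 2]
    by (simp add: tC_def)
qed

end

section \<open>Gauge equivalence is an equivalence relation\<close>

text \<open>The squares of the two gauge transformations are stacked: first \<open>c\<close> whiskered by the edge of \<open>f'\<close> over
  the vertex 1, then \<open>c'\<close> whiskered by the edge of \<open>f\<close> over the vertex 0. The three squares over \<open>[2]\<close> in degree 2 are of the same form, so that
  pasting of prisms applies.\<close>

lemma gauge_comp_iff:
  assumes d: "(x, g, a) \<in> Desc G" and d': "(x', g', a') \<in> Desc G" and d'': "(x'', g'', a'') \<in> Desc G"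
    and fc: "(f, c) \<in> gauge G (x, g, a) (x', g', a')"
    and f': "f' \<in> Hom1 (deg G 0) x' x''"
    and c': "c' \<in> Hom2 (deg G 1) (vM G 1 1 f' \<odot>\<^bsub>deg G 1\<^esub> g') (g'' \<odot>\<^bsub>deg G 1\<^esub> vM G 1 0 f')"
  shows "(f' \<odot>\<^bsub>deg G 0\<^esub> f, (c' \<diamondop>\<^bsub>deg G 1\<^esub> id2 (deg G 1) (vM G 1 0 f)) \<star>\<^bsub>deg G 1\<^esub>
      (id2 (deg G 1) (vM G 1 1 f') \<diamondop>\<^bsub>deg G 1\<^esub> c)) \<in> gauge G (x, g, a) (x'', g'', a'') \<longleftrightarrow>
    (f', c') \<in> gauge G (x', g', a') (x'', g'', a'')"
    (is "(?f, ?c) \<in> _ \<longleftrightarrow> _")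
proof -
  have f: "f \<in> Hom1 (deg G 0) x x'"
    and c: "c \<in> Hom2 (deg G 1) (vM G 1 1 f \<odot>\<^bsub>deg G 1\<^esub> g) (g' \<odot>\<^bsub>deg G 1\<^esub> vM G 1 0 f)"
    and P: "prism (deg G 2) (vM G 2 0 f) (vM G 2 2 f) (eM G 2 0 1 g) (eM G 2 1 2 g') a a'
       (eC G 2 0 1 c) (eC G 2 0 2 c) (eC G 2 1 2 c)"
    using fc by (simp_all add: gauge_iff)
  \<comment> \<open>\<open>le(1,5)\<close>, \<open>le(2,6)\<close> and \<open>le(3,6)\<close> are the bounds for the edges 01, 12 and 02 of \<open>[2]\<close>\<close>
  have le: "(0::nat) < 1" "(1::nat) < 2" "(0::nat) < 2" "(0::nat) \<le> 2" "(1::nat) \<le> 2" "(2::nat) \<le> 2" by simp_all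
  \<comment> \<open>the degree must stay the literal 1 for the typing rules in that degree to apply\<close>
  note One_nat_def [simp del]
  interpret G0: two_groupoid "deg G 0" by (rule deg_two_groupoid)
  interpret G1: two_groupoid "deg G 1" by (rule deg_two_groupoid)
  interpret G2: two_groupoid "deg G 2" by (rule deg_two_groupoid)
  note [simp] = f[unfolded Hom1_def mem_Collect_eq] f'[unfolded Hom1_def mem_Collect_eq]
    c[unfolded Hom2_def mem_Collect_eq] c'[unfolded Hom2_def mem_Collect_eq]
    desc_g[OF d, unfolded Hom1_def mem_Collect_eq] desc_g[OF d', unfolded Hom1_def mem_Collect_eq]
    desc_g[OF d'', unfolded Hom1_def mem_Collect_eq]
    vM_in[OF f, of _ 1, unfolded Hom1_def mem_Collect_eq] vM_in[OF f', of _ 1, unfolded Hom1_def mem_Collect_eq]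
  have comp: "vM G p i ?f = vM G p i f' \<odot>\<^bsub>deg G p\<^esub> vM G p i f" if "i \<le> p" for p i
    unfolding vM_def
    by (rule strict_two_functor.on_comp1[OF act_functor[OF face_vertex[OF that]] f f'])
  have "?c \<in> Hom2 (deg G 1) (vM G 1 1 ?f \<odot>\<^bsub>deg G 1\<^esub> g) (g'' \<odot>\<^bsub>deg G 1\<^esub> vM G 1 0 ?f)"
    by (simp add: comp Hom2_def)
  moreover have "?f \<in> Hom1 (deg G 0) x x''" by (simp add: Hom1_def)
  moreover have "eC G 2 i j ?c = (eC G 2 i j c' \<diamondop>\<^bsub>deg G 2\<^esub> id2 (deg G 2) (vM G 2 i f)) \<star>\<^bsub>deg G 2\<^esub>
      (id2 (deg G 2) (vM G 2 j f') \<diamondop>\<^bsub>deg G 2\<^esub> eC G 2 i j c)" if ij: "i < j" "j \<le> 2" for i j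
  proof -
    note \<theta> = face_edge[OF ij]
    interpret strict_two_functor "deg G 1" "deg G 2" "act G 1 2 (face 1 (pick i j j j))"
      by (rule act_functor[OF \<theta>])
    show ?thesis
      using act_vM[OF \<theta>, of f 0] act_vM[OF \<theta>, of f' 1] by (simp add: eC_def)
  qed
  moreover note G2.prism_paste[OF vM_in[OF f le(4)] vM_in[OF f le(5)] vM_in[OF f le(6)]
      vM_in[OF f' le(4)] vM_in[OF f' le(5)] vM_in[OF f' le(6)]
      desc_eM_in[OF d le(1,5)] desc_eM_in[OF d le(2,6)] desc_eM_in[OF d le(3,6)]
      desc_eM_in[OF d' le(1,5)] desc_eM_in[OF d' le(2,6)] desc_eM_in[OF d' le(3,6)]
      desc_eM_in[OF d'' le(1,5)] desc_eM_in[OF d'' le(2,6)] desc_eM_in[OF d'' le(3,6)]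
      desc_a[OF d] desc_a[OF d'] desc_a[OF d'']
      gauge_eC_in[OF d d' f c le(1,5)] gauge_eC_in[OF d d' f c le(2,6)] gauge_eC_in[OF d d' f c le(3,6)]
      gauge_eC_in[OF d' d'' f' c' le(1,5)] gauge_eC_in[OF d' d'' f' c' le(2,6)]
      gauge_eC_in[OF d' d'' f' c' le(3,6)] P]
  ultimately show ?thesis
    using f' c' comp[of _ 2] unfolding gauge_iff by simp
qed

lemma gauge_identity:
  assumes d: "(x, g, a) \<in> Desc G"
  shows "(id1 (deg G 0) x, id2 (deg G 1) g) \<in> gauge G (x, g, a) (x, g, a)"
proof -
  note One_nat_def [simp del]
  interpret G0: two_groupoid "deg G 0" by (rule deg_two_groupoid)
  interpret G1: two_groupoid "deg G 1" by (rule deg_two_groupoid)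
  interpret G2: two_groupoid "deg G 2" by (rule deg_two_groupoid)
  have x: "x \<in> Obj (deg G 0)" by (rule desc_x[OF d])
  have i: "vM G p i (id1 (deg G 0) x) = id1 (deg G p) (vO G p i x)" if "i \<le> p" for p i
    unfolding vM_def vO_def by (rule strict_two_functor.on_id1[OF act_functor[OF face_vertex[OF that]] x])
  have j: "eC G 2 i j (id2 (deg G 1) g) = id2 (deg G 2) (eM G 2 i j g)" if "i < j" "j \<le> 2" for i j
    unfolding eC_def eM_def
    by (rule strict_two_functor.on_id2[OF act_functor[OF face_edge[OF that]] desc_g_Mor[OF d]])
  note [simp] = desc_g[OF d, unfolded Hom1_def mem_Collect_eq] desc_a[OF d, unfolded Hom2_def mem_Collect_eq]
    desc_eM_in[OF d, of _ _ 2, unfolded Hom1_def mem_Collect_eq] vO_in[OF x]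
  show ?thesis
    unfolding gauge_iff prism_def using x by (simp add: i j Hom1_def Hom2_def)
qed

text \<open>Let \<open>h\<close> and \<open>b\<close> be inverse to \<open>f\<close> and \<open>c\<close>. The square of the inverse is \<open>b\<close> whiskered by \<open>h\<close> on both sides. Stacked on
  \<open>c\<close> it gives the identity, so the composite is the identity gauge transformation, and pasting
  shows that the second factor satisfies the prism equation.\<close>

lemma gauge_inverse:
  assumes d: "(x, g, a) \<in> Desc G" and d': "(x', g', a') \<in> Desc G"
    and fc: "(f, c) \<in> gauge G (x, g, a) (x', g', a')"
  shows "gauge G (x', g', a') (x, g, a) \<noteq> {}"
proof -
  note One_nat_def [simp del]
  interpret G0: two_groupoid "deg G 0" by (rule deg_two_groupoid)
  interpret G1: two_groupoid "deg G 1" by (rule deg_two_groupoid)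
  have f: "f \<in> Hom1 (deg G 0) x x'"
    and c: "c \<in> Hom2 (deg G 1) (vM G 1 1 f \<odot>\<^bsub>deg G 1\<^esub> g) (g' \<odot>\<^bsub>deg G 1\<^esub> vM G 1 0 f)"
    using fc by (simp_all add: gauge_iff)
  obtain h where h: "h \<in> Hom1 (deg G 0) x' x" "h \<odot>\<^bsub>deg G 0\<^esub> f = id1 (deg G 0) x"
      "f \<odot>\<^bsub>deg G 0\<^esub> h = id1 (deg G 0) x'"
    using G0.inverse1[OF f] by blast
  obtain b where b: "b \<in> Hom2 (deg G 1) (g' \<odot>\<^bsub>deg G 1\<^esub> vM G 1 0 f) (vM G 1 1 f \<odot>\<^bsub>deg G 1\<^esub> g)"
      "b \<star>\<^bsub>deg G 1\<^esub> c = id2 (deg G 1) (vM G 1 1 f \<odot>\<^bsub>deg G 1\<^esub> g)"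
    using G1.inverse2[OF c] by blast
  have inv: "vM G 1 i h \<odot>\<^bsub>deg G 1\<^esub> vM G 1 i f = id1 (deg G 1) (vO G 1 i x)"
      "vM G 1 i f \<odot>\<^bsub>deg G 1\<^esub> vM G 1 i h = id1 (deg G 1) (vO G 1 i x')" if "i \<le> 1" for i
  proof -
    interpret strict_two_functor "deg G 0" "deg G 1" "act G 0 1 (face 0 (\<lambda>_. i))"
      by (rule act_functor[OF face_vertex[OF that]])
    show "vM G 1 i h \<odot>\<^bsub>deg G 1\<^esub> vM G 1 i f = id1 (deg G 1) (vO G 1 i x)"
      "vM G 1 i f \<odot>\<^bsub>deg G 1\<^esub> vM G 1 i h = id1 (deg G 1) (vO G 1 i x')"
      unfolding vM_def vO_def
      using on_comp1[OF f h(1)] on_comp1[OF h(1) f] h(2,3) desc_x[OF d] desc_x[OF d']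
      by (simp_all add: on_id1)
  qed
  note [simp] = h(1)[unfolded Hom1_def mem_Collect_eq] f[unfolded Hom1_def mem_Collect_eq]
    c[unfolded Hom2_def mem_Collect_eq] b(1)[unfolded Hom2_def mem_Collect_eq]
    desc_g[OF d, unfolded Hom1_def mem_Collect_eq] desc_g[OF d', unfolded Hom1_def mem_Collect_eq]
    vM_in[OF f, of _ 1, unfolded Hom1_def mem_Collect_eq] vM_in[OF h(1), of _ 1, unfolded Hom1_def mem_Collect_eq]
  have inv': "vM G 1 1 h \<odot>\<^bsub>deg G 1\<^esub> vM G 1 1 f \<odot>\<^bsub>deg G 1\<^esub> k = k"
    if "k \<in> Mor (deg G 1)" "tgt (deg G 1) k = vO G 1 1 x" for k
    using G1.comp1_laws(1)[of k "vM G 1 1 f" "vM G 1 1 h"] inv(1)[of 1] that by simp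
  let ?b = "id2 (deg G 1) (vM G 1 1 h) \<diamondop>\<^bsub>deg G 1\<^esub> (b \<diamondop>\<^bsub>deg G 1\<^esub> id2 (deg G 1) (vM G 1 0 h))"
  have b': "?b \<in> Hom2 (deg G 1) (vM G 1 1 h \<odot>\<^bsub>deg G 1\<^esub> g') (g \<odot>\<^bsub>deg G 1\<^esub> vM G 1 0 h)"
    by (simp add: Hom2_def inv inv')
  have "(?b \<diamondop>\<^bsub>deg G 1\<^esub> id2 (deg G 1) (vM G 1 0 f)) \<star>\<^bsub>deg G 1\<^esub> (id2 (deg G 1) (vM G 1 1 h) \<diamondop>\<^bsub>deg G 1\<^esub> c)
    = (id2 (deg G 1) (vM G 1 1 h) \<diamondop>\<^bsub>deg G 1\<^esub> b) \<star>\<^bsub>deg G 1\<^esub> (id2 (deg G 1) (vM G 1 1 h) \<diamondop>\<^bsub>deg G 1\<^esub> c)"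
    by (simp add: inv)
  also have "\<dots> = id2 (deg G 1) (vM G 1 1 h) \<diamondop>\<^bsub>deg G 1\<^esub> (b \<star>\<^bsub>deg G 1\<^esub> c)" by simp
  also have "\<dots> = id2 (deg G 1) g" unfolding b(2) by (simp add: inv')
  finally have "(h, ?b) \<in> gauge G (x', g', a') (x, g, a)"
    using gauge_comp_iff[OF d d' d fc h(1) b'] gauge_identity[OF d] h(2) by simp
  then show ?thesis by blast
qed

lemma equiv_gauge_rel: "equiv (Desc G) (gauge_rel G)"
proof (rule equivI)
  show "gauge_rel G \<subseteq> Desc G \<times> Desc G" by (auto simp: gauge_rel_def)
  show "refl_on (Desc G) (gauge_rel G)"
    using gauge_identity by (fastforce simp: refl_on_def gauge_rel_def)
  show "sym (gauge_rel G)"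
    using gauge_inverse by (fastforce simp: sym_def gauge_rel_def)
  show "trans (gauge_rel G)"
  proof (rule transI)
    fix d d' d'' assume r: "(d, d') \<in> gauge_rel G" "(d', d'') \<in> gauge_rel G"
    obtain x g a x' g' a' x'' g'' a'' where [simp]: "d = (x, g, a)" "d' = (x', g', a')" "d'' = (x'', g'', a'')"
      by (metis prod_cases3)
    from r obtain f c f' c' where fc: "(f, c) \<in> gauge G d d'" "(f', c') \<in> gauge G d' d''"
      and D: "d \<in> Desc G" "d' \<in> Desc G" "d'' \<in> Desc G"
      unfolding gauge_rel_def by auto
    have "f' \<in> Hom1 (deg G 0) x' x''"
      "c' \<in> Hom2 (deg G 1) (vM G 1 1 f' \<odot>\<^bsub>deg G 1\<^esub> g') (g'' \<odot>\<^bsub>deg G 1\<^esub> vM G 1 0 f')"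
      using fc(2) by (simp_all add: gauge_iff)
    from gauge_comp_iff[OF _ _ _ _ this, of x g a a' a'' f c] fc D have "gauge G d d'' \<noteq> {}" by auto
    then show "(d, d'') \<in> gauge_rel G" using D by (simp add: gauge_rel_def)
  qed
qed

end

section \<open>Descent data as vertices of the totalization\<close>

text \<open>The pseudofunctors \<open>[p] \<rightarrow> G\<^sup>p\<close> of a descent datum. The second cases below are meant for the degenerate chains
  \<open>i = j\<close> and \<open>i = j \<or> j = k\<close>.\<close>

definition desc_vert :: "('o, 'm, 'c) cosimp_two_groupoid \<Rightarrow> 'o \<times> 'm \<times> 'c \<Rightarrow> nat \<Rightarrow> nat \<Rightarrow> 'o" where
  "desc_vert G d p i = vO G p i (fst d)"

definition desc_edge :: "('o, 'm, 'c) cosimp_two_groupoid \<Rightarrow> 'o \<times> 'm \<times> 'c \<Rightarrow> nat \<Rightarrow> nat \<Rightarrow> nat \<Rightarrow> 'm" where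
  "desc_edge G d p i j =
    (if i < j then eM G p i j (fst (snd d)) else id1 (deg G p) (desc_vert G d p i))"

definition desc_tri ::
  "('o, 'm, 'c) cosimp_two_groupoid \<Rightarrow> 'o \<times> 'm \<times> 'c \<Rightarrow> nat \<Rightarrow> nat \<Rightarrow> nat \<Rightarrow> nat \<Rightarrow> 'c" where
  "desc_tri G d p i j k =
    (if i < j \<and> j < k then tC G p i j k (snd (snd d)) else id2 (deg G p) (desc_edge G d p i k))"

definition desc_tot :: "('o, 'm, 'c) cosimp_two_groupoid \<Rightarrow> 'o \<times> 'm \<times> 'c
    \<Rightarrow> ('o, 'm, 'c) cosk_simplex tot_simplex" where
  "desc_tot G d = tot_of 0 (\<lambda>p u. desc_vert G d p (fst u)) (\<lambda>p u v. desc_edge G d p (fst u) (fst v))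
     (\<lambda>p u v w. desc_tri G d p (fst u) (fst v) (fst w))"

abbreviation Tot :: "('o, 'm, 'c) cosimp_two_groupoid \<Rightarrow> ('o, 'm, 'c) cosk_simplex tot_simplex sset" where
  "Tot G \<equiv> Tot_r (restr (nerve_cosimp G))"

lemma pseudofunctor_familyD:
  assumes "pseudofunctor_family G n V E A"
  shows "normal_pseudofunctor (deg G p) (grid p n) (V p) (E p) (A p)"
    "\<lbrakk>\<theta> \<in> Delta_r p q; grid p n u u\<rbrakk> \<Longrightarrow> V q (push \<theta> u) = on_obj (act G p q \<theta>) (V p u)"
    "\<lbrakk>\<theta> \<in> Delta_r p q; grid p n u v\<rbrakk>
      \<Longrightarrow> E q (push \<theta> u) (push \<theta> v) = on_mor (act G p q \<theta>) (E p u v)"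
    "\<lbrakk>\<theta> \<in> Delta_r p q; grid p n u v; grid p n v w\<rbrakk>
      \<Longrightarrow> A q (push \<theta> u) (push \<theta> v) (push \<theta> w) = on_cell (act G p q \<theta>) (A p u v w)"
  using assms unfolding pseudofunctor_family_def by blast+

text \<open>Evaluate at the 2-simplex \<open>u \<le> v \<le> w\<close>.\<close>

lemma tot_of_inject:
  assumes eq: "tot_of n V E A = tot_of n V' E' A'" and g: "grid p n u v" "grid p n v w"
  shows "V p u = V' p u" "E p u v = E' p u v" "A p u v w = A' p u v w"
proof -
  have st: "path 2 (pick u v w w) \<in> Delta 2 p \<times> Delta 2 n"
    using g by (auto simp: path_def pick_def Delta_def mono_on_def grid_def chain_def)
  have p: "(fst (path 2 (pick u v w w)) i, snd (path 2 (pick u v w w)) i) = pick u v w w i" if "i \<le> 2" for i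
    using that by (simp add: path_def)
  have *: "tot_of n V E A p 2 (path 2 (pick u v w w)) 2 (ord_id 2) = nsimplex 2 (V p) (E p) (A p) (pick u v w w)"
    for V :: "nat \<Rightarrow> nat \<times> nat \<Rightarrow> 'o" and E :: "nat \<Rightarrow> nat \<times> nat \<Rightarrow> nat \<times> nat \<Rightarrow> 'm"
      and A :: "nat \<Rightarrow> nat \<times> nat \<Rightarrow> nat \<times> nat \<Rightarrow> nat \<times> nat \<Rightarrow> 'c"
    using st p
    by (auto simp: tot_of_def case_prod_beta ord_id_Delta[of 2, unfolded ord_id_def] ord_id_def intro!: nsimplex_cong)
  have e: "nsimplex 2 (V p) (E p) (A p) (pick u v w w) = nsimplex 2 (V' p) (E' p) (A' p) (pick u v w w)"
    using eq *[of V E A] *[of V' E' A'] by simp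
  show "V p u = V' p u"
    using arg_cong[OF e, of "\<lambda>s. vert s 0"] by (simp add: nsimplex_def)
  show "E p u v = E' p u v"
    using arg_cong[OF e, of "\<lambda>s. edge s (0, 1)"] by (simp add: nsimplex_def pairs_def)
  show "A p u v w = A' p u v w"
    using arg_cong[OF e, of "\<lambda>s. tri s (0, 1, 2)"] by (simp add: nsimplex_def triples_def)
qed

lemma push_simps [simp]: "fst (push \<theta> u) = \<theta> (fst u)" "snd (push \<theta> u) = snd u" "push \<theta> (i, t) = (\<theta> i, t)"
  by (simp_all add: push_def)

context cosimplicial_two_groupoid
begin

lemma desc_pseudofunctor:
  assumes "d \<in> Desc G"
  shows "normal_pseudofunctor (deg G p) (chain p) (desc_vert G d p) (desc_edge G d p) (desc_tri G d p)"
proof -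
  obtain x g a where d: "d = (x, g, a)" "(x, g, a) \<in> Desc G" using assms by (cases d) auto
  show ?thesis
    by (rule two_groupoid.normal_pseudofunctor_of_strict_chains[OF deg_two_groupoid])
      (simp_all add: desc_vert_def desc_edge_def desc_tri_def d vO_in desc_x[OF d(2)] desc_eM_in[OF d(2)]
        desc_tC_in[OF d(2)] desc_cocycle[OF d(2)])
qed

text \<open>An injection sends strict chains to strict chains and degenerate ones to degenerate ones; the former are covered by
  functoriality, the latter because 2-functors preserve identities.\<close>

lemma desc_natural:
  assumes "d \<in> Desc G" and \<theta>: "\<theta> \<in> Delta_r p q"
  shows "i \<le> p \<Longrightarrow> desc_vert G d q (\<theta> i) = on_obj (act G p q \<theta>) (desc_vert G d p i)"
    "\<lbrakk>i \<le> j; j \<le> p\<rbrakk> \<Longrightarrow> desc_edge G d q (\<theta> i) (\<theta> j) = on_mor (act G p q \<theta>) (desc_edge G d p i j)"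
    "\<lbrakk>i \<le> j; j \<le> k; k \<le> p\<rbrakk> \<Longrightarrow>
      desc_tri G d q (\<theta> i) (\<theta> j) (\<theta> k) = on_cell (act G p q \<theta>) (desc_tri G d p i j k)"
proof -
  obtain x g a where d: "d = (x, g, a)" "(x, g, a) \<in> Desc G" using assms by (cases d) auto
  interpret D: normal_pseudofunctor "deg G p" "chain p" "desc_vert G d p" "desc_edge G d p" "desc_tri G d p"
    by (rule desc_pseudofunctor[OF assms(1)])
  interpret F: strict_two_functor "deg G p" "deg G q" "act G p q \<theta>" by (rule act_functor[OF \<theta>])
  have V: "desc_vert G d q (\<theta> i) = on_obj (act G p q \<theta>) (desc_vert G d p i)" if "i \<le> p" for i
    using act_vO[OF \<theta> desc_x[OF d(2)] that] by (simp add: desc_vert_def d)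
  have E: "desc_edge G d q (\<theta> i) (\<theta> j) = on_mor (act G p q \<theta>) (desc_edge G d p i j)"
    if "i \<le> j" "j \<le> p" for i j
  proof (cases "i < j")
    case True
    then show ?thesis
      using Delta_r_strict[OF \<theta> True that(2)] act_eM[OF \<theta> desc_g_Mor[OF d(2)] True that(2)]
      by (simp add: desc_edge_def d)
  next
    case False
    then have "i = j" using that by simp
    then show ?thesis using V[OF that(2)] D.V_in[of j] that by (simp add: desc_edge_def chain_def)
  qed
  have A: "desc_tri G d q (\<theta> i) (\<theta> j) (\<theta> k) = on_cell (act G p q \<theta>) (desc_tri G d p i j k)"
    if "i \<le> j" "j \<le> k" "k \<le> p" for i j k
  proof (cases "i < j \<and> j < k")
    case True
    then show ?thesis
      using Delta_r_strict[OF \<theta>, of i j] Delta_r_strict[OF \<theta>, of j k] that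
        act_tC[OF \<theta> desc_a_Cell[OF d(2)], of i j k]
      by (simp add: desc_tri_def d)
  next
    case False
    then have n: "\<not> (\<theta> i < \<theta> j \<and> \<theta> j < \<theta> k)" using that by auto
    show ?thesis unfolding desc_tri_def if_not_P[OF n] if_not_P[OF False]
      using E[of i k] that D.E_typing(1)[of i k] by (simp add: chain_def)
  qed
  show "i \<le> p \<Longrightarrow> desc_vert G d q (\<theta> i) = on_obj (act G p q \<theta>) (desc_vert G d p i)"
    "\<lbrakk>i \<le> j; j \<le> p\<rbrakk> \<Longrightarrow> desc_edge G d q (\<theta> i) (\<theta> j) = on_mor (act G p q \<theta>) (desc_edge G d p i j)"
    "\<lbrakk>i \<le> j; j \<le> k; k \<le> p\<rbrakk> \<Longrightarrow>
      desc_tri G d q (\<theta> i) (\<theta> j) (\<theta> k) = on_cell (act G p q \<theta>) (desc_tri G d p i j k)"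
    by (fact V E A)+
qed

lemma desc_tot_in_Tot:
  assumes "d \<in> Desc G"
  shows "desc_tot G d \<in> simp (Tot G) 0"
  unfolding desc_tot_def
proof (rule tot_of_in_Tot)
  have "normal_pseudofunctor (deg G p) (grid p 0) (\<lambda>u. desc_vert G d p (fst u))
     (\<lambda>u v. desc_edge G d p (fst u) (fst v)) (\<lambda>u v w. desc_tri G d p (fst u) (fst v) (fst w))" for p
    by (rule normal_pseudofunctor.reindex[OF desc_pseudofunctor[OF assms]])
      (auto simp: grid_def chain_def)
  then show "pseudofunctor_family G 0 (\<lambda>p u. desc_vert G d p (fst u))
     (\<lambda>p u v. desc_edge G d p (fst u) (fst v)) (\<lambda>p u v w. desc_tri G d p (fst u) (fst v) (fst w))"
    unfolding pseudofunctor_family_def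
    by (auto simp: desc_natural[OF assms] grid_def chain_def)
qed

text \<open>A descent datum is recovered from its values on the top chains of \<open>[0]\<close>, \<open>[1]\<close> and \<open>[2]\<close>, because identities
  of ordinals act trivially.\<close>

lemma desc_top:
  assumes "d \<in> Desc G"
  shows "(desc_vert G d 0 0, desc_edge G d 1 0 1, desc_tri G d 2 0 1 2) = d"
proof -
  obtain x g a where d: "d = (x, g, a)" "(x, g, a) \<in> Desc G" using assms by (cases d) auto
  show ?thesis
    using top_cofaces(1)[OF desc_x[OF d(2)]] top_cofaces(3)[OF desc_g_Mor[OF d(2)]]
      top_cofaces(5)[OF desc_a_Cell[OF d(2)]]
    by (simp add: desc_vert_def desc_edge_def desc_tri_def d)
qed

text \<open>Each row \<open>[p] \<times> {t}\<close> of a family is the family of a descent datum, which is read off in degrees 0, 1 and 2.\<close>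

lemma family_row:
  assumes fam: "pseudofunctor_family G n V E A" and t: "t \<le> n"
    and d: "d = (V 0 (0, t), E 1 (0, t) (1, t), A 2 (0, t) (1, t) (2, t))"
  shows "d \<in> Desc G"
    "i \<le> p \<Longrightarrow> V p (i, t) = desc_vert G d p i"
    "\<lbrakk>i \<le> j; j \<le> p\<rbrakk> \<Longrightarrow> E p (i, t) (j, t) = desc_edge G d p i j"
    "\<lbrakk>i \<le> j; j \<le> k; k \<le> p\<rbrakk> \<Longrightarrow> A p (i, t) (j, t) (k, t) = desc_tri G d p i j k"
proof -
  note psf = pseudofunctor_familyD(1)[OF fam] and nat = pseudofunctor_familyD(2-4)[OF fam]
  have gr [simp]: "grid p n (i, t) (j, t) \<longleftrightarrow> i \<le> j \<and> j \<le> p" for p i j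
    using t by (auto simp: grid_def chain_def)
  have V: "V p (i, t) = desc_vert G d p i" if "i \<le> p" for p i
    using nat(1)[OF face_vertex[OF that], of "(0, t)"] by (simp add: desc_vert_def vO_def d)
  have E: "E p (i, t) (j, t) = eM G p i j (fst (snd d))" if "i < j" "j \<le> p" for p i j
    using nat(2)[OF face_edge[OF that], of "(0, t)" "(1, t)"] by (simp add: eM_def d)
  have A: "A p (i, t) (j, t) (k, t) = tC G p i j k (snd (snd d))" if "i < j" "j < k" "k \<le> p" for p i j k
    using nat(3)[OF face_triangle[OF that], of "(0, t)" "(1, t)" "(2, t)"] by (simp add: tC_def d)
  have E': "E p (i, t) (j, t) = desc_edge G d p i j" if "i \<le> j" "j \<le> p" for p i j
  proof (cases "i < j")
    case True
    then show ?thesis using E[of i j p] that by (simp add: desc_edge_def)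
  next
    case False
    then have "i = j" using that by simp
    then show ?thesis using normal_pseudofunctor.E_id[OF psf, of p "(j, t)"] that V[of j p]
      by (simp add: desc_edge_def)
  qed
  have A': "A p (i, t) (j, t) (k, t) = desc_tri G d p i j k" if "i \<le> j" "j \<le> k" "k \<le> p" for p i j k
  proof (cases "i < j \<and> j < k")
    case True
    then show ?thesis using A[of i j k p] that by (simp add: desc_tri_def)
  next
    case False
    then have "i = j \<or> j = k" using that by auto
    then show ?thesis
      using normal_pseudofunctor.A_id_left[OF psf, of p "(i, t)" "(k, t)"]
        normal_pseudofunctor.A_id_right[OF psf, of p "(i, t)" "(k, t)"] that E'[of i k p]
      by (auto simp add: desc_tri_def)
  qed
  have "(fst d, fst (snd d), snd (snd d)) \<in> Desc G"
    unfolding Desc_iff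
  proof (intro conjI)
    show "fst d \<in> Obj (deg G 0)"
      using normal_pseudofunctor.V_in[OF psf, of 0 "(0, t)"] by (simp add: d)
    show "fst (snd d) \<in> Hom1 (deg G 1) (vO G 1 0 (fst d)) (vO G 1 1 (fst d))"
      using normal_pseudofunctor.E_in[OF psf, of 1 "(0, t)" "(1, t)"] V[of 0 1] V[of 1 1]
      by (simp add: d desc_vert_def)
    show "snd (snd d) \<in> Hom2 (deg G 2) (eM G 2 0 2 (fst (snd d)))
        (eM G 2 1 2 (fst (snd d)) \<odot>\<^bsub>deg G 2\<^esub> eM G 2 0 1 (fst (snd d)))"
      using normal_pseudofunctor.A_in[OF psf, of 2 "(0, t)" "(1, t)" "(2, t)"]
        E[of 0 2 2] E[of 0 1 2] E[of 1 2 2]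
      by (simp add: d)
    show "(id2 (deg G 3) (eM G 3 2 3 (fst (snd d))) \<diamondop>\<^bsub>deg G 3\<^esub> tC G 3 0 1 2 (snd (snd d)))
        \<star>\<^bsub>deg G 3\<^esub> tC G 3 0 2 3 (snd (snd d)) =
      (tC G 3 1 2 3 (snd (snd d)) \<diamondop>\<^bsub>deg G 3\<^esub> id2 (deg G 3) (eM G 3 0 1 (fst (snd d))))
        \<star>\<^bsub>deg G 3\<^esub> tC G 3 0 1 3 (snd (snd d))"
      using normal_pseudofunctor.cocycle[OF psf, of 3 "(0, t)" "(1, t)" "(2, t)" "(3, t)"]
        E[of 2 3 3] E[of 0 1 3] A[of 0 1 2 3] A[of 0 2 3 3] A[of 1 2 3 3] A[of 0 1 3 3]
      by simp
  qed
  then show "d \<in> Desc G" by simp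
  show "i \<le> p \<Longrightarrow> V p (i, t) = desc_vert G d p i"
    "\<lbrakk>i \<le> j; j \<le> p\<rbrakk> \<Longrightarrow> E p (i, t) (j, t) = desc_edge G d p i j"
    "\<lbrakk>i \<le> j; j \<le> k; k \<le> p\<rbrakk> \<Longrightarrow> A p (i, t) (j, t) (k, t) = desc_tri G d p i j k"
    by (fact V E' A')+
qed

lemma bij_betw_desc_tot: "bij_betw (desc_tot G) (Desc G) (simp (Tot G) 0)"
proof (rule bij_betw_imageI)
  show "inj_on (desc_tot G) (Desc G)"
  proof (rule inj_onI)
    fix d d' assume D: "d \<in> Desc G" "d' \<in> Desc G" and eq: "desc_tot G d = desc_tot G d'"
    note inj = tot_of_inject[OF eq[unfolded desc_tot_def]]
    have "desc_vert G d 0 0 = desc_vert G d' 0 0"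
      using inj(1)[of 0 "(0, 0)" "(0, 0)" "(0, 0)"] by (simp add: grid_0)
    moreover have "desc_edge G d 1 0 1 = desc_edge G d' 1 0 1"
      using inj(2)[of 1 "(0, 0)" "(1, 0)" "(1, 0)"] by (simp add: grid_0)
    moreover have "desc_tri G d 2 0 1 2 = desc_tri G d' 2 0 1 2"
      using inj(3)[of 2 "(0, 0)" "(1, 0)" "(2, 0)"] by (simp add: grid_0)
    ultimately show "d = d'" using desc_top[OF D(1)] desc_top[OF D(2)] by metis
  qed
  show "desc_tot G ` Desc G = simp (Tot G) 0"
  proof (intro equalityI subsetI)
    fix T assume "T \<in> simp (Tot G) 0"
    then obtain V E A where fam: "pseudofunctor_family G 0 V E A" and T: "T = tot_of 0 V E A"
      using Tot_simplex_is_tot_of[OF cosimplicial_two_groupoid_axioms] by blast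
    define d where d: "d = (V 0 (0, 0), E 1 (0, 0) (1, 0), A 2 (0, 0) (1, 0) (2, 0))"
    note row = family_row[OF fam order_refl d]
    have "T = desc_tot G d" unfolding T desc_tot_def
      by (rule tot_of_cong) (auto simp: grid_0 row)
    then show "T \<in> desc_tot G ` Desc G" using row(1) by blast
  qed (use desc_tot_in_Tot in auto)
qed

end

section \<open>Edges of the totalization are gauge transformations\<close>

context cosimplicial_two_groupoid
begin

text \<open>The vertices \<open>d\<^sub>1\<close> and \<open>d\<^sub>0\<close> of an edge of the totalization are its rows \<open>t = 0\<close> and \<open>t = 1\<close>.\<close>

lemma tot_of_rows:
  assumes fam: "pseudofunctor_family G 1 V E A"
    and d: "d = (V 0 (0, 0), E 1 (0, 0) (1, 0), A 2 (0, 0) (1, 0) (2, 0))"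
    and d': "d' = (V 0 (0, 1), E 1 (0, 1) (1, 1), A 2 (0, 1) (1, 1) (2, 1))"
  shows "d \<in> Desc G" "d' \<in> Desc G"
    "sact (Tot G) 0 1 (skip 0 1) (tot_of 1 V E A) = desc_tot G d"
    "sact (Tot G) 0 1 (skip 0 0) (tot_of 1 V E A) = desc_tot G d'"
proof -
  note row = family_row[OF fam _ d] and row' = family_row[OF fam _ d']
  note skip = skip_Delta_r'(1)[THEN Delta_r_Delta]
  have s: "skip 0 1 0 = 0" "skip 0 0 0 = 1" by (simp_all add: skip_def)
  show "d \<in> Desc G" using row(1) by simp
  show "d' \<in> Desc G" using row'(1) by simp
  show "sact (Tot G) 0 1 (skip 0 1) (tot_of 1 V E A) = desc_tot G d"
    unfolding tot_of_sact[OF skip] desc_tot_def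
    by (rule tot_of_cong) (unfold grid_0, auto simp only: s row le0)
  show "sact (Tot G) 0 1 (skip 0 0) (tot_of 1 V E A) = desc_tot G d'"
    unfolding tot_of_sact[OF skip] desc_tot_def
    by (rule tot_of_cong) (unfold grid_0, auto simp only: s row' order_refl)
qed

text \<open>The vertical edge in degree 0 is \<open>f\<close>, and the two triangles of the square in degree 1 give \<open>c\<close>. Naturality
  identifies the vertical edges and squares in degree 2 with the images of \<open>f\<close> and \<open>c\<close>.\<close>

lemma gauge_of_edge:
  assumes "T \<in> simp (Tot G) 1"
  shows "\<exists>d d'. (d, d') \<in> gauge_rel G \<and>
    sact (Tot G) 0 1 (skip 0 1) T = desc_tot G d \<and> sact (Tot G) 0 1 (skip 0 0) T = desc_tot G d'"
proof -
  \<comment> \<open>the degree must stay the literal 1 for the typing rules in that degree to apply\<close>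
  note One_nat_def [simp del]
  obtain V E A where fam: "pseudofunctor_family G 1 V E A" and T: "T = tot_of 1 V E A"
    using Tot_simplex_is_tot_of[OF cosimplicial_two_groupoid_axioms assms] by blast
  define d where d: "d = (V 0 (0, 0), E 1 (0, 0) (1, 0), A 2 (0, 0) (1, 0) (2, 0))"
  define d' where d': "d' = (V 0 (0, 1), E 1 (0, 1) (1, 1), A 2 (0, 1) (1, 1) (2, 1))"
  note rows = tot_of_rows[OF fam d d']
  note psf = pseudofunctor_familyD(1)[OF fam] and nat = pseudofunctor_familyD(2-4)[OF fam]
  have gr [simp]: "grid p 1 (i, s) (j, t) \<longleftrightarrow> i \<le> j \<and> j \<le> p \<and> s \<le> t \<and> t \<le> 1" for p i j s t
    by (auto simp: grid_def chain_def)
  interpret P1: normal_pseudofunctor "deg G 1" "grid 1 1" "V 1" "E 1" "A 1" by (rule psf)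
  let ?f = "E 0 (0, 0) (0, 1)"
  let ?t = "A 1 (0, 0) (1, 0) (1, 1)" and ?t' = "A 1 (0, 0) (0, 1) (1, 1)"
  obtain b where b: "b \<in> Hom2 (deg G 1) (tgt2 (deg G 1) ?t) (src2 (deg G 1) ?t)"
      "b \<star>\<^bsub>deg G 1\<^esub> ?t = id2 (deg G 1) (src2 (deg G 1) ?t)"
    using P1.inverse2[of ?t "src2 (deg G 1) ?t" "tgt2 (deg G 1) ?t"] by (auto simp: Hom2_def)
  let ?c = "?t' \<star>\<^bsub>deg G 1\<^esub> b"
  note [simp] = b(1)[unfolded Hom2_def mem_Collect_eq]
  have c_in: "?c \<in> Hom2 (deg G 1) (E 1 (1, 0) (1, 1) \<odot>\<^bsub>deg G 1\<^esub> E 1 (0, 0) (1, 0))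
      (E 1 (0, 1) (1, 1) \<odot>\<^bsub>deg G 1\<^esub> E 1 (0, 0) (0, 1))"
    by (simp add: Hom2_def)
  \<comment> \<open>this equation determines \<open>?c\<close> and is preserved by 2-functors\<close>
  have ct: "?c \<star>\<^bsub>deg G 1\<^esub> ?t = ?t'" using b(2) by simp
  have f_in: "?f \<in> Hom1 (deg G 0) (V 0 (0, 0)) (V 0 (0, 1))"
    by (rule normal_pseudofunctor.E_in[OF psf]) simp
  have vMf: "vM G p i ?f = E p (i, 0) (i, 1)" if "i \<le> p" for p i
    using nat(2)[OF face_vertex[OF that], of "(0, 0)" "(0, 1)"] by (simp add: vM_def)
  have c12: "eC G 2 r s ?c \<in> Hom2 (deg G 2) (E 2 (s, 0) (s, 1) \<odot>\<^bsub>deg G 2\<^esub> E 2 (r, 0) (s, 0))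
      (E 2 (r, 1) (s, 1) \<odot>\<^bsub>deg G 2\<^esub> E 2 (r, 0) (r, 1))"
    "eC G 2 r s ?c \<star>\<^bsub>deg G 2\<^esub> A 2 (r, 0) (s, 0) (s, 1) = A 2 (r, 0) (r, 1) (s, 1)"
    if rs: "r < s" "s \<le> 2" for r s
  proof -
    note \<theta> = face_edge[OF rs]
    interpret F: strict_two_functor "deg G 1" "deg G 2" "act G 1 2 (face 1 (pick r s s s))"
      by (rule act_functor[OF \<theta>])
    note E = nat(2)[OF \<theta>, symmetric] and A = nat(3)[OF \<theta>, symmetric]
    show "eC G 2 r s ?c \<in> Hom2 (deg G 2) (E 2 (s, 0) (s, 1) \<odot>\<^bsub>deg G 2\<^esub> E 2 (r, 0) (s, 0))
      (E 2 (r, 1) (s, 1) \<odot>\<^bsub>deg G 2\<^esub> E 2 (r, 0) (r, 1))"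
      using F.on_cell_closed[OF c_in] by (simp add: eC_def E del: F.on_comp(2))
    show "eC G 2 r s ?c \<star>\<^bsub>deg G 2\<^esub> A 2 (r, 0) (s, 0) (s, 1) = A 2 (r, 0) (r, 1) (s, 1)"
      using arg_cong[OF ct, of "on_cell (act G 1 2 (face 1 (pick r s s s)))"]
        F.on_vcomp[of ?t _ _ ?c] c_in A[of "(0, 0)" "(1, 0)" "(1, 1)"] A[of "(0, 0)" "(0, 1)" "(1, 1)"]
      by (simp add: eC_def Hom2_def del: F.on_comp(2))
  qed
  have "prism (deg G 2) (E 2 (0, 0) (0, 1)) (E 2 (2, 0) (2, 1)) (E 2 (0, 0) (1, 0)) (E 2 (1, 1) (2, 1))
    (A 2 (0, 0) (1, 0) (2, 0)) (A 2 (0, 1) (1, 1) (2, 1)) (eC G 2 0 1 ?c) (eC G 2 0 2 ?c) (eC G 2 1 2 ?c)"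
    by (rule prism_of_cylinder[OF psf]) (simp_all add: c12)
  moreover have "eM G 2 0 1 (E 1 (0, 0) (1, 0)) = E 2 (0, 0) (1, 0)"
    "eM G 2 1 2 (E 1 (0, 1) (1, 1)) = E 2 (1, 1) (2, 1)"
    using nat(2)[OF face_edge[of 0 1 2], of "(0, 0)" "(1, 0)"] nat(2)[OF face_edge[of 1 2 2], of "(0, 1)" "(1, 1)"]
    by (simp_all add: eM_def)
  ultimately have "(?f, ?c) \<in> gauge G d d'"
    using f_in c_in unfolding d d' gauge_iff by (simp add: vMf)
  then have "(d, d') \<in> gauge_rel G" using rows(1,2) by (auto simp: gauge_rel_def)
  with rows(3,4) show ?thesis unfolding T by blast
qed

text \<open>In each degree the images of \<open>f\<close> and \<open>c\<close> connect the two pseudofunctors by a cylinder. The cylinder is built from them by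
  compositions and identities, which 2-functors preserve, so these cylinders form a natural family.\<close>

lemma edge_of_gauge:
  assumes "(d, d') \<in> gauge_rel G"
  shows "\<exists>T\<in>simp (Tot G) 1.
    sact (Tot G) 0 1 (skip 0 1) T = desc_tot G d \<and> sact (Tot G) 0 1 (skip 0 0) T = desc_tot G d'"
proof -
  note One_nat_def [simp del]
  obtain x g a x' g' a' where dd [simp]: "d = (x, g, a)" "d' = (x', g', a')" by (metis prod_cases3)
  have D: "d \<in> Desc G" "d' \<in> Desc G" using assms by (auto simp: gauge_rel_def)
  note D' = D[unfolded dd]
  obtain f c where fc: "(f, c) \<in> gauge G d d'" using assms by (auto simp: gauge_rel_def)
  have f: "f \<in> Hom1 (deg G 0) x x'"
    and c: "c \<in> Hom2 (deg G 1) (vM G 1 1 f \<odot>\<^bsub>deg G 1\<^esub> g) (g' \<odot>\<^bsub>deg G 1\<^esub> vM G 1 0 f)"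
    and P: "prism (deg G 2) (vM G 2 0 f) (vM G 2 2 f) (eM G 2 0 1 g) (eM G 2 1 2 g') a a'
       (eC G 2 0 1 c) (eC G 2 0 2 c) (eC G 2 1 2 c)"
    using fc by (simp_all add: gauge_iff)
  have fM: "f \<in> Mor (deg G 0)" using f by (simp add: Hom1_def)
  have cC: "c \<in> Cell (deg G 1)" using c by (simp add: Hom2_def)
  define e where "e p i j = (if i < j then eC G p i j c else id2 (deg G p) (vM G p i f))" for p i j
  define V where "V p = cyl_vert (desc_vert G d p) (desc_vert G d' p)" for p
  define E where "E p = cyl_edge (deg G p) (desc_edge G d p) (desc_edge G d' p) (\<lambda>i. vM G p i f)" for p
  define A where "A p = cyl_tri (deg G p) (desc_edge G d p) (desc_tri G d p) (desc_tri G d' p)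
      (\<lambda>i. vM G p i f) (e p)" for p
  have f_in: "vM G p i f \<in> Hom1 (deg G p) (desc_vert G d p i) (desc_vert G d' p i)" if "i \<le> p" for p i
    using vM_in[OF f that] by (simp add: desc_vert_def)
  have e_in: "e p i j \<in> Hom2 (deg G p) (vM G p j f \<odot>\<^bsub>deg G p\<^esub> desc_edge G d p i j)
      (desc_edge G d' p i j \<odot>\<^bsub>deg G p\<^esub> vM G p i f)" if "i < j" "j \<le> p" for p i j
    using gauge_eC_in[OF D' f c that] that by (simp add: e_def desc_edge_def)
  have psf: "normal_pseudofunctor (deg G p) (grid p 1) (V p) (E p) (A p)" for p
    unfolding V_def E_def A_def
  proof (rule cylinder[OF desc_pseudofunctor[OF D(1)] desc_pseudofunctor[OF D(2)] f_in e_in])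
    show "e p i i = id2 (deg G p) (vM G p i f)" for i by (simp add: e_def)
    fix i j k assume "i < j" "j < k" "k \<le> p"
    then show "prism (deg G p) (vM G p i f) (vM G p k f) (desc_edge G d p i j) (desc_edge G d' p j k)
        (desc_tri G d p i j k) (desc_tri G d' p i j k) (e p i j) (e p i k) (e p j k)"
      using gauge_prism[OF D' f c P, of i j k p] by (simp add: e_def desc_edge_def desc_tri_def)
  qed
  have nat: "grid p 1 u u \<longrightarrow> V q (push \<theta> u) = on_obj (act G p q \<theta>) (V p u)"
    "grid p 1 u v \<longrightarrow> E q (push \<theta> u) (push \<theta> v) = on_mor (act G p q \<theta>) (E p u v)"
    "grid p 1 u v \<longrightarrow> grid p 1 v w \<longrightarrow>
       A q (push \<theta> u) (push \<theta> v) (push \<theta> w) = on_cell (act G p q \<theta>) (A p u v w)"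
    if \<theta>: "\<theta> \<in> Delta_r p q" for p q \<theta> u v w
  proof -
    interpret D: normal_pseudofunctor "deg G p" "chain p" "desc_vert G d p" "desc_edge G d p" "desc_tri G d p"
      by (rule desc_pseudofunctor[OF D(1)])
    interpret D': normal_pseudofunctor "deg G p" "chain p" "desc_vert G d' p" "desc_edge G d' p" "desc_tri G d' p"
      by (rule desc_pseudofunctor[OF D(2)])
    interpret F: strict_two_functor "deg G p" "deg G q" "act G p q \<theta>" by (rule act_functor[OF \<theta>])
    have f' [simp]: "vM G p i f \<in> Mor (deg G p)" "src (deg G p) (vM G p i f) = desc_vert G d p i"
        "tgt (deg G p) (vM G p i f) = desc_vert G d' p i" if "i \<le> p" for i
      using f_in[OF that] by (auto simp: Hom1_def)
    have e_nat: "e q (\<theta> i) (\<theta> j) = on_cell (act G p q \<theta>) (e p i j)" if "i \<le> j" "j \<le> p" for i j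
    proof (cases "i < j")
      case True
      then show ?thesis using act_eC[OF \<theta> cC True that(2)] Delta_r_strict[OF \<theta> True that(2)]
        by (simp add: e_def)
    next
      case False
      then have "i = j" using that by simp
      then show ?thesis using that act_vM[OF \<theta> fM, of j] by (simp add: e_def)
    qed
    have e' [simp]: "e p i j \<in> Cell (deg G p)"
        "src2 (deg G p) (e p i j) = vM G p j f \<odot>\<^bsub>deg G p\<^esub> desc_edge G d p i j" if "i \<le> j" "j \<le> p" for i j
    proof -
      have "e p i j \<in> Cell (deg G p) \<and> src2 (deg G p) (e p i j) = vM G p j f \<odot>\<^bsub>deg G p\<^esub> desc_edge G d p i j"
      proof (cases "i < j")
        case True
        then show ?thesis using e_in[OF True that(2)] by (simp add: Hom2_def)
      next
        case False
        then have "i = j" using that by simp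
        then show ?thesis using that D.E_id[of j] by (simp add: e_def chain_def)
      qed
      then show "e p i j \<in> Cell (deg G p)"
        "src2 (deg G p) (e p i j) = vM G p j f \<odot>\<^bsub>deg G p\<^esub> desc_edge G d p i j" by auto
    qed
    note [simp] = act_vM[OF \<theta> fM] e_nat[symmetric] desc_natural[OF D(1) \<theta>, symmetric] desc_natural[OF D(2) \<theta>, symmetric]
    show "grid p 1 u u \<longrightarrow> V q (push \<theta> u) = on_obj (act G p q \<theta>) (V p u)"
      by (auto simp: V_def cyl_vert_def grid_def chain_def simp del: dd)
    show "grid p 1 u v \<longrightarrow> E q (push \<theta> u) (push \<theta> v) = on_mor (act G p q \<theta>) (E p u v)"
      by (auto simp: E_def cyl_edge_def grid_def chain_def simp del: dd)
    show "grid p 1 u v \<longrightarrow> grid p 1 v w \<longrightarrow>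
       A q (push \<theta> u) (push \<theta> v) (push \<theta> w) = on_cell (act G p q \<theta>) (A p u v w)"
      by (auto simp: A_def cyl_tri_def grid_def chain_def simp del: dd)
  qed
  have fam: "pseudofunctor_family G 1 V E A"
    unfolding pseudofunctor_family_def using psf nat by blast
  have "d = (V 0 (0, 0), E 1 (0, 0) (1, 0), A 2 (0, 0) (1, 0) (2, 0))"
    "d' = (V 0 (0, 1), E 1 (0, 1) (1, 1), A 2 (0, 1) (1, 1) (2, 1))"
    using desc_top[OF D(1)] desc_top[OF D(2)]
    by (simp_all add: V_def E_def A_def cyl_vert_def cyl_edge_def cyl_tri_def del: dd)
  from tot_of_rows(3,4)[OF fam this] tot_of_in_Tot[OF fam] show ?thesis by blast
qed

text \<open>By the two preceding lemmas the edges are the image of the gauge relation, which is already symmetric and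
  transitive. The identity relation appears because the generated relation is reflexive also outside the vertices.\<close>

lemma pi0_rel_Tot: "pi0_rel (Tot G) = map_prod (desc_tot G) (desc_tot G) ` gauge_rel G \<union> Id"
proof -
  let ?S = "map_prod (desc_tot G) (desc_tot G) ` gauge_rel G"
  have "{(sact (Tot G) 0 1 (skip 0 1) e, sact (Tot G) 0 1 (skip 0 0) e) | e. e \<in> simp (Tot G) 1} = ?S"
    (is "?R = _")
  proof (intro equalityI subsetI)
    fix ST assume "ST \<in> ?R"
    then show "ST \<in> ?S" using gauge_of_edge by force
  next
    fix ST assume "ST \<in> ?S"
    then show "ST \<in> ?R" using edge_of_gauge by clarsimp metis
  qed
  then have "pi0_rel (Tot G) = (?S \<union> ?S\<inverse>)\<^sup>*" by (simp add: pi0_rel_def Let_def)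
  also have "?S\<inverse> = ?S"
    using equiv_gauge_rel by (force simp: equiv_def dest: symD)
  also have "(?S \<union> ?S)\<^sup>* = ?S \<union> Id"
  proof -
    have "trans ?S"
    proof (rule transI)
      fix S T U assume "(S, T) \<in> ?S" "(T, U) \<in> ?S"
      then obtain s t t' u where *: "(s, t) \<in> gauge_rel G" "(t', u) \<in> gauge_rel G"
        "S = desc_tot G s" "T = desc_tot G t" "T = desc_tot G t'" "U = desc_tot G u" by auto
      then have "t = t'"
        using bij_betw_desc_tot by (auto simp: bij_betw_def inj_on_def gauge_rel_def)
      then have "(s, u) \<in> gauge_rel G"
        using * equiv_gauge_rel by (auto simp: equiv_def dest: transD)
      then show "(S, U) \<in> ?S" using * by force
    qed
    then show ?thesis by (simp add: rtrancl_trancl_reflcl)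
  qed
  finally show ?thesis .
qed

lemma pi0_rel_desc_tot:
  assumes "D \<subseteq> Desc G"
  shows "pi0_rel (Tot G) `` (desc_tot G ` D) = desc_tot G ` (gauge_rel G `` D)"
proof -
  have inj: "d = d'" if "desc_tot G d = desc_tot G d'" "d \<in> Desc G" "d' \<in> Desc G" for d d'
    using bij_betw_desc_tot that by (auto simp: bij_betw_def inj_on_def)
  show ?thesis
  proof (intro equalityI subsetI)
    fix T assume "T \<in> pi0_rel (Tot G) `` (desc_tot G ` D)"
    then obtain d where d: "d \<in> D" "(desc_tot G d, T) \<in> pi0_rel (Tot G)" by blast
    then consider "T = desc_tot G d"
      | e e' where "(e, e') \<in> gauge_rel G" "desc_tot G d = desc_tot G e" "T = desc_tot G e'"
      unfolding pi0_rel_Tot by auto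
    then show "T \<in> desc_tot G ` (gauge_rel G `` D)"
    proof cases
      case 1
      have "(d, d) \<in> gauge_rel G"
        using equiv_gauge_rel d(1) assms by (auto simp: equiv_def refl_on_def)
      then show ?thesis using 1 d(1) by blast
    next
      case 2
      moreover have "e \<in> Desc G" "d \<in> Desc G" using 2(1) d(1) assms by (auto simp: gauge_rel_def)
      ultimately have "d = e" using inj by blast
      then show ?thesis using 2 d(1) by blast
    qed
  next
    fix T assume "T \<in> desc_tot G ` (gauge_rel G `` D)"
    then obtain d d' where d: "d \<in> D" "(d, d') \<in> gauge_rel G" "T = desc_tot G d'" by blast
    have "(desc_tot G d, T) \<in> pi0_rel (Tot G)"
      unfolding pi0_rel_Tot d(3) using map_prod_imageI[OF d(2)] by blast
    then show "T \<in> pi0_rel (Tot G) `` (desc_tot G ` D)" using d(1) by blast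
  qed
qed

lemma bij_betw_classes: "bij_betw ((`) (desc_tot G)) (Desc_bar G) (pi0 (Tot G))"
proof (rule bij_betw_imageI)
  have "Desc_bar G \<subseteq> Pow (Desc G)"
    using equiv_gauge_rel by (auto simp: Desc_bar_def quotient_def gauge_rel_def)
  then show "inj_on ((`) (desc_tot G)) (Desc_bar G)"
    using inj_on_image_Pow[of "desc_tot G" "Desc G"] bij_betw_desc_tot
    by (auto simp: bij_betw_def intro: inj_on_subset)
  have "pi0 (Tot G) = (\<lambda>d. pi0_rel (Tot G) `` {desc_tot G d}) ` Desc G"
    unfolding pi0_def quotient_def bij_betw_imp_surj_on[OF bij_betw_desc_tot, symmetric] by blast
  also have "\<dots> = (\<lambda>d. desc_tot G ` (gauge_rel G `` {d})) ` Desc G"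
    using pi0_rel_desc_tot[of "{d}" for d] by (intro image_cong) auto
  also have "\<dots> = (`) (desc_tot G) ` Desc_bar G"
    by (auto simp: Desc_bar_def quotient_def)
  finally show "(`) (desc_tot G) ` Desc_bar G = pi0 (Tot G)" by simp
qed

end

section \<open>Naturality\<close>

lemma Tot_r_map_tot_of:
  "Tot_r_map (\<lambda>p. nerve_map (F p)) n (tot_of n V E A) =
    tot_of n (\<lambda>p u. on_obj (F p) (V p u)) (\<lambda>p u v. on_mor (F p) (E p u v))
      (\<lambda>p u v w. on_cell (F p) (A p u v w))"
proof (rule ext, rule ext)
  fix p k
  show "Tot_r_map (\<lambda>p. nerve_map (F p)) n (tot_of n V E A) p k =
    tot_of n (\<lambda>p u. on_obj (F p) (V p u)) (\<lambda>p u v. on_mor (F p) (E p u v))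
      (\<lambda>p u v w. on_cell (F p) (A p u v w)) p k"
    unfolding tot_of_def Tot_r_map_def nerve_map_def cosk_map_def
    by (auto simp: Tot_dom_def cosimp_prod_def const_cosimp_def restr_def std_cosimp_def
        sset_prod_def std_simplex_def nerve_data_map_nsimplex intro!: restrict_ext)
qed

context cosimplicial_two_functor
begin

lemma component_act:
  assumes "\<theta> \<in> Delta_r m n"
  shows "x \<in> Obj (deg G m) \<Longrightarrow>
      on_obj (F n) (on_obj (act G m n \<theta>) x) = on_obj (act H m n \<theta>) (on_obj (F m) x)"
    "f \<in> Mor (deg G m) \<Longrightarrow>
      on_mor (F n) (on_mor (act G m n \<theta>) f) = on_mor (act H m n \<theta>) (on_mor (F m) f)"
    "a \<in> Cell (deg G m) \<Longrightarrow>
      on_cell (F n) (on_cell (act G m n \<theta>) a) = on_cell (act H m n \<theta>) (on_cell (F m) a)"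
  using natural[OF Delta_r_Delta[OF assms]] by (auto simp: two_functor_eq_def two_functor_comp_def)

definition on_desc :: "'o \<times> 'm \<times> 'c \<Rightarrow> 'o \<times> 'm \<times> 'c" where
  "on_desc = (\<lambda>(x, g, a). (on_obj (F 0) x, on_mor (F 1) g, on_cell (F 2) a))"

context
  fixes x g a
  assumes d: "(x, g, a) \<in> Desc G"
begin

lemma component_vO: "i \<le> p \<Longrightarrow> on_obj (F p) (vO G p i x) = vO H p i (on_obj (F 0) x)"
  and component_eM: "\<lbrakk>i < j; j \<le> p\<rbrakk> \<Longrightarrow> on_mor (F p) (eM G p i j g) = eM H p i j (on_mor (F 1) g)"
  and component_tC: "\<lbrakk>i < j; j < k; k \<le> p\<rbrakk>
    \<Longrightarrow> on_cell (F p) (tC G p i j k a) = tC H p i j k (on_cell (F 2) a)"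
  unfolding vO_def eM_def tC_def
  using component_act(1)[OF face_vertex G.desc_x[OF d]] component_act(2)[OF face_edge G.desc_g_Mor[OF d]]
    component_act(3)[OF face_triangle G.desc_a_Cell[OF d]]
  by simp_all

lemma on_desc_in: "(on_obj (F 0) x, on_mor (F 1) g, on_cell (F 2) a) \<in> Desc H"
  unfolding H.Desc_iff
proof (intro conjI)
  interpret F0: strict_two_functor "deg G 0" "deg H 0" "F 0" by (rule component)
  interpret F1: strict_two_functor "deg G 1" "deg H 1" "F 1" by (rule component)
  interpret F2: strict_two_functor "deg G 2" "deg H 2" "F 2" by (rule component)
  interpret F3: strict_two_functor "deg G 3" "deg H 3" "F 3" by (rule component)
  show "on_obj (F 0) x \<in> Obj (deg H 0)" using G.desc_x[OF d] by simp
  show "on_mor (F 1) g \<in> Hom1 (deg H 1) (vO H 1 0 (on_obj (F 0) x)) (vO H 1 1 (on_obj (F 0) x))"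
    using F1.on_mor_closed[OF G.desc_g[OF d]] component_vO[of 0 1] component_vO[of 1 1] by simp
  show "on_cell (F 2) a \<in> Hom2 (deg H 2) (eM H 2 0 2 (on_mor (F 1) g))
     (eM H 2 1 2 (on_mor (F 1) g) \<odot>\<^bsub>deg H 2\<^esub> eM H 2 0 1 (on_mor (F 1) g))"
    using F2.on_cell_closed[OF G.desc_a[OF d]] F2.on_comp1[OF G.desc_eM_in[OF d, of 0 1] G.desc_eM_in[OF d, of 1 2]]
      component_eM[of 0 1 2] component_eM[of 0 2 2] component_eM[of 1 2 2] by simp
  from F3.on_cocycle[OF G.desc_eM_in[OF d] G.desc_eM_in[OF d] G.desc_eM_in[OF d] G.desc_eM_in[OF d]
      G.desc_eM_in[OF d] G.desc_eM_in[OF d] G.desc_tC_in[OF d] G.desc_tC_in[OF d] G.desc_tC_in[OF d]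
      G.desc_tC_in[OF d] G.desc_cocycle[OF d, of 0 1 2 3]]
  show "(id2 (deg H 3) (eM H 3 2 3 (on_mor (F 1) g)) \<diamondop>\<^bsub>deg H 3\<^esub> tC H 3 0 1 2 (on_cell (F 2) a))
      \<star>\<^bsub>deg H 3\<^esub> tC H 3 0 2 3 (on_cell (F 2) a) =
    (tC H 3 1 2 3 (on_cell (F 2) a) \<diamondop>\<^bsub>deg H 3\<^esub> id2 (deg H 3) (eM H 3 0 1 (on_mor (F 1) g)))
      \<star>\<^bsub>deg H 3\<^esub> tC H 3 0 1 3 (on_cell (F 2) a)"
    using component_eM[of 0 1 3] component_eM[of 2 3 3] component_tC[of 0 1 2 3] component_tC[of 0 2 3 3]
      component_tC[of 1 2 3 3] component_tC[of 0 1 3 3] by simp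
qed

end

text \<open>Both sides are families of pseudofunctors built from images of \<open>x\<close>, \<open>g\<close> and \<open>a\<close> under injections and from identities.
  The 2-functors commute with the former by naturality and preserve the latter.\<close>

lemma Tot_map_desc_tot:
  assumes "d \<in> Desc G"
  shows "Tot_r_map (\<lambda>p. nerve_map (F p)) 0 (desc_tot G d) = desc_tot H (on_desc d)"
proof -
  obtain x g a where d: "d = (x, g, a)" "(x, g, a) \<in> Desc G" using assms by (cases d) auto
  have V: "on_obj (F p) (desc_vert G d p i) = desc_vert H (on_desc d) p i" if "i \<le> p" for p i
    using component_vO[OF d(2) that] by (simp add: desc_vert_def d on_desc_def)
  have E: "on_mor (F p) (desc_edge G d p i j) = desc_edge H (on_desc d) p i j" if "i \<le> j" "j \<le> p" for p i j
    using component_eM[OF d(2), of i j p] that V[of i p]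
      strict_two_functor.on_id1[OF component, of "desc_vert G d p i" p] G.vO_in[OF G.desc_x[OF d(2)], of i p]
    by (auto simp: desc_edge_def desc_vert_def d on_desc_def)
  have A: "on_cell (F p) (desc_tri G d p i j k) = desc_tri H (on_desc d) p i j k"
    if "i \<le> j" "j \<le> k" "k \<le> p" for p i j k
  proof (cases "i < j \<and> j < k")
    case True
    then show ?thesis using component_tC[OF d(2), of i j k p] that by (simp add: desc_tri_def d on_desc_def)
  next
    case False
    have "desc_edge G d p i k \<in> Mor (deg G p)"
      using normal_pseudofunctor.E_typing(1)[OF G.desc_pseudofunctor[OF assms], of p i k] that
      by (simp add: chain_def)
    then show ?thesis using False E[of i k p] that strict_two_functor.on_id2[OF component, of "desc_edge G d p i k" p]
      unfolding desc_tri_def by (simp only: if_not_P) simp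
  qed
  show ?thesis
    unfolding desc_tot_def Tot_r_map_tot_of
    by (rule tot_of_cong) (unfold grid_0, simp_all add: V E A)
qed

lemma classes_natural:
  assumes "D \<in> Desc_bar G"
  shows "desc_tot H ` Desc_bar_map H F D = pi0_Tot_map H F (desc_tot G ` D)"
proof -
  have D: "D \<subseteq> Desc G"
    using assms by (auto simp: Desc_bar_def quotient_def gauge_rel_def)
  have "on_desc ` D \<subseteq> Desc H"
    using D on_desc_in by (auto simp: on_desc_def)
  from H.pi0_rel_desc_tot[OF this]
  have "desc_tot H ` Desc_bar_map H F D = pi0_rel (Tot H) `` (desc_tot H ` on_desc ` D)"
    by (simp add: Desc_bar_map_def on_desc_def)
  also have "desc_tot H ` on_desc ` D = Tot_r_map (\<lambda>p. nerve_map (F p)) 0 ` desc_tot G ` D"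
    using Tot_map_desc_tot D by (force simp: image_iff)
  finally show ?thesis by (simp add: pi0_Tot_map_def pi0_map_def)
qed

end

theorem theorem5p3:
  shows "\<exists>\<Phi> :: ('o, 'm, 'c) cosimp_two_groupoid \<Rightarrow> ('o \<times> 'm \<times> 'c) set
             \<Rightarrow> ('o, 'm, 'c) cosk_simplex tot_simplex set.
    (\<forall>G. cosimplicial_two_groupoid G \<longrightarrow>
       bij_betw (\<Phi> G) (Desc_bar G) (pi0 (Tot_r (restr (nerve_cosimp G))))) \<and>
    (\<forall>G H F. cosimplicial_two_functor G H F \<longrightarrow>
       (\<forall>D\<in>Desc_bar G. \<Phi> H (Desc_bar_map H F D) = pi0_Tot_map H F (\<Phi> G D)))"
proof (intro exI conjI allI impI ballI)
  fix G :: "('o, 'm, 'c) cosimp_two_groupoid"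
  assume "cosimplicial_two_groupoid G"
  then show "bij_betw ((`) (desc_tot G)) (Desc_bar G) (pi0 (Tot G))"
    by (rule cosimplicial_two_groupoid.bij_betw_classes)
next
  fix G H :: "('o, 'm, 'c) cosimp_two_groupoid" and F D
  assume "cosimplicial_two_functor G H F" "D \<in> Desc_bar G"
  then show "desc_tot H ` Desc_bar_map H F D = pi0_Tot_map H F (desc_tot G ` D)"
    by (rule cosimplicial_two_functor.classes_natural)
qed

end
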